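(* Let $\Theta\subset\mathbb{R}^d$ be open, convex and bounded, and let $X_0,X_1,\ldots$ satisfy $$X_j=S(\vartheta,X_{j-1})+\varepsilon_j,\qquad j\ge 1,$$ where $(\varepsilon_j)_{j\ge1}$ are i.i.d. with known density $g$ and $\vartheta\in\Theta$ is unknown. Let $\ell(\vartheta,x,x')=\ln g\big(x'-S(\vartheta,x)\big)$ and let $\mathbb{I}(\vartheta)=\mathbf{E}_\vartheta\big[\dot\ell(\vartheta,X_0,X_1)\dot\ell(\vartheta,X_0,X_1)^{\mathbb{T}}\big]$ be the Fisher information matrix. Assume Conditions $\mathcal{R}$ (stated in the context) hold. Let $\frac14<\delta\le\frac12$, $N=[n^\delta]$, and let $\bar\vartheta_N$ be a preliminary estimator, i.e. a function of $X_0,\ldots,X_N$, such that $\sqrt{N}(\bar\vartheta_N-\vartheta)$ is tight uniformly on compacts $\mathbb{K}\subset\Theta$. For $s\in(\tau_\delta,1]$, $\tau_\delta=n^{-1+\delta}$, put $k=[sn]$, $$\Delta_k(\vartheta,X^k)=\frac{1}{\sqrt{k}}\sum_{j=1}^{k}\dot\ell(\vartheta,X_{j-1},X_j),$$ define the second preliminary estimator-process $$\bar\vartheta_{k,2}=\bar\vartheta_N+\frac{1}{\sqrt{k}}\,\mathbb{I}(\bar\vartheta_N)^{-1}\Delta_k(\bar\vartheta_N,X^k),\qquad k=N+1,\ldots,n,$$ and the two-step MLE-process $$\vartheta^{\star\star}_{s,n}=\bar\vartheta_{k,2}+\frac{1}{\sqrt{k}}\,\mathbb{I}(\bar\vartheta_{k,2})^{-1}\Delta_k(\bar\vartheta_{k,2},X^k).$$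 Then for every $s\in(0,1]$, as $n\to\infty$, $$\sqrt{k}\,(\vartheta^{\star\star}_{s,n}-\vartheta)\Longrightarrow\mathcal{N}\big(0,\mathbb{I}(\vartheta)^{-1}\big),$$ and this estimator is asymptotically efficient for bounded loss functions, i.e. for every $\vartheta_0\in\Theta$ and every bounded loss function $W$, $$\lim_{\rho\to0}\lim_{n\to\infty}\sup_{|\vartheta-\vartheta_0|<\rho}\mathbf{E}_\vartheta W\big(\sqrt{k}(\vartheta^{\star\star}_{s,n}-\vartheta)\big)=\mathbf{E}\,W\big(\zeta\,\mathbb{I}(\vartheta_0)^{-1/2}\big),$$ where $\zeta\sim\mathcal{N}(0,\mathbb{J})$ with $\mathbb{J}$ the $d\times d$ identity matrix.
   Context: $[a]$ denotes the integer part of $a$; a dot denotes differentiation with respect to $\vartheta$, $\mathbb{T}$ denotes transpose, and $\mathbf{P}_\vartheta,\mathbf{E}_\vartheta$ refer to the law of the process under parameter $\vartheta$. A family of random variables $\eta_n(\vartheta)$ is tight uniformly on compacts $\mathbb{K}\subset\Theta$ if for every $\varepsilon>0$ and every compact $\mathbb{K}$ there exists $C>0$ with $\sup_{\vartheta\in\mathbb{K}}\mathbf{P}_\vartheta(|\eta_n(\vartheta)|>C)\le\varepsilon$ for all $n$. A loss function $W:\mathbb{R}^d\to[0,\infty)$ is understood in the usual sense of Ibragimov–Has'minskii (e.g. $W(0)=0$, symmetric, continuous, with convex sublevel sets). Conditions $\mathcal{R}$: (1) The time series $(X_j)_{j\ge0}$ is strictly stationary and has a unique invariant distribution with density $\pi(\vartheta,x)$.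 (2) The preliminary estimator has the tightness property stated in the claim. (3) $S(\vartheta,x)$ is three times continuously differentiable in $\vartheta$, $g>0$ and $g\in\mathcal{C}^3$; the derivatives $\partial^i\ell(\vartheta,x,x')/\partial\vartheta^i$, $i=1,2,3$, satisfy $\sup_{\vartheta\in\Theta}\|\partial^i\ell(\vartheta,x,x')/\partial\vartheta^i\|\le R_i(x,x')$ with $\mathbf{E}_\vartheta|R_i(X_{j-1},X_j)|^2<C$, the constant $C>0$ not depending on $\vartheta$. (4) The law of large numbers $\frac1n\sum_{j=1}^n\dot\ell(\vartheta,X_{j-1},X_j)\dot\ell(\vartheta,X_{j-1},X_j)^{\mathbb{T}}\to\mathbb{I}(\vartheta)$ holds; the central limit theorem $\frac1{\sqrt n}\sum_{j=1}^n\dot\ell(\vartheta,X_{j-1},X_j)\Rightarrow\mathcal{N}(0,\mathbb{I}(\vartheta))$ holds; and the family $\frac1{\sqrt n}\sum_{j=1}^n[\ddot\ell(\vartheta,X_{j-1},X_j)+\mathbb{I}(\vartheta)]$ is tight uniformly on compacts $\mathbb{K}\subset\Theta$. (5) $\mathbb{I}$ is Lipschitz, $|\mathbb{I}(\vartheta_1)-\mathbb{I}(\vartheta_2)|\le L|\vartheta_1-\vartheta_2|$, and uniformly non-degenerate and bounded: $0<\inf_{\vartheta\in\Theta}\inf_{|\lambda|=1}\lambda^{\mathbb{T}}\mathbb{I}(\vartheta)\lambda$ and $\sup_{\vartheta\in\Theta}\sup_{|\lambda|=1}\lambda^{\mathbb{T}}\mathbb{I}(\vartheta)\lambda<\infty$,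 $\lambda\in\mathbb{R}^d$. *)

theory Defs
  imports "HOL-Probability.Probability"
begin

text \<open>A trajectory is a real sequence; the observation X_j is the coordinate j.\<close>
definition path_space :: "(nat \<Rightarrow> real) measure" where
  "path_space = Pi\<^sub>M UNIV (\<lambda>_. borel)"

definition grad :: "(real^'d \<Rightarrow> real) \<Rightarrow> real^'d \<Rightarrow> real^'d" where
  "grad f t = (\<chi> i. frechet_derivative f (at t) (axis i 1))"

definition third_deriv :: "(real^'d \<Rightarrow> real) \<Rightarrow> real^'d \<Rightarrow> real^'d^'d^'d" where
  "third_deriv f t = (\<chi> i j k. frechet_derivative (\<lambda>u. jacobian (grad f) (at u)) (at t) (axis k 1) $ i $ j)"

definition C3_on :: "(real^'d) set \<Rightarrow> (real^'d \<Rightarrow> real) \<Rightarrow> bool" where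
  "C3_on T f \<longleftrightarrow>
     (\<forall>t\<in>T. f differentiable (at t) \<and> grad f differentiable (at t)
           \<and> (\<lambda>u. jacobian (grad f) (at u)) differentiable (at t))
     \<and> continuous_on T (third_deriv f)"

definition C3_real :: "(real \<Rightarrow> real) \<Rightarrow> bool" where
  "C3_real g \<longleftrightarrow> (\<forall>k<3. \<forall>x. (deriv ^^ k) g differentiable (at x))
                 \<and> continuous_on UNIV ((deriv ^^ 3) g)"

definition ell :: "(real^'d \<Rightarrow> real \<Rightarrow> real) \<Rightarrow> (real \<Rightarrow> real) \<Rightarrow> real^'d \<Rightarrow> real \<Rightarrow> real \<Rightarrow> real" where
  "ell S g t x x' = ln (g (x' - S t x))"

definition ldot :: "(real^'d \<Rightarrow> real \<Rightarrow> real) \<Rightarrow> (real \<Rightarrow> real) \<Rightarrow> real^'d \<Rightarrow> real \<Rightarrow> real \<Rightarrow> real^'d" where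
  "ldot S g t x x' = grad (\<lambda>u. ell S g u x x') t"

definition lddot :: "(real^'d \<Rightarrow> real \<Rightarrow> real) \<Rightarrow> (real \<Rightarrow> real) \<Rightarrow> real^'d \<Rightarrow> real \<Rightarrow> real \<Rightarrow> real^'d^'d" where
  "lddot S g t x x' = jacobian (\<lambda>u. ldot S g u x x') (at t)"

definition l3dot :: "(real^'d \<Rightarrow> real \<Rightarrow> real) \<Rightarrow> (real \<Rightarrow> real) \<Rightarrow> real^'d \<Rightarrow> real \<Rightarrow> real \<Rightarrow> real^'d^'d^'d" where
  "l3dot S g t x x' = third_deriv (\<lambda>u. ell S g u x x') t"

definition fisher :: "(real^'d \<Rightarrow> (nat \<Rightarrow> real) measure) \<Rightarrow> (real^'d \<Rightarrow> real \<Rightarrow> real) \<Rightarrow> (real \<Rightarrow> real)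
                       \<Rightarrow> real^'d \<Rightarrow> real^'d^'d" where
  "fisher P S g t = (\<chi> i j. \<integral>\<omega>. ldot S g t (\<omega> 0) (\<omega> 1) $ i * ldot S g t (\<omega> 0) (\<omega> 1) $ j \<partial>P t)"

definition trans_kernel :: "(real^'d \<Rightarrow> real \<Rightarrow> real) \<Rightarrow> (real \<Rightarrow> real) \<Rightarrow> real^'d \<Rightarrow> real \<Rightarrow> real measure" where
  "trans_kernel S g t x = density lborel (\<lambda>y. ennreal (g (y - S t x)))"

definition invariant_distribution :: "(real^'d \<Rightarrow> real \<Rightarrow> real) \<Rightarrow> (real \<Rightarrow> real) \<Rightarrow> real^'d \<Rightarrow> real measure \<Rightarrow> bool" where
  "invariant_distribution S g t \<mu> \<longleftrightarrow> prob_space \<mu> \<and> sets \<mu> = sets borel \<and>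
     (\<forall>A\<in>sets borel. emeasure \<mu> A = (\<integral>\<^sup>+x. emeasure (trans_kernel S g t x) A \<partial>\<mu>))"

definition std_normal_vec :: "(real^'d) measure" where
  "std_normal_vec = distr (Pi\<^sub>M UNIV (\<lambda>_::'d. density lborel std_normal_density)) borel (\<lambda>z. \<chi> i. z i)"

definition psd_sqrt :: "real^'d^'d \<Rightarrow> real^'d^'d" where
  "psd_sqrt M = (THE A. transpose A = A \<and> (\<forall>v. 0 \<le> v \<bullet> (A *v v)) \<and> A ** A = M)"

definition normal_vec :: "real^'d^'d \<Rightarrow> (real^'d) measure" where
  "normal_vec \<Sigma> = distr std_normal_vec borel (\<lambda>z. psd_sqrt \<Sigma> *v z)"

definition conv_distr :: "'a measure \<Rightarrow> (nat \<Rightarrow> 'a \<Rightarrow> real^'d) \<Rightarrow> (real^'d) measure \<Rightarrow> bool" where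
  "conv_distr M Y \<mu> \<longleftrightarrow>
     (\<forall>f::real^'d \<Rightarrow> real. continuous_on UNIV f \<and> bounded (range f) \<longrightarrow>
        ((\<lambda>n. \<integral>\<omega>. f (Y n \<omega>) \<partial>M) \<longlonglongrightarrow> (\<integral>x. f x \<partial>\<mu>)))"

definition conv_prob :: "'a measure \<Rightarrow> (nat \<Rightarrow> 'a \<Rightarrow> 'b::metric_space) \<Rightarrow> 'b \<Rightarrow> bool" where
  "conv_prob M Y c \<longleftrightarrow>
     (\<forall>e>0. (\<lambda>n. measure M {\<omega>\<in>space M. dist (Y n \<omega>) c > e}) \<longlonglongrightarrow> 0)"

definition unif_tight :: "(real^'d) set \<Rightarrow> (real^'d \<Rightarrow> 'a measure)
                          \<Rightarrow> (nat \<Rightarrow> real^'d \<Rightarrow> 'a \<Rightarrow> 'b::real_normed_vector) \<Rightarrow> bool" where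
  "unif_tight \<Theta> P \<eta> \<longleftrightarrow>
     (\<forall>K. compact K \<and> K \<subseteq> \<Theta> \<longrightarrow>
        (\<forall>e>0. \<exists>C>0. \<forall>n. \<forall>t\<in>K. measure (P t) {\<omega>\<in>space (P t). norm (\<eta> n t \<omega>) > C} \<le> e))"

text \<open>Loss function in the sense of Ibragimov--Has'minskii.\<close>
definition loss_function :: "(real^'d \<Rightarrow> real) \<Rightarrow> bool" where
  "loss_function W \<longleftrightarrow> W 0 = 0 \<and> (\<forall>u. 0 \<le> W u) \<and> (\<forall>u. W (- u) = W u)
     \<and> continuous_on UNIV W \<and> (\<forall>c. convex {u. W u < c})"

definition Nn :: "real \<Rightarrow> nat \<Rightarrow> nat" where
  "Nn \<delta> n = nat \<lfloor>real n powr \<delta>\<rfloor>"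

definition kk :: "real \<Rightarrow> nat \<Rightarrow> nat" where
  "kk s n = nat \<lfloor>s * real n\<rfloor>"

definition Delta :: "(real^'d \<Rightarrow> real \<Rightarrow> real) \<Rightarrow> (real \<Rightarrow> real) \<Rightarrow> nat \<Rightarrow> real^'d \<Rightarrow> (nat \<Rightarrow> real) \<Rightarrow> real^'d" where
  "Delta S g k t \<omega> = (1 / sqrt (real k)) *\<^sub>R (\<Sum>j=1..k. ldot S g t (\<omega> (j - 1)) (\<omega> j))"

definition one_step :: "(real^'d \<Rightarrow> (nat \<Rightarrow> real) measure) \<Rightarrow> (real^'d \<Rightarrow> real \<Rightarrow> real) \<Rightarrow> (real \<Rightarrow> real)
                         \<Rightarrow> nat \<Rightarrow> real^'d \<Rightarrow> (nat \<Rightarrow> real) \<Rightarrow> real^'d" where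
  "one_step P S g k t \<omega> = t + (1 / sqrt (real k)) *\<^sub>R (matrix_inv (fisher P S g t) *v Delta S g k t \<omega>)"

definition theta_k2 :: "(real^'d \<Rightarrow> (nat \<Rightarrow> real) measure) \<Rightarrow> (real^'d \<Rightarrow> real \<Rightarrow> real) \<Rightarrow> (real \<Rightarrow> real)
          \<Rightarrow> (nat \<Rightarrow> (nat \<Rightarrow> real) \<Rightarrow> real^'d) \<Rightarrow> real \<Rightarrow> nat \<Rightarrow> nat \<Rightarrow> (nat \<Rightarrow> real) \<Rightarrow> real^'d" where
  "theta_k2 P S g pre \<delta> n k \<omega> = one_step P S g k (pre (Nn \<delta> n) \<omega>) \<omega>"

definition theta_ss :: "(real^'d \<Rightarrow> (nat \<Rightarrow> real) measure) \<Rightarrow> (real^'d \<Rightarrow> real \<Rightarrow> real) \<Rightarrow> (real \<Rightarrow> real)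
          \<Rightarrow> (nat \<Rightarrow> (nat \<Rightarrow> real) \<Rightarrow> real^'d) \<Rightarrow> real \<Rightarrow> real \<Rightarrow> nat \<Rightarrow> (nat \<Rightarrow> real) \<Rightarrow> real^'d" where
  "theta_ss P S g pre \<delta> s n \<omega> =
     one_step P S g (kk s n) (theta_k2 P S g pre \<delta> n (kk s n) \<omega>) \<omega>"

end

theory Submission
  imports Defs "HOL-Real_Asymp.Real_Asymp"
begin

text \<open>
  Write $\Delta_k(\vartheta)$ for the normalised score. A Taylor expansion of the score at the true
  parameter shows that one scoring step maps a preliminary estimator with error $h$ to one with
  $\sqrt{k}\,(\vartheta' - \vartheta) = \mathbb{I}(\vartheta)^{-1}\Delta_k(\vartheta)
  + O_p(|h| + \sqrt{k}\,|h|^2)$. Starting from $|h| = O_p(n^{-\delta/2})$, the first step yields an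
  error of order $n^{-\delta}$, and since $2\delta > 1/2$ the remainder of the second step vanishes.

  Efficiency needs the central limit theorem for $\Delta_k$ locally uniformly in $\vartheta$,
  whereas Condition (4) only provides it pointwise. It is derived here along arbitrary
  parameter sequences in a compact set. With $J = \int (\ln g)'^2 g$ the score is a martingale with
  increments $-(\ln g)'(\varepsilon_j)\,\dot S(\vartheta, X_{j-1})$ and conditional variance
  $J \dot S \dot S^{\mathbb{T}}$, which is also minus the conditional mean of $\ddot\ell$.
  Hence the uniform tightness of the centred Hessian sums is a uniform law of large numbers for the
  conditional variances, and the second moment bound on $\ddot\ell$ is a fourth moment bound
  on $\dot S$, which replaces the Lindeberg condition.
\<close>

inductive trig_poly :: "('a::real_inner \<Rightarrow> real) \<Rightarrow> bool" where
  cos: "trig_poly (\<lambda>x. cos (l \<bullet> x))"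
| sin: "trig_poly (\<lambda>x. sin (l \<bullet> x))"
| add: "trig_poly p \<Longrightarrow> trig_poly q \<Longrightarrow> trig_poly (\<lambda>x. p x + q x)"
| scale: "trig_poly p \<Longrightarrow> trig_poly (\<lambda>x. c * p x)"

lemma trig_poly_const: "trig_poly (\<lambda>x. c)"
  using trig_poly.scale[OF trig_poly.cos[of 0], of c] by simp

lemma trig_poly_mult_cos:
  assumes "trig_poly p" shows "trig_poly (\<lambda>x. cos (l \<bullet> x) * p x)"
  using assms
proof induction
  case (cos m)
  have "trig_poly (\<lambda>x. 1/2 * (cos ((l - m) \<bullet> x) + cos ((l + m) \<bullet> x)))"
    by (intro trig_poly.intros)
  then show ?case
    by (simp add: cos_times_cos inner_diff_left inner_add_left)
next
  case (sin m)
  have "trig_poly (\<lambda>x. 1/2 * (sin ((m + l) \<bullet> x) + sin ((m - l) \<bullet> x)))"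
    by (intro trig_poly.intros)
  then show ?case
    by (simp add: sin_times_cos inner_diff_left inner_add_left mult.commute[of "cos _" "sin _"])
next
  case (add p q)
  then show ?case using trig_poly.add[OF add.IH] by (simp add: algebra_simps)
next
  case (scale p c)
  then show ?case using trig_poly.scale[OF scale.IH, of c] by (simp add: algebra_simps)
qed

lemma trig_poly_mult_sin:
  assumes "trig_poly p" shows "trig_poly (\<lambda>x. sin (l \<bullet> x) * p x)"
  using assms
proof induction
  case (cos m)
  have "trig_poly (\<lambda>x. 1/2 * (sin ((l + m) \<bullet> x) + sin ((l - m) \<bullet> x)))"
    by (intro trig_poly.intros)
  then show ?case
    by (simp add: sin_times_cos inner_diff_left inner_add_left)
next
  case (sin m)
  have "trig_poly (\<lambda>x. 1/2 * (cos ((l - m) \<bullet> x) + (-1) * cos ((l + m) \<bullet> x)))"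
    by (intro trig_poly.intros)
  then show ?case
    by (simp add: sin_times_sin inner_diff_left inner_add_left)
next
  case (add p q)
  then show ?case using trig_poly.add[OF add.IH] by (simp add: algebra_simps)
next
  case (scale p c)
  then show ?case using trig_poly.scale[OF scale.IH, of c] by (simp add: algebra_simps)
qed

lemma trig_poly_mult:
  assumes "trig_poly p" "trig_poly q" shows "trig_poly (\<lambda>x. p x * q x)"
  using assms
proof (induction)
  case (add p q)
  then show ?case using trig_poly.add by (simp add: algebra_simps)
next
  case (scale p c)
  then show ?case using trig_poly.scale[of _ c] by (simp add: algebra_simps)
qed (auto intro: trig_poly_mult_cos trig_poly_mult_sin)

lemma trig_poly_sum:
  "finite A \<Longrightarrow> (\<And>i. i \<in> A \<Longrightarrow> trig_poly (p i)) \<Longrightarrow> trig_poly (\<lambda>x. \<Sum>i\<in>A. p i x)"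
  by (induction A rule: finite_induct) (auto intro: trig_poly_const trig_poly.add)

lemma trig_poly_polynomial_sin:
  fixes q :: "real^'d \<Rightarrow> real"
  assumes "real_polynomial_function q"
  shows "trig_poly (\<lambda>x::real^'d. q (\<chi> j. sin (x $ j / R)))"
  using assms
proof induction
  case (linear f)
  interpret bounded_linear f by fact
  have "f (\<chi> j. sin (x $ j / R)) = (\<Sum>j\<in>UNIV. f (axis j 1) * sin ((axis j (1/R)) \<bullet> x))" for x
  proof -
    have "(\<chi> j. sin (x $ j / R)) = (\<Sum>j\<in>UNIV. sin (x $ j / R) *\<^sub>R axis j 1)"
      by (simp add: vec_eq_iff axis_def if_distrib sum.delta cong: if_cong)
    then show ?thesis
      by (simp add: sum scale inner_axis' mult.commute)
  qed
  then show ?case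
    by (simp only:) (intro trig_poly_sum trig_poly.intros, simp)
qed (auto intro: trig_poly_const trig_poly.add trig_poly_mult)

text \<open>Composing with the coordinatewise sine makes the approximating polynomial bounded
  on the whole space, not merely on the ball where it approximates $f$.\<close>
lemma trig_poly_approx:
  fixes f :: "real^'d \<Rightarrow> real"
  assumes f: "continuous_on UNIV f" "\<And>x. \<bar>f x\<bar> \<le> B" and "e > 0" "R > 0"
  obtains p where "trig_poly p" "\<And>x. norm x \<le> R \<Longrightarrow> \<bar>f x - p x\<bar> \<le> e" "\<And>x. \<bar>p x\<bar> \<le> B + e"
proof -
  define Q :: "(real^'d) set" where "Q = cbox (-1) 1"
  have Q: "s \<in> Q \<longleftrightarrow> (\<forall>j. -1 \<le> s $ j \<and> s $ j \<le> 1)" for s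
    by (simp add: Q_def mem_box_cart)
  define F where "F s = f (\<chi> j. R * arcsin (s $ j))" for s
  have "continuous_on Q F"
    unfolding F_def
    by (rule continuous_on_compose2[OF f(1)])
       (auto intro!: continuous_intros simp: Q continuous_on_component)
  then obtain q where q: "real_polynomial_function q" "\<And>x. x \<in> Q \<Longrightarrow> \<bar>F x - q x\<bar> < e"
    using Stone_Weierstrass_real_polynomial_function[of Q F e] \<open>e > 0\<close> by (auto simp: Q_def)
  define s :: "real^'d \<Rightarrow> real^'d" where "s x = (\<chi> j. sin (x $ j / R))" for x
  have sQ: "s x \<in> Q" for x by (simp add: Q s_def)
  show ?thesis
  proof
    show "trig_poly (\<lambda>x. q (s x))" unfolding s_def by (rule trig_poly_polynomial_sin) fact
    show "\<bar>f x - q (s x)\<bar> \<le> e" if "norm x \<le> R" for x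
    proof -
      have "arcsin (sin (x $ j / R)) = x $ j / R" for j
      proof (rule arcsin_sin)
        have "\<bar>x $ j\<bar> \<le> R" using component_le_norm_cart[of x j] that by simp
        then have "\<bar>x $ j / R\<bar> \<le> 1" using \<open>R > 0\<close> by simp
        then show "- (pi / 2) \<le> x $ j / R" "x $ j / R \<le> pi / 2"
          using pi_ge_two by linarith+
      qed
      then have "F (s x) = f x" using \<open>R > 0\<close> by (simp add: F_def s_def)
      then show ?thesis using q(2)[OF sQ[of x]] by simp
    qed
    show "\<bar>q (s x)\<bar> \<le> B + e" for x
      using q(2)[OF sQ[of x]] f(2)[of "\<chi> j. R * arcsin (s x $ j)"] unfolding F_def by linarith
  qed
qed

lemma integrable_bounded_borel:
  fixes f :: "'a \<Rightarrow> 'b::{banach, second_countable_topology}"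
  assumes "prob_space M" "f \<in> borel_measurable M" "\<And>x. norm (f x) \<le> B"
  shows "integrable M f"
proof -
  interpret prob_space M by fact
  show ?thesis by (rule integrable_const_bound[of _ B]) (use assms in auto)
qed

lemma trig_poly_continuous: "trig_poly p \<Longrightarrow> continuous_on UNIV p"
  by (induction rule: trig_poly.induct) (auto intro!: continuous_intros)

lemma trig_poly_bounded: "trig_poly p \<Longrightarrow> \<exists>B. \<forall>x. \<bar>p x\<bar> \<le> B"
proof (induction rule: trig_poly.induct)
  case (add p q)
  then obtain B C where "\<forall>x. \<bar>p x\<bar> \<le> B" "\<forall>x. \<bar>q x\<bar> \<le> C" by auto
  then have "\<bar>p x + q x\<bar> \<le> B + C" for x by (meson abs_triangle_ineq add_mono order_trans)
  then show ?case by blast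
next
  case (scale p c)
  then obtain B where "\<forall>x. \<bar>p x\<bar> \<le> B" by auto
  then have "\<bar>c * p x\<bar> \<le> \<bar>c\<bar> * B" for x by (simp add: abs_mult mult_left_mono)
  then show ?case by blast
qed (auto intro: exI[of _ 1])

lemma trig_poly_integral_diff:
  fixes \<mu> \<nu> :: "nat \<Rightarrow> ('a::euclidean_space) measure"
  assumes p: "trig_poly p"
    and mu: "\<And>n. prob_space (\<mu> n)" "\<And>n. sets (\<mu> n) = sets borel"
    and nu: "\<And>n. prob_space (\<nu> n)" "\<And>n. sets (\<nu> n) = sets borel"
    and cf: "\<And>l. (\<lambda>n. (CLINT x|\<mu> n. iexp (l \<bullet> x)) - (CLINT x|\<nu> n. iexp (l \<bullet> x))) \<longlonglongrightarrow> 0"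
  shows "(\<lambda>n. (\<integral>x. p x \<partial>\<mu> n) - (\<integral>x. p x \<partial>\<nu> n)) \<longlonglongrightarrow> 0"
  using p
proof induction
  have ie: "integrable M (\<lambda>x. iexp (l \<bullet> x))" if "prob_space M" "sets M = sets borel"
    for M :: "'a measure" and l
    using that by (intro integrable_bounded_borel[of _ _ 1])
                  (auto simp: measurable_cong_sets[OF that(2) refl])
  {
    case (cos l)
    have "(\<integral>x. cos (l \<bullet> x) \<partial>M) = Re (CLINT x|M. iexp (l \<bullet> x))"
      if "prob_space M" "sets M = sets borel" for M :: "'a measure"
      using integral_Re[OF ie[OF that]] by (simp add: Re_exp)
    then show ?case using tendsto_Re[OF cf[of l]] mu nu by simp
  next
    case (sin l)
    have "(\<integral>x. sin (l \<bullet> x) \<partial>M) = Im (CLINT x|M. iexp (l \<bullet> x))"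
      if "prob_space M" "sets M = sets borel" for M :: "'a measure"
      using integral_Im[OF ie[OF that]] by (simp add: Im_exp)
    then show ?case using tendsto_Im[OF cf[of l]] mu nu by simp
  next
    case (add p q)
    have i: "integrable M r" if "prob_space M" "sets M = sets borel" "trig_poly r"
      for M :: "'a measure" and r
      using trig_poly_bounded[OF that(3)] trig_poly_continuous[OF that(3)] that(1,2)
      by (auto intro!: integrable_bounded_borel simp: measurable_cong_sets[OF that(2) refl]
               borel_measurable_continuous_onI)
    show ?case using tendsto_add[OF add.IH] add.hyps
      by (simp add: i mu nu algebra_simps)
  next
    case (scale p c)
    then show ?case using tendsto_mult_left[OF scale.IH, of c] by (simp add: algebra_simps)
  }
qed

lemma levy_difference:
  fixes \<mu> \<nu> :: "nat \<Rightarrow> (real^'d) measure"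
  assumes mu: "\<And>n. prob_space (\<mu> n)" "\<And>n. sets (\<mu> n) = sets borel"
    and nu: "\<And>n. prob_space (\<nu> n)" "\<And>n. sets (\<nu> n) = sets borel"
    and cf: "\<And>l. (\<lambda>n. (CLINT x|\<mu> n. iexp (l \<bullet> x)) - (CLINT x|\<nu> n. iexp (l \<bullet> x))) \<longlonglongrightarrow> 0"
    and tmu: "\<And>e. e > 0 \<Longrightarrow> \<exists>R. \<forall>\<^sub>F n in sequentially. measure (\<mu> n) {x. norm x > R} \<le> e"
    and tnu: "\<And>e. e > 0 \<Longrightarrow> \<exists>R. \<forall>\<^sub>F n in sequentially. measure (\<nu> n) {x. norm x > R} \<le> e"
    and f: "continuous_on UNIV f" "bounded (range f)"
  shows "(\<lambda>n. (\<integral>x. f x \<partial>\<mu> n) - (\<integral>x. f x \<partial>\<nu> n)) \<longlonglongrightarrow> (0::real)"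
proof (rule LIMSEQ_I)
  fix r :: real assume "r > 0"
  obtain B where B0: "B > 0" and B: "\<And>x. \<bar>f x\<bar> \<le> B"
    using f(2) by (auto simp: bounded_pos)
  define e where "e = min 1 (r / (8 + 4 * B))"
  have e: "e > 0" "e \<le> 1" using \<open>r > 0\<close> B0 by (auto simp: e_def)
  have er: "2 * (e + (2 * B + 1) * e) \<le> r / 1 * ((4 + 4 * B) / (8 + 4 * B))"
  proof -
    have "2 * (e + (2 * B + 1) * e) = e * (4 + 4 * B)" by (simp add: algebra_simps)
    also have "\<dots> \<le> r / (8 + 4 * B) * (4 + 4 * B)"
      using B0 by (intro mult_right_mono) (auto simp: e_def)
    finally show ?thesis by simp
  qed
  obtain R1 where R1: "\<forall>\<^sub>F n in sequentially. measure (\<mu> n) {x. norm x > R1} \<le> e"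
    using tmu e by blast
  obtain R2 where R2: "\<forall>\<^sub>F n in sequentially. measure (\<nu> n) {x. norm x > R2} \<le> e"
    using tnu e by blast
  define R where "R = max 1 (max R1 R2)"
  obtain p where p: "trig_poly p" "\<And>x. norm x \<le> R \<Longrightarrow> \<bar>f x - p x\<bar> \<le> e" "\<And>x. \<bar>p x\<bar> \<le> B + e"
    by (rule trig_poly_approx[OF f(1) B e(1), of R]) (auto simp: R_def)
  have approx: "\<bar>(\<integral>x. f x \<partial>M) - (\<integral>x. p x \<partial>M)\<bar> \<le> e + (2 * B + 1) * e"
    if M: "prob_space M" "sets M = sets borel" and m: "measure M {x. norm x > R'} \<le> e" and RR: "R' \<le> R"
    for M :: "(real^'d) measure" and R'
  proof -
    interpret prob_space M by fact
    have [measurable]: "f \<in> borel_measurable M" "p \<in> borel_measurable M"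
      using f(1) trig_poly_continuous[OF p(1)]
      by (auto simp: measurable_cong_sets[OF M(2) refl] borel_measurable_continuous_onI)
    have meas: "{x. norm x > R''} \<in> sets M" for R'' unfolding M(2) by measurable
    have i: "integrable M f" "integrable M p"
      using B p(3) by (auto intro!: integrable_bounded_borel[OF M(1)])
    have ii: "integrable M (\<lambda>x. e + (2 * B + 1) * indicator {x. norm x > R} x :: real)"
    proof (rule integrable_bounded_borel[OF M(1), of _ "e + (2 * B + 1)"])
      show "(\<lambda>x. e + (2 * B + 1) * indicator {x. norm x > R} x :: real) \<in> borel_measurable M"
        using meas by measurable
    qed (use B0 e in \<open>auto simp: indicator_def\<close>)
    have "\<bar>(\<integral>x. f x \<partial>M) - (\<integral>x. p x \<partial>M)\<bar> = \<bar>\<integral>x. f x - p x \<partial>M\<bar>"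
      using i by simp
    also have "\<dots> \<le> (\<integral>x. \<bar>f x - p x\<bar> \<partial>M)" by simp
    also have "\<dots> \<le> (\<integral>x. e + (2 * B + 1) * indicator {x. norm x > R} x \<partial>M)"
    proof (rule integral_mono)
      show "\<bar>f x - p x\<bar> \<le> e + (2 * B + 1) * indicator {x. norm x > R} x" for x
      proof (cases "norm x > R")
        case True
        then show ?thesis using B[of x] p(3)[of x] e by (simp add: indicator_def)
      qed (use p(2) in \<open>auto simp: indicator_def\<close>)
    qed (use i ii in auto)
    also have "\<dots> = e + (2 * B + 1) * measure M {x. norm x > R}"
    proof -
      have "integrable M (indicat_real {x. norm x > R})"
        using meas[of R] by (intro integrable_real_indicator) (auto simp: less_top[symmetric])
      then show ?thesis
        using meas[of R] by (subst Bochner_Integration.integral_add) (auto simp: prob_space)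
    qed
    also have "measure M {x. norm x > R} \<le> e"
      using order_trans[OF finite_measure_mono m] RR meas by (auto intro!: finite_measure_mono order_trans[OF _ m])
    finally show ?thesis using B0 by simp
  qed
  have "(\<lambda>n. (\<integral>x. p x \<partial>\<mu> n) - (\<integral>x. p x \<partial>\<nu> n)) \<longlonglongrightarrow> 0"
    by (rule trig_poly_integral_diff[OF p(1) mu nu cf])
  moreover have s: "r / (2 + B) > 0" using \<open>r > 0\<close> B0 by simp
  ultimately have "\<forall>\<^sub>F n in sequentially. dist ((\<integral>x. p x \<partial>\<mu> n) - (\<integral>x. p x \<partial>\<nu> n)) 0 < r / (2 + B)"
    by (rule tendstoD)
  then have pd: "\<forall>\<^sub>F n in sequentially. \<bar>(\<integral>x. p x \<partial>\<mu> n) - (\<integral>x. p x \<partial>\<nu> n)\<bar> < r / (2 + B)"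
    by (simp add: dist_real_def)
  have tri: "\<bar>a - b\<bar> < 2 * c + d" if "\<bar>a - a'\<bar> \<le> c" "\<bar>b - b'\<bar> \<le> c" "\<bar>a' - b'\<bar> < d"
    for a a' b b' c d :: real using that by linarith
  from R1 R2 pd have "\<forall>\<^sub>F n in sequentially. \<bar>(\<integral>x. f x \<partial>\<mu> n) - (\<integral>x. f x \<partial>\<nu> n)\<bar> < r"
  proof eventually_elim
    case (elim n)
    have "\<bar>(\<integral>x. f x \<partial>\<mu> n) - (\<integral>x. p x \<partial>\<mu> n)\<bar> \<le> e + (2 * B + 1) * e"
         "\<bar>(\<integral>x. f x \<partial>\<nu> n) - (\<integral>x. p x \<partial>\<nu> n)\<bar> \<le> e + (2 * B + 1) * e"
      using approx[OF mu elim(1)] approx[OF nu elim(2)] by (auto simp: R_def)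
    then have "\<bar>(\<integral>x. f x \<partial>\<mu> n) - (\<integral>x. f x \<partial>\<nu> n)\<bar> < 2 * (e + (2 * B + 1) * e) + r / (2 + B)"
      using elim(3) by (rule tri)
    also have "\<dots> \<le> r * ((4 + 4 * B) / (8 + 4 * B)) + r / (2 + B)" using er by simp
    also have "(4 + 4 * B) / (8 + 4 * B) = (1 + B) / (2 + B)" using B0 by (simp add: field_simps)
    also have "r * ((1 + B) / (2 + B)) + r / (2 + B) = r"
      using B0 by (simp add: add_divide_distrib[symmetric]) (simp add: field_simps)
    finally show ?case .
  qed
  then show "\<exists>no. \<forall>n\<ge>no. norm ((\<integral>x. f x \<partial>\<mu> n) - (\<integral>x. f x \<partial>\<nu> n) - 0) < r"
    by (auto simp: eventually_sequentially)
qed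

lemma cmod_iexp_diff: "cmod (iexp a - iexp b) \<le> \<bar>a - b\<bar>"
proof -
  have "iexp a - iexp b = iexp b * (iexp (a - b) - 1)"
    by (simp add: right_diff_distrib exp_add[symmetric])
  then have "cmod (iexp a - iexp b) = cmod (iexp (a - b) - 1)" by (simp only: norm_mult norm_exp_i_times mult_1)
  also have "\<dots> \<le> \<bar>a - b\<bar>" using iexp_approx1[of "a - b" 0] by simp
  finally show ?thesis .
qed

lemma abs_SUP_diff_le:
  fixes f h :: "'a \<Rightarrow> real"
  assumes "A \<noteq> {}" "bdd_above (f ` A)" "bdd_above (h ` A)" "\<And>x. x \<in> A \<Longrightarrow> \<bar>f x - h x\<bar> \<le> e"
  shows "\<bar>(SUP x\<in>A. f x) - (SUP x\<in>A. h x)\<bar> \<le> e"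
proof -
  have "(SUP x\<in>A. f x) \<le> (SUP x\<in>A. h x) + e"
  proof (rule cSUP_least[OF assms(1)])
    show "f x \<le> (SUP x\<in>A. h x) + e" if "x \<in> A" for x
      using assms(4)[OF that] cSUP_upper[OF that assms(3)] by linarith
  qed
  moreover have "(SUP x\<in>A. h x) \<le> (SUP x\<in>A. f x) + e"
  proof (rule cSUP_least[OF assms(1)])
    show "h x \<le> (SUP x\<in>A. f x) + e" if "x \<in> A" for x
      using assms(4)[OF that] cSUP_upper[OF that assms(2)] by linarith
  qed
  ultimately show ?thesis by linarith
qed

section \<open>Square roots of symmetric matrices and Gaussian measures\<close>

lemma quadratic_nonneg_imp_zero:
  fixes a b :: real
  assumes "\<And>s. 0 \<le> 2 * s * b + s\<^sup>2 * a"
  shows "b = 0"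
proof (rule ccontr)
  assume b: "b \<noteq> 0"
  define d where "d = \<bar>a\<bar> + 1"
  define s where "s = - b / d"
  have d: "d > 0" "a \<le> d" by (auto simp: d_def)
  have "2 * s * b + s\<^sup>2 * a \<le> 2 * s * b + s\<^sup>2 * d"
    using d by (intro add_left_mono mult_left_mono) auto
  also have "\<dots> = - (b\<^sup>2 / d)"
    using d by (simp add: s_def power2_eq_square field_simps)
  also have "\<dots> < 0" using b d by simp
  finally show False using assms[of s] by simp
qed

lemma self_adjoint_eigenvector:
  fixes f :: "'a::euclidean_space \<Rightarrow> 'a"
  assumes f: "linear f" and sym: "\<And>x y. f x \<bullet> y = x \<bullet> f y"
    and V: "subspace V" "f ` V \<subseteq> V" "V \<noteq> {0}"
  obtains x c where "x \<in> V" "norm x = 1" "f x = c *\<^sub>R x"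
proof -
  interpret linear f by fact
  define K where "K = V \<inter> sphere 0 1"
  have "compact K" unfolding K_def
    using V(1) by (simp add: closed_subspace compact_Int_closed Int_commute closed_Int_compact)
  obtain v where v: "v \<in> V" "v \<noteq> 0" using V subspace_0 by blast
  then have "v /\<^sub>R norm v \<in> K" using V(1) by (auto simp: K_def subspace_scale)
  then have "K \<noteq> {}" by auto
  moreover have "continuous_on K (\<lambda>x. x \<bullet> f x)"
    using f by (intro continuous_intros linear_continuous_on) (simp add: linear_conv_bounded_linear)
  ultimately obtain x where x: "x \<in> K" "\<And>y. y \<in> K \<Longrightarrow> y \<bullet> f y \<le> x \<bullet> f x"
    using continuous_attains_sup[OF \<open>compact K\<close>, of "\<lambda>x. x \<bullet> f x"] by blast
  define c where "c = x \<bullet> f x"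
  have xV: "x \<in> V" and xx: "x \<bullet> x = 1" using x by (auto simp: K_def dot_square_norm)
  have q: "y \<bullet> f y \<le> c * (y \<bullet> y)" if "y \<in> V" for y
  proof (cases "y = 0")
    case False
    have "y /\<^sub>R norm y \<in> K" using V(1) that False by (auto simp: K_def subspace_scale)
    from x(2)[OF this] show ?thesis using False
      by (simp add: scale c_def dot_square_norm field_simps power2_eq_square)
  qed (simp add: f linear_0)
  have "(c *\<^sub>R x - f x) \<bullet> y = 0" if y: "y \<in> V" for y
  proof (rule quadratic_nonneg_imp_zero)
    fix s :: real
    have "x + s *\<^sub>R y \<in> V" using V(1) xV y by (simp add: subspace_add subspace_scale)
    from q[OF this]
    have "0 \<le> c * ((x + s *\<^sub>R y) \<bullet> (x + s *\<^sub>R y)) - (x + s *\<^sub>R y) \<bullet> f (x + s *\<^sub>R y)" by simp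
    also have "\<dots> = 2 * s * ((c *\<^sub>R x - f x) \<bullet> y) + s\<^sup>2 * (c * (y \<bullet> y) - y \<bullet> f y)"
      using xx sym[of x y]
      by (simp add: add scale inner_add inner_diff inner_commute c_def power2_eq_square algebra_simps)
    finally show "0 \<le> 2 * s * ((c *\<^sub>R x - f x) \<bullet> y) + s\<^sup>2 * (c * (y \<bullet> y) - y \<bullet> f y)" .
  qed
  moreover have "c *\<^sub>R x - f x \<in> V" using V xV by (intro subspace_diff subspace_scale) auto
  ultimately have "c *\<^sub>R x - f x = 0" using inner_eq_zero_iff by blast
  then show ?thesis using that[of x c] xV xx by (simp add: norm_eq_1)
qed

lemma self_adjoint_eigenbasis:
  fixes f :: "'a::euclidean_space \<Rightarrow> 'a"
  assumes f: "linear f" and sym: "\<And>x y. f x \<bullet> y = x \<bullet> f y"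
    and V: "subspace V" "f ` V \<subseteq> V"
  shows "\<exists>B. finite B \<and> B \<subseteq> V \<and> (\<forall>b\<in>B. norm b = 1) \<and> pairwise orthogonal B \<and>
             (\<forall>v\<in>V. v = (\<Sum>b\<in>B. (b \<bullet> v) *\<^sub>R b)) \<and> (\<forall>b\<in>B. \<exists>c. f b = c *\<^sub>R b)"
  using V
proof (induction "dim V" arbitrary: V rule: less_induct)
  case less
  show ?case
  proof (cases "V = {0}")
    case True
    then show ?thesis by (intro exI[of _ "{}"]) auto
  next
    case False
    obtain x c where x: "x \<in> V" "norm x = 1" "f x = c *\<^sub>R x"
      using self_adjoint_eigenvector[OF f sym less.prems False] by blast
    have xx: "x \<bullet> x = 1" using x by (simp add: dot_square_norm)
    define U where "U = V \<inter> {y. x \<bullet> y = 0}"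
    have U: "subspace U" unfolding U_def by (intro subspace_inter less.prems subspace_hyperplane)
    have fU: "f ` U \<subseteq> U"
    proof safe
      fix y assume "y \<in> U"
      then show "f y \<in> U" using less.prems(2) sym[of x y] x(3) by (auto simp: U_def)
    qed
    have "x \<notin> U" using xx by (simp add: U_def)
    then have "U \<subset> V" using x(1) U_def by blast
    then have "dim U < dim V"
      using U less.prems(1) by (metis dim_psubset span_eq_iff)
    from less.hyps[OF this U fU] obtain B where B: "finite B" "B \<subseteq> U" "\<forall>b\<in>B. norm b = 1"
      "pairwise orthogonal B" "\<forall>v\<in>U. v = (\<Sum>b\<in>B. (b \<bullet> v) *\<^sub>R b)" "\<forall>b\<in>B. \<exists>c. f b = c *\<^sub>R b" by blast
    have xB: "x \<notin> B" using \<open>x \<notin> U\<close> B(2) by auto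
    have xb: "b \<bullet> x = 0" if "b \<in> B" for b using that B(2) by (auto simp: U_def inner_commute)
    have "v = (\<Sum>b\<in>insert x B. (b \<bullet> v) *\<^sub>R b)" if v: "v \<in> V" for v
    proof -
      define w where "w = v - (x \<bullet> v) *\<^sub>R x"
      have "w \<in> U" using v x(1) less.prems(1) xx
        by (auto simp: U_def w_def inner_diff_right subspace_diff subspace_scale)
      then have "w = (\<Sum>b\<in>B. (b \<bullet> w) *\<^sub>R b)" using B(5) by blast
      also have "\<dots> = (\<Sum>b\<in>B. (b \<bullet> v) *\<^sub>R b)"
        by (intro sum.cong refl) (simp add: w_def inner_diff_right xb)
      finally show ?thesis using B(1) xB by (simp add: w_def algebra_simps)
    qed
    moreover have "pairwise orthogonal (insert x B)"
      using B(4) xb by (auto simp: pairwise_insert orthogonal_def inner_commute)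
    ultimately show ?thesis
      using B x by (intro exI[of _ "insert x B"]) (auto simp: U_def)
  qed
qed

lemma self_adjoint_eigenbasis_UNIV:
  fixes f :: "'a::euclidean_space \<Rightarrow> 'a"
  assumes f: "linear f" and sym: "\<And>x y. f x \<bullet> y = x \<bullet> f y"
  obtains B where "finite B" "\<forall>b\<in>B. norm b = 1" "pairwise orthogonal B"
    "\<forall>v. v = (\<Sum>b\<in>B. (b \<bullet> v) *\<^sub>R b)" "\<forall>b\<in>B. \<exists>c. f b = c *\<^sub>R b"
proof -
  from self_adjoint_eigenbasis[OF f sym subspace_UNIV subset_UNIV]
  obtain B where B: "finite B \<and> B \<subseteq> UNIV \<and> (\<forall>b\<in>B. norm b = 1) \<and> pairwise orthogonal B \<and>
             (\<forall>v\<in>UNIV. v = (\<Sum>b\<in>B. (b \<bullet> v) *\<^sub>R b)) \<and> (\<forall>b\<in>B. \<exists>c. f b = c *\<^sub>R b)" ..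
  note B' = B[THEN conjunct2]
  note B'' = B'[THEN conjunct2, THEN conjunct2]
  show ?thesis
    by (rule that[OF B[THEN conjunct1] B'[THEN conjunct2, THEN conjunct1] B''[THEN conjunct1]
          B''[THEN conjunct2, THEN conjunct1, unfolded ball_UNIV] B''[THEN conjunct2, THEN conjunct2]])
qed

definition psd_root :: "real^'d^'d \<Rightarrow> real^'d^'d \<Rightarrow> bool" where
  "psd_root M A \<longleftrightarrow> transpose A = A \<and> (\<forall>v. 0 \<le> v \<bullet> (A *v v)) \<and> A ** A = M"

lemma symmetric_matrix_inner:
  fixes A :: "real^'d^'d"
  assumes "transpose A = A" shows "(A *v x) \<bullet> y = x \<bullet> (A *v y)"
  by (metis assms dot_lmul_matrix inner_commute transpose_matrix_vector)

lemma psd_root_exists: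
  fixes M :: "real^'d^'d"
  assumes "transpose M = M" "\<And>v. 0 \<le> v \<bullet> (M *v v)"
  shows "\<exists>A. psd_root M A"
proof -
  obtain B where B: "finite B" "\<forall>b\<in>B. norm b = 1" "pairwise orthogonal B"
    and B4: "\<forall>v. v = (\<Sum>b\<in>B. (b \<bullet> v) *\<^sub>R b)" and B5: "\<forall>b\<in>B. \<exists>c. M *v b = c *\<^sub>R b"
    by (rule self_adjoint_eigenbasis_UNIV[of "\<lambda>v. M *v v", OF matrix_vector_mul_linear
          symmetric_matrix_inner[OF assms(1)]]) (rule that, assumption+)
  obtain c where c: "\<And>b. b \<in> B \<Longrightarrow> M *v b = c b *\<^sub>R b" using B5 by metis
  have bb: "b \<bullet> b' = (if b = b' then 1 else 0)" if "b \<in> B" "b' \<in> B" for b b'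
    using B(2,3) that by (auto simp: dot_square_norm pairwise_def orthogonal_def)
  have c0: "c b \<ge> 0" if "b \<in> B" for b
    using assms(2)[of b] c[OF that] bb[OF that that] by simp
  define h where "h v = (\<Sum>b\<in>B. (sqrt (c b) * (b \<bullet> v)) *\<^sub>R b)" for v
  have lin: "linear h"
    by (intro linearI) (simp_all add: h_def inner_add_right scaleR_sum_right sum.distrib[symmetric]
       algebra_simps scaleR_left_distrib)
  define A where "A = matrix h"
  have A: "A *v v = h v" for v unfolding A_def by (simp add: lin)
  have hb: "h b = sqrt (c b) *\<^sub>R b" if "b \<in> B" for b
  proof -
    have "h b = (\<Sum>b'\<in>B. (if b = b' then sqrt (c b) *\<^sub>R b else 0))"
      unfolding h_def using that by (intro sum.cong refl) (auto simp: bb)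
    then show ?thesis using that B(1) by simp
  qed
  have hh: "h (h v) = M *v v" for v
  proof -
    interpret h: linear h by fact
    have "h (h v) = (\<Sum>b\<in>B. (c b * (b \<bullet> v)) *\<^sub>R b)"
      unfolding h_def[of v] h.sum by (intro sum.cong refl) (simp add: h.scale hb c0 real_sqrt_mult_self)
    also have "\<dots> = (\<Sum>b\<in>B. (b \<bullet> v) *\<^sub>R (M *v b))"
      by (intro sum.cong refl) (simp add: c mult.commute)
    also have "\<dots> = M *v (\<Sum>b\<in>B. (b \<bullet> v) *\<^sub>R b)"
      by (simp add: matrix_vector_mult_scaleR linear_sum[OF matrix_vector_mul_linear])
    finally show ?thesis using spec[OF B4, of v] by simp
  qed
  have "A ** A = M"
    by (simp add: matrix_eq matrix_vector_mul_assoc[symmetric] A hh)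
  moreover have "transpose A = A"
  proof -
    have "x \<bullet> h y = y \<bullet> h x" for x y
      by (simp add: h_def inner_sum_right mult_ac inner_commute)
    then have "x \<bullet> (transpose A *v y) = x \<bullet> (A *v y)" for x y
      by (metis A dot_lmul_matrix inner_commute transpose_matrix_vector)
    then show ?thesis by (metis matrix_eq vector_eq_rdot inner_commute)
  qed
  moreover have "0 \<le> v \<bullet> (A *v v)" for v
    by (auto simp: A h_def inner_sum_right inner_commute mult.assoc c0 intro!: sum_nonneg)
  ultimately show ?thesis unfolding psd_root_def by blast
qed

lemma psd_form_eq_0:
  fixes A :: "real^'d^'d"
  assumes sym: "transpose A = A" and psd: "\<And>v. 0 \<le> v \<bullet> (A *v v)" and "v \<bullet> (A *v v) = 0"
  shows "A *v v = 0"
proof -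
  have "(A *v v) \<bullet> (A *v v) = 0"
  proof (rule quadratic_nonneg_imp_zero)
    fix s :: real
    define w where "w = A *v v"
    have "0 \<le> (v + s *\<^sub>R w) \<bullet> (A *v (v + s *\<^sub>R w))" by (rule psd)
    also have "\<dots> = 2 * s * (w \<bullet> w) + s\<^sup>2 * (w \<bullet> (A *v w))"
      using assms(3) symmetric_matrix_inner[OF sym, of v w]
      by (simp add: matrix_vector_right_distrib matrix_vector_mult_scaleR inner_add w_def[symmetric]
          power2_eq_square algebra_simps)
    finally show "0 \<le> 2 * s * ((A *v v) \<bullet> (A *v v)) + s\<^sup>2 * (w \<bullet> (A *v w))"
      unfolding w_def .
  qed
  then show ?thesis by simp
qed

lemma psd_root_unique:
  assumes A: "psd_root M A" and B: "psd_root M B"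
  shows "A = (B :: real^'d^'d)"
proof -
  define D where "D = A - B"
  have D: "D *v x = A *v x - B *v x" for x by (simp add: D_def matrix_vector_mult_diff_rdistrib)
  note s = symmetric_matrix_inner[of A] symmetric_matrix_inner[of B]
  have sA: "transpose A = A" "transpose B = B" and pos: "\<And>v. 0 \<le> v \<bullet> (A *v v)" "\<And>v. 0 \<le> v \<bullet> (B *v v)"
    and sq: "A *v (A *v v) = M *v v" "B *v (B *v v) = M *v v" for v
    using A B by (auto simp: psd_root_def matrix_vector_mul_assoc)
  have symD: "(D *v x) \<bullet> y = x \<bullet> (D *v y)" for x y
    using s sA by (simp add: D inner_diff)
  obtain E where E0: "\<forall>v. v = (\<Sum>b\<in>E. (b \<bullet> v) *\<^sub>R b)" and E2: "\<forall>b\<in>E. \<exists>c. D *v b = c *\<^sub>R b"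
    by (rule self_adjoint_eigenbasis_UNIV[of "\<lambda>v. D *v v", OF matrix_vector_mul_linear symD])
      (rule that, assumption+)
  have E: "v = (\<Sum>b\<in>E. (b \<bullet> v) *\<^sub>R b)" for v using E0 by (rule spec)
  have z: "D *v b = 0" if bE: "b \<in> E" for b
  proof -
    obtain c where c: "D *v b = c *\<^sub>R b" using bspec[OF E2 bE] ..
    have f: "b \<bullet> (A *v (B *v b)) = (A *v b) \<bullet> (B *v b)" "(B *v b) \<bullet> (B *v b) = b \<bullet> (M *v b)"
      using s(1)[OF sA(1), of b "B *v b"] s(2)[OF sA(2), of b "B *v b"] sq(2)[of b] by simp_all
    have "b \<bullet> (A *v (D *v b)) + (D *v b) \<bullet> (B *v b) = 0"
      by (simp add: D matrix_vector_mult_diff_distrib inner_diff_left inner_diff_right f sq(1))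
    then have "c * (b \<bullet> (A *v b) + b \<bullet> (B *v b)) = 0"
      by (simp add: c matrix_vector_mult_scaleR algebra_simps)
    then consider "c = 0" | "b \<bullet> (A *v b) = 0" "b \<bullet> (B *v b) = 0"
      using pos[of b] by (auto simp: add_nonneg_eq_0_iff)
    then show ?thesis
    proof cases
      case 2
      then have "A *v b = 0" "B *v b = 0" using psd_form_eq_0 sA pos by blast+
      then show ?thesis by (simp add: D)
    qed (simp add: c)
  qed
  have "D *v v = 0" for v
    by (subst E[of v]) (simp add: linear_sum[OF matrix_vector_mul_linear] matrix_vector_mult_scaleR z)
  then have "A *v v = B *v v" for v using D by simp
  then show ?thesis by (simp add: matrix_eq)
qed

lemma psd_sqrt_root:
  fixes M :: "real^'d^'d"
  assumes "transpose M = M" "\<And>v. 0 \<le> v \<bullet> (M *v v)"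
  shows "psd_root M (psd_sqrt M)"
  unfolding psd_sqrt_def psd_root_def[symmetric]
  by (rule theI') (use psd_root_exists[OF assms] psd_root_unique in blast)

lemma measurable_matrix_vector_mult [measurable]:
  "(\<lambda>v. (A :: real^'n^'m) *v v) \<in> borel_measurable borel"
  by (intro borel_measurable_continuous_onI linear_continuous_on)
     (simp add: linear_conv_bounded_linear[symmetric])

lemma prob_space_std_normal_vec: "prob_space (std_normal_vec :: (real^'d) measure)"
  and sets_std_normal_vec [simp, measurable_cong]: "sets (std_normal_vec :: (real^'d) measure) = sets borel"
proof -
  interpret p: prob_space "density lborel std_normal_density :: real measure"
    by (rule prob_space_normal_density) simp
  interpret product_prob_space "\<lambda>_::'d. density lborel std_normal_density :: real measure" UNIV
    by unfold_locales
  have "(\<lambda>z. \<chi> i. z i) \<in> borel_measurable (Pi\<^sub>M UNIV (\<lambda>_::'d. density lborel std_normal_density :: real measure))"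
    by (subst borel_measurable_euclidean_space) (auto simp: Basis_vec_def inner_axis)
  then show "prob_space (std_normal_vec :: (real^'d) measure)"
    unfolding std_normal_vec_def by (rule prob_space_distr)
qed (simp add: std_normal_vec_def)

lemma char_std_normal_vec:
  fixes l :: "real^'d"
  shows "(CLINT x|std_normal_vec. iexp (l \<bullet> x)) = of_real (exp (- (l \<bullet> l) / 2))"
proof -
  let ?N = "density lborel std_normal_density :: real measure"
  interpret p: prob_space ?N
    by (rule prob_space_normal_density) simp
  interpret product_sigma_finite "\<lambda>_::'d. ?N" by unfold_locales
  have m: "(\<lambda>z. \<chi> i. z i) \<in> measurable (Pi\<^sub>M UNIV (\<lambda>_::'d. ?N)) (borel :: (real^'d) measure)"
    by (subst borel_measurable_euclidean_space) (auto simp: Basis_vec_def inner_axis)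
  have "(CLINT x|std_normal_vec. iexp (l \<bullet> x)) = (CLINT z|Pi\<^sub>M UNIV (\<lambda>_::'d. ?N). iexp (l \<bullet> (\<chi> i. z i)))"
    unfolding std_normal_vec_def by (rule integral_distr[OF m]) simp
  also have "\<dots> = (CLINT z|Pi\<^sub>M UNIV (\<lambda>_::'d. ?N). (\<Prod>i\<in>UNIV. iexp (l $ i * z i)))"
    by (simp add: inner_vec_def sum_distrib_left exp_sum)
  also have "\<dots> = (\<Prod>i\<in>UNIV. CLINT x|?N. iexp (l $ i * x))"
    by (rule product_integral_prod) (auto intro!: p.integrable_iexp)
  also have "\<dots> = (\<Prod>i\<in>UNIV. of_real (exp (- (l $ i)\<^sup>2 / 2)))"
    using char_std_normal_distribution by (simp add: char_def fun_eq_iff)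
  also have "\<dots> = of_real (exp (- (l \<bullet> l) / 2))"
    by (simp add: inner_vec_def exp_sum[symmetric] sum_negf sum_divide_distrib power2_eq_square flip: of_real_prod)
  finally show ?thesis .
qed

lemma normal_vec_prob: "prob_space (normal_vec \<Sigma> :: (real^'d) measure)"
  unfolding normal_vec_def by (rule prob_space.prob_space_distr[OF prob_space_std_normal_vec]) simp

lemma sets_normal_vec [simp, measurable_cong]: "sets (normal_vec \<Sigma>) = sets borel"
  by (simp add: normal_vec_def)

lemma char_normal_vec:
  fixes l :: "real^'d"
  assumes "transpose \<Sigma> = \<Sigma>" "\<And>v. 0 \<le> v \<bullet> (\<Sigma> *v v)"
  shows "(CLINT x|normal_vec \<Sigma>. iexp (l \<bullet> x)) = of_real (exp (- (l \<bullet> (\<Sigma> *v l)) / 2))"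
proof -
  let ?A = "psd_sqrt \<Sigma>"
  have A: "transpose ?A = ?A" "?A ** ?A = \<Sigma>" using psd_sqrt_root[OF assms] by (auto simp: psd_root_def)
  have "(CLINT x|normal_vec \<Sigma>. iexp (l \<bullet> x)) = (CLINT x|std_normal_vec. iexp ((?A *v l) \<bullet> x))"
    unfolding normal_vec_def by (subst integral_distr) (simp_all add: symmetric_matrix_inner[OF A(1)])
  also have "\<dots> = of_real (exp (- ((?A *v l) \<bullet> (?A *v l)) / 2))" by (rule char_std_normal_vec)
  also have "(?A *v l) \<bullet> (?A *v l) = l \<bullet> (\<Sigma> *v l)"
    unfolding symmetric_matrix_inner[OF A(1)] matrix_vector_mul_assoc A(2) ..
  finally show ?thesis .
qed

lemma norm_psd_sqrt_mult_le:
  assumes "transpose \<Sigma> = \<Sigma>" "\<And>v. 0 \<le> v \<bullet> (\<Sigma> *v v)" and "v \<bullet> (\<Sigma> *v v) \<le> C * (norm v)\<^sup>2"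
  shows "norm (psd_sqrt \<Sigma> *v v) \<le> sqrt C * norm v"
proof -
  let ?A = "psd_sqrt \<Sigma>"
  have A: "transpose ?A = ?A" "?A ** ?A = \<Sigma>" using psd_sqrt_root[OF assms(1,2)] by (auto simp: psd_root_def)
  have "(norm (?A *v v))\<^sup>2 = v \<bullet> (\<Sigma> *v v)"
    by (simp add: power2_norm_eq_inner symmetric_matrix_inner[OF A(1)] matrix_vector_mul_assoc A(2))
  then have "norm (?A *v v) = sqrt (v \<bullet> (\<Sigma> *v v))"
    by (metis norm_ge_zero real_sqrt_unique)
  also have "\<dots> \<le> sqrt (C * (norm v)\<^sup>2)" using assms(3) by simp
  finally show ?thesis by (simp add: real_sqrt_mult)
qed

lemma prob_tight_single:
  fixes M :: "'a::euclidean_space measure"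
  assumes "prob_space M" "sets M = sets borel" "e > 0"
  shows "\<exists>R>0. measure M {x. norm x > R} \<le> e"
proof -
  interpret prob_space M by fact
  have *: "{x. norm x > real n} \<in> sets M" for n unfolding assms(2) by measurable
  have "(\<lambda>n. measure M {x. norm x > real n}) \<longlonglongrightarrow> measure M (\<Inter>n. {x. norm x > real n})"
    by (rule finite_Lim_measure_decseq) (use * in \<open>auto simp: decseq_def\<close>)
  moreover have "(\<Inter>n. {x::'a. norm x > real n}) = {}"
  proof safe
    fix x :: 'a assume x: "x \<in> (\<Inter>n. {x. norm x > real n})"
    obtain n where "norm x < real n" using reals_Archimedean2 by blast
    then show "x \<in> {}" using x by (auto dest!: spec[of _ n])
  qed
  ultimately have "(\<lambda>n. measure M {x. norm x > real n}) \<longlonglongrightarrow> 0" by simp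
  from order_tendstoD(2)[OF this \<open>e > 0\<close>]
  obtain N where N: "\<And>n. n \<ge> N \<Longrightarrow> measure M {x. norm x > real n} < e" by (auto simp: eventually_sequentially)
  show ?thesis using N[of "Suc N"] by (intro exI[of _ "real (Suc N)"]) auto
qed

lemma normal_vec_tight:
  assumes "e > 0"
  shows "\<exists>R. \<forall>\<Sigma>::real^'d^'d. transpose \<Sigma> = \<Sigma> \<longrightarrow> (\<forall>v. 0 \<le> v \<bullet> (\<Sigma> *v v)) \<longrightarrow>
     (\<forall>v. v \<bullet> (\<Sigma> *v v) \<le> C * (norm v)\<^sup>2) \<longrightarrow> measure (normal_vec \<Sigma>) {x. norm x > R} \<le> e"
proof -
  interpret prob_space "std_normal_vec :: (real^'d) measure" by (rule prob_space_std_normal_vec)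
  obtain R where R: "R > 0" "measure (std_normal_vec :: (real^'d) measure) {x. norm x > R} \<le> e"
    using prob_tight_single[OF prob_space_std_normal_vec sets_std_normal_vec assms] by blast
  show ?thesis
  proof (intro exI allI impI)
    fix \<Sigma> :: "real^'d^'d"
    assume S: "transpose \<Sigma> = \<Sigma>" "\<forall>v. 0 \<le> v \<bullet> (\<Sigma> *v v)" "\<forall>v. v \<bullet> (\<Sigma> *v v) \<le> C * (norm v)\<^sup>2"
    have "measure (normal_vec \<Sigma>) {x. norm x > sqrt \<bar>C\<bar> * R}
        = measure std_normal_vec {z. norm (psd_sqrt \<Sigma> *v z) > sqrt \<bar>C\<bar> * R}"
      unfolding normal_vec_def by (subst measure_distr) (auto simp: vimage_def std_normal_vec_def)
    also have "\<dots> \<le> measure (std_normal_vec :: (real^'d) measure) {x. norm x > R}"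
    proof (rule finite_measure_mono)
      have "norm (psd_sqrt \<Sigma> *v z) \<le> sqrt \<bar>C\<bar> * norm z" for z :: "real^'d"
      proof (rule norm_psd_sqrt_mult_le)
        show "z \<bullet> (\<Sigma> *v z) \<le> \<bar>C\<bar> * (norm z)\<^sup>2"
          using S(3) by (meson abs_ge_self mult_right_mono order_trans zero_le_power2)
      qed (use S in auto)
      moreover have "sqrt \<bar>C\<bar> * norm z \<le> sqrt \<bar>C\<bar> * R" if "norm z \<le> R" for z :: "real^'d"
        using that by (intro mult_left_mono) auto
      ultimately show "{z. norm (psd_sqrt \<Sigma> *v z) > sqrt \<bar>C\<bar> * R} \<subseteq> {x. norm x > R}"
        by (auto simp: not_le[symmetric]) (meson order_trans)
    qed simp
    also note R(2)
    finally show "measure (normal_vec \<Sigma>) {x. norm x > sqrt \<bar>C\<bar> * R} \<le> e" .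
  qed
qed

section \<open>Matrix inverses\<close>

lemma norm_matrix_vector_mult_le:
  fixes A :: "real^'n^'m"
  shows "norm (A *v x) \<le> norm A * norm x"
proof -
  have "norm (A *v x) = L2_set (\<lambda>i. \<bar>A $ i \<bullet> x\<bar>) UNIV"
    by (simp add: norm_vec_def matrix_vector_mul_component)
  also have "\<dots> \<le> L2_set (\<lambda>i. norm (A $ i) * norm x) UNIV"
    by (intro L2_set_mono) (auto simp: Cauchy_Schwarz_ineq2)
  also have "\<dots> = norm A * norm x"
    by (simp add: norm_vec_def L2_set_left_distrib)
  finally show ?thesis .
qed

lemma norm_quadratic_form_le:
  fixes A :: "real^'n^'n" shows "\<bar>w \<bullet> (A *v w)\<bar> \<le> (norm w)\<^sup>2 * norm A"
proof -
  have "\<bar>w \<bullet> (A *v w)\<bar> \<le> norm w * norm (A *v w)" by (rule Cauchy_Schwarz_ineq2)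
  also have "\<dots> \<le> norm w * (norm A * norm w)" by (intro mult_left_mono norm_matrix_vector_mult_le) simp
  finally show ?thesis by (simp add: power2_eq_square mult_ac)
qed

lemma borel_measurable_vec_nth [measurable (raw)]:
  fixes f :: "'a \<Rightarrow> 'b::second_countable_topology^'n"
  assumes "f \<in> borel_measurable M" shows "(\<lambda>x. f x $ i) \<in> borel_measurable M"
proof -
  have "(\<lambda>v::'b^'n. v $ i) \<in> borel_measurable borel"
    by (intro borel_measurable_continuous_onI continuous_intros)
  then show ?thesis using assms by (rule measurable_compose[rotated])
qed

lemma borel_measurable_vec_lambda:
  fixes f :: "'a \<Rightarrow> 'n::finite \<Rightarrow> 'b::euclidean_space"
  assumes "\<And>i. (\<lambda>x. f x i) \<in> borel_measurable M"
  shows "(\<lambda>x. \<chi> i. f x i) \<in> borel_measurable M"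
  using assms
  by (subst borel_measurable_euclidean_space) (auto simp: Basis_vec_def inner_axis)

lemma borel_measurable_matrix_vector_mult [measurable (raw)]:
  fixes f :: "'a \<Rightarrow> real^'n^'m"
  assumes "f \<in> borel_measurable M" "g \<in> borel_measurable M"
  shows "(\<lambda>x. f x *v g x) \<in> borel_measurable M"
  unfolding matrix_vector_mult_def using assms
  by (intro borel_measurable_vec_lambda borel_measurable_sum borel_measurable_times borel_measurable_vec_nth)

lemma borel_measurable_det:
  fixes f :: "'a \<Rightarrow> real^'n^'n"
  assumes "f \<in> borel_measurable M"
  shows "(\<lambda>x. det (f x)) \<in> borel_measurable M"
  unfolding det_def using assms by simp

text \<open>For a singular matrix the library inverse is a choice from an empty predicate, hence one and the same
  constant; without this the inverse would not be known to be measurable.\<close>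
lemma matrix_inv_singular:
  fixes A :: "real^'n^'n"
  assumes "\<not> invertible A" shows "matrix_inv A = matrix_inv 0"
proof -
  have *: "\<not> (A ** B = mat 1 \<and> B ** A = mat 1)" for B using assms by (auto simp: invertible_def)
  have "0 ** B \<noteq> mat 1" for B :: "real^'n^'n"
  proof
    assume eq: "0 ** B = mat 1"
    have "x = 0" for x :: "real^'n"
      by (metis eq matrix_vector_mul_assoc matrix_vector_mul_lid matrix_vector_mult_0)
    from this[of "axis undefined 1"] show False by simp
  qed
  then have "\<not> (0 ** B = mat 1 \<and> B ** 0 = mat 1)" for B :: "real^'n^'n" by auto
  with * have "(\<lambda>B. A ** B = mat 1 \<and> B ** A = mat 1) = (\<lambda>B. 0 ** B = mat 1 \<and> B ** 0 = mat 1)"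
    by (simp only: fun_eq_iff) blast
  then show ?thesis by (simp only: matrix_inv_def)
qed

lemma matrix_inv_invertible:
  fixes A :: "real^'n^'n"
  assumes "invertible A" shows "A ** matrix_inv A = mat 1" "matrix_inv A ** A = mat 1"
  using someI_ex[of "\<lambda>A'. A ** A' = mat 1 \<and> A' ** A = mat 1"] assms
  by (auto simp: invertible_def matrix_inv_def)

lemma borel_measurable_matrix_inv:
  fixes f :: "'a \<Rightarrow> real^'n^'n"
  assumes [measurable]: "f \<in> borel_measurable M" "g \<in> borel_measurable M"
  shows "(\<lambda>x. matrix_inv (f x) *v g x) \<in> borel_measurable M"
proof -
  let ?r = "\<lambda>x. (\<chi> k. det (\<chi> i j. if j = k then g x $ i else f x $ i $ j) / det (f x)) :: real^'n"
  have "matrix_inv (f x) *v g x = (if det (f x) = 0 then matrix_inv 0 *v g x else ?r x)" for x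
  proof (cases "det (f x) = 0")
    case True
    then show ?thesis using matrix_inv_singular[of "f x"] by (simp add: invertible_det_nz)
  next
    case False
    then have "f x *v (matrix_inv (f x) *v g x) = g x"
      by (simp add: matrix_vector_mul_assoc invertible_det_nz matrix_inv_invertible)
    then show ?thesis using cramer[OF False] False by simp
  qed
  moreover have "(\<lambda>x. if det (f x) = 0 then matrix_inv 0 *v g x else ?r x) \<in> borel_measurable M"
  proof -
    have [measurable]: "(\<lambda>x. \<chi> i j. if j = k then g x $ i else f x $ i $ j) \<in> borel_measurable M" for k
      by (intro borel_measurable_vec_lambda) (auto split: if_split)
    have [measurable]: "?r \<in> borel_measurable M"
      by (intro borel_measurable_vec_lambda borel_measurable_divide borel_measurable_det) measurable
    have [measurable]: "(\<lambda>x. det (f x)) \<in> borel_measurable M" by (rule borel_measurable_det) fact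
    show ?thesis by measurable
  qed
  ultimately show ?thesis by simp
qed

lemma coercive_matrix_inv:
  fixes A :: "real^'n^'n"
  assumes c: "c > 0" "\<And>v. norm v = 1 \<Longrightarrow> c \<le> v \<bullet> (A *v v)"
  shows "A *v (matrix_inv A *v w) = w" "matrix_inv A *v (A *v w) = w"
    and "norm (matrix_inv A *v w) \<le> norm w / c"
    and "0 \<le> w \<bullet> (matrix_inv A *v w)" "w \<bullet> (matrix_inv A *v w) \<le> 1 / c * (norm w)\<^sup>2"
proof -
  have q: "c * (norm v)\<^sup>2 \<le> v \<bullet> (A *v v)" for v
  proof (cases "v = 0")
    case False
    then have "c \<le> (v /\<^sub>R norm v) \<bullet> (A *v (v /\<^sub>R norm v))" by (intro c) simp
    then show ?thesis using False
      by (simp add: matrix_vector_mult_scaleR field_simps power2_eq_square)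
  qed simp
  have n: "c * norm v \<le> norm (A *v v)" for v
  proof (cases "v = 0")
    case False
    have "c * norm v * norm v \<le> norm (A *v v) * norm v"
      using q[of v] Cauchy_Schwarz_ineq2[of v "A *v v"] by (simp add: power2_eq_square mult_ac)
    then show ?thesis using False by simp
  qed simp
  have "invertible A"
  proof -
    have "v = 0" if "A *v v = 0" for v using n[of v] that c(1) by (simp add: mult_le_0_iff)
    then show ?thesis
      by (metis invertible_left_inverse matrix_left_invertible_ker)
  qed
  then show 1: "A *v (matrix_inv A *v w) = w" and "matrix_inv A *v (A *v w) = w"
    by (simp_all add: matrix_vector_mul_assoc matrix_inv_invertible)
  then show b: "norm (matrix_inv A *v w) \<le> norm w / c"
    using n[of "matrix_inv A *v w"] c(1) by (simp add: field_simps)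
  have "0 \<le> c * (norm (matrix_inv A *v w))\<^sup>2" using c(1) by simp
  also note q[of "matrix_inv A *v w"]
  finally show "0 \<le> w \<bullet> (matrix_inv A *v w)" using 1 by (simp add: inner_commute)
  have "w \<bullet> (matrix_inv A *v w) \<le> norm w * norm (matrix_inv A *v w)" by (rule norm_cauchy_schwarz)
  also have "\<dots> \<le> norm w * (norm w / c)" by (intro mult_left_mono b) simp
  finally show "w \<bullet> (matrix_inv A *v w) \<le> 1 / c * (norm w)\<^sup>2" by (simp add: power2_eq_square)
qed

lemma transpose_matrix_inv_symmetric:
  fixes A :: "real^'n^'n"
  assumes "transpose A = A" "\<And>w. A *v (matrix_inv A *v w) = w"
  shows "transpose (matrix_inv A) = matrix_inv A"
proof -
  let ?B = "matrix_inv A"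
  have "x \<bullet> (?B *v y) = (?B *v x) \<bullet> y" for x y
    using symmetric_matrix_inner[OF assms(1), of "?B *v x" "?B *v y"] by (simp add: assms(2))
  then have "x \<bullet> (transpose ?B *v y) = x \<bullet> (?B *v y)" for x y
    by (metis dot_lmul_matrix inner_commute transpose_matrix_vector)
  then show ?thesis by (metis matrix_eq vector_eq_rdot inner_commute)
qed

lemma matrix_inv_diff:
  fixes A B :: "real^'n^'n"
  assumes "\<And>w. A *v (matrix_inv A *v w) = w" "\<And>w. matrix_inv A *v (A *v w) = w"
    and "\<And>w. B *v (matrix_inv B *v w) = w" "\<And>w. matrix_inv B *v (B *v w) = w"
  shows "matrix_inv A *v w - matrix_inv B *v w = matrix_inv A *v ((B - A) *v (matrix_inv B *v w))"
  by (simp add: matrix_vector_mult_diff_rdistrib matrix_vector_mult_diff_distrib assms)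

section \<open>The score of a location family\<close>

text \<open>$F(x+n) - F(x-n)$ tends to the integral for every $x$, but its mean over $x \in [0,1]$ tends to 0.\<close>
lemma integral_derivative_eq_0:
  fixes F f :: "real \<Rightarrow> real"
  assumes D: "\<And>x. (F has_real_derivative f x) (at x)" and c: "\<And>x. isCont f x"
    and iF: "integrable lborel F" and i_f: "integrable lborel f"
  shows "(\<integral>x. f x \<partial>lborel) = 0"
proof -
  let ?c = "\<integral>x. f x \<partial>lborel"
  let ?K = "\<integral>x. \<bar>f x\<bar> \<partial>lborel"
  have [measurable]: "f \<in> borel_measurable borel" "F \<in> borel_measurable borel"
    using iF i_f by (auto dest: borel_measurable_integrable)
  define d where "d n x = F (x + real n) - F (x - real n)" for n x
  have [measurable]: "d n \<in> borel_measurable borel" for n unfolding d_def by measurable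
  have deq: "d n x = (\<integral>y. f y * indicator {x - real n .. x + real n} y \<partial>lborel)" for n x
    unfolding d_def using D c by (subst integral_FTC_Icc_real[of _ _ F]) auto
  have dbd: "\<bar>d n x\<bar> \<le> ?K" for n x
  proof -
    have "\<bar>d n x\<bar> \<le> (\<integral>y. \<bar>f y * indicator {x - real n .. x + real n} y\<bar> \<partial>lborel)"
      unfolding deq by (rule integral_abs_bound)
    also have "\<dots> \<le> ?K"
      using i_f by (intro integral_mono' integrable_abs) (auto simp: indicator_def)
    finally show ?thesis .
  qed
  have dlim: "(\<lambda>n. d n x) \<longlonglongrightarrow> ?c" for x
    unfolding deq
  proof (rule integral_dominated_convergence[where w = "\<lambda>y. \<bar>f y\<bar>"])
    show "AE y in lborel. (\<lambda>n. f y * indicator {x - real n .. x + real n} y) \<longlonglongrightarrow> f y"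
    proof (rule AE_I2)
      fix y
      obtain N where N: "\<bar>y - x\<bar> \<le> real N" using real_arch_simple by blast
      have "\<forall>\<^sub>F n in sequentially. f y * indicator {x - real n .. x + real n} y = f y"
        using eventually_ge_at_top[of N] by eventually_elim (use N in \<open>auto simp: indicator_def\<close>)
      then show "(\<lambda>n. f y * indicator {x - real n .. x + real n} y) \<longlonglongrightarrow> f y"
        by (rule tendsto_eventually)
    qed
  qed (use i_f in \<open>auto simp: indicator_def\<close>)
  have 1: "(\<lambda>n. \<integral>x. d n x * indicator {0..1} x \<partial>lborel) \<longlonglongrightarrow> (\<integral>x. ?c * indicator {0..1::real} x \<partial>lborel)"
  proof (rule integral_dominated_convergence[where w = "\<lambda>x. ?K * indicator {0..1::real} x"])
    show "AE x in lborel. (\<lambda>n. d n x * indicator {0..1} x) \<longlonglongrightarrow> ?c * indicator {0..1} x"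
      by (intro AE_I2 tendsto_mult dlim tendsto_const)
    show "AE x in lborel. norm (d n x * indicator {0..1} x) \<le> ?K * indicator {0..1} x" for n
      using dbd by (intro AE_I2) (auto simp: indicator_def)
  qed auto
  have shift: "(\<integral>x. F (x + a) * indicator {0..1} x \<partial>lborel) = (\<integral>x. F x * indicator {a..a+1} x \<partial>lborel)" for a
    by (subst (2) lborel_integral_real_affine[of 1 _ a])
       (auto simp: indicator_def add.commute intro!: Bochner_Integration.integral_cong)
  have ii: "integrable lborel (\<lambda>x. F (x + a) * indicator {0..1} x)" for a
  proof -
    have "integrable lborel (\<lambda>x. F (a + 1 * x))"
      by (rule lborel_integrable_real_affine[OF iF]) simp
    then have "integrable lborel (\<lambda>x. F (x + a))" by (simp add: add.commute)
    from integrable_mult_indicator[OF _ this, of "{0..1}"] show ?thesis by (simp add: mult.commute)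
  qed
  have lim0: "(\<lambda>n. \<integral>x. F x * indicator {a n..a n + 1} x \<partial>lborel) \<longlonglongrightarrow> 0"
    if a: "\<And>x. \<forall>\<^sub>F n in sequentially. x \<notin> {a n..a n + 1}" for a :: "nat \<Rightarrow> real"
  proof -
    have "(\<lambda>n. \<integral>x. F x * indicator {a n..a n + 1} x \<partial>lborel) \<longlonglongrightarrow> (\<integral>(x::real). 0 \<partial>lborel)"
    proof (rule integral_dominated_convergence[where w = "\<lambda>y. \<bar>F y\<bar>"])
      show "AE x in lborel. (\<lambda>n. F x * indicator {a n..a n + 1} x) \<longlonglongrightarrow> 0"
      proof (rule AE_I2)
        show "(\<lambda>n. F x * indicator {a n..a n + 1} x) \<longlonglongrightarrow> 0" for x
          by (rule tendsto_eventually, rule eventually_mono[OF a[of x]]) (simp add: indicator_def)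
      qed
    qed (use iF in \<open>auto simp: indicator_def\<close>)
    then show ?thesis by simp
  qed
  have a1: "\<forall>\<^sub>F n in sequentially. x \<notin> {real n..real n + 1}" for x
  proof -
    obtain N where N: "\<bar>x\<bar> < real N" using reals_Archimedean2 by blast
    show ?thesis using eventually_ge_at_top[of N]
    proof eventually_elim
      case (elim n)
      then have "real N \<le> real n" by simp
      then show ?case using N by auto
    qed
  qed
  have a2: "\<forall>\<^sub>F n in sequentially. x \<notin> {- real n.. - real n + 1}" for x
  proof -
    obtain N where N: "\<bar>x\<bar> + 1 < real N" using reals_Archimedean2 by blast
    show ?thesis using eventually_ge_at_top[of N]
    proof eventually_elim
      case (elim n)
      then have "real N \<le> real n" by simp
      then show ?case using N by auto
    qed
  qed
  have "(\<integral>x. d n x * indicator {0..1} x \<partial>lborel) =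
      (\<integral>x. F x * indicator {real n..real n + 1} x \<partial>lborel) - (\<integral>x. F x * indicator {- real n..- real n + 1} x \<partial>lborel)" for n
  proof -
    have "(\<integral>x. d n x * indicator {0..1} x \<partial>lborel) =
        (\<integral>x. F (x + real n) * indicator {0..1} x - F (x + - real n) * indicator {0..1} x \<partial>lborel)"
      by (simp add: d_def left_diff_distrib)
    also have "\<dots> = (\<integral>x. F (x + real n) * indicator {0..1} x \<partial>lborel) - (\<integral>x. F (x + - real n) * indicator {0..1} x \<partial>lborel)"
      by (rule Bochner_Integration.integral_diff[OF ii ii])
    finally show ?thesis unfolding shift .
  qed
  then have "(\<lambda>n. \<integral>x. d n x * indicator {0..1} x \<partial>lborel) \<longlonglongrightarrow> 0 - 0"
    using tendsto_diff[OF lim0[OF a1] lim0[OF a2]] by simp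
  from LIMSEQ_unique[OF 1 this] show ?thesis by simp
qed

definition noise :: "(real \<Rightarrow> real) \<Rightarrow> real measure" where
  "noise g = density lborel (\<lambda>x. ennreal (g x))"

definition lg1 :: "(real \<Rightarrow> real) \<Rightarrow> real \<Rightarrow> real" where
  "lg1 g e = deriv g e / g e"

definition lg2 :: "(real \<Rightarrow> real) \<Rightarrow> real \<Rightarrow> real" where
  "lg2 g e = deriv (deriv g) e / g e - (lg1 g e)\<^sup>2"

lemma C3_real_deriv:
  assumes "C3_real g"
  shows "(g has_real_derivative deriv g x) (at x)"
    and "(deriv g has_real_derivative deriv (deriv g) x) (at x)"
    and "(deriv (deriv g) has_real_derivative deriv (deriv (deriv g)) x) (at x)"
proof -
  have k: "(deriv ^^ k) g differentiable at x" if "k < 3" for k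
    using assms that unfolding C3_real_def by blast
  show "(g has_real_derivative deriv g x) (at x)"
    and "(deriv g has_real_derivative deriv (deriv g) x) (at x)"
    and "(deriv (deriv g) has_real_derivative deriv (deriv (deriv g)) x) (at x)"
    using k[of 0] k[of 1] k[of 2] by (simp_all add: DERIV_deriv_iff_real_differentiable numeral_2_eq_2)
qed

lemma C3_real_isCont:
  assumes "C3_real g"
  shows "isCont g x" "isCont (deriv g) x" "isCont (deriv (deriv g)) x"
  using C3_real_deriv[OF assms] DERIV_isCont by blast+

lemma integrable_of_square:
  fixes f :: "'a \<Rightarrow> real"
  assumes "finite_measure M" "f \<in> borel_measurable M" "integrable M (\<lambda>x. (f x)\<^sup>2)"
  shows "integrable M f"
proof -
  interpret finite_measure M by fact
  have "integrable M (\<lambda>x. 1 + (f x)\<^sup>2)" using assms by simp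
  then show ?thesis
  proof (rule Bochner_Integration.integrable_bound)
    have "\<bar>y\<bar> \<le> 1 + y\<^sup>2" for y :: real
    proof -
      have "0 \<le> (\<bar>y\<bar> - 1/2)\<^sup>2" by simp
      then show ?thesis by (simp add: power2_eq_square algebra_simps)
    qed
    then show "AE x in M. norm (f x) \<le> norm (1 + (f x)\<^sup>2)"
      by (intro AE_I2) (simp add: abs_of_nonneg add_nonneg_nonneg)
  qed fact
qed

context
  fixes g :: "real \<Rightarrow> real"
  assumes g: "\<And>x. 0 < g x" "C3_real g"
begin

lemma lg1_deriv: "((\<lambda>e. ln (g e)) has_real_derivative lg1 g e) (at e)"
  using C3_real_deriv(1)[OF g(2)] g(1) by (auto intro!: derivative_eq_intros simp: lg1_def)

lemma lg2_deriv: "(lg1 g has_real_derivative lg2 g e) (at e)"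
proof -
  have "((\<lambda>e. deriv g e / g e) has_real_derivative lg2 g e) (at e)"
    using C3_real_deriv[OF g(2)] g(1)[of e]
    by (auto intro!: derivative_eq_intros simp: lg1_def lg2_def field_simps power2_eq_square)
  then show ?thesis by (simp add: lg1_def[abs_def])
qed

lemma lg2_differentiable: "lg2 g differentiable (at e)"
proof -
  have "(\<lambda>e. deriv (deriv g) e / g e - (deriv g e / g e)\<^sup>2) differentiable (at e)"
    using C3_real_deriv[OF g(2)] g(1)[of e]
    by (intro derivative_intros) (auto simp: real_differentiable_def)
  then show ?thesis by (simp add: lg1_def[abs_def] lg2_def[abs_def])
qed

lemma lg_measurable: "lg1 g \<in> borel_measurable borel" "lg2 g \<in> borel_measurable borel"
  "g \<in> borel_measurable borel"
  using DERIV_isCont[OF lg2_deriv] differentiable_imp_continuous_within[OF lg2_differentiable] C3_real_isCont(1)[OF g(2)]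
  by (intro borel_measurable_continuous_onI continuous_at_imp_continuous_on ballI; simp)+

lemma integrable_noise_iff:
  "f \<in> borel_measurable borel \<Longrightarrow> integrable (noise g) (f :: real \<Rightarrow> real) \<longleftrightarrow> integrable lborel (\<lambda>x. g x * f x)"
  unfolding noise_def using g(1) lg_measurable(3) by (subst integrable_density) (auto intro: less_imp_le AE_I2)

lemma integral_noise_eq:
  "f \<in> borel_measurable borel \<Longrightarrow> (\<integral>x. f x \<partial>noise g) = (\<integral>x. g x * (f x :: real) \<partial>lborel)"
  unfolding noise_def using g(1) lg_measurable(3) by (subst integral_density) (auto intro: less_imp_le AE_I2)

lemma score_identities:
  assumes P: "prob_space (noise g)"
    and i: "integrable (noise g) (\<lambda>e. (lg1 g e)\<^sup>2)" "integrable (noise g) (\<lambda>e. (lg2 g e)\<^sup>2)"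
  shows "integrable (noise g) (lg1 g)" "integrable (noise g) (lg2 g)"
    and "(\<integral>e. lg1 g e \<partial>noise g) = 0"
    and "(\<integral>e. lg2 g e \<partial>noise g) = - (\<integral>e. (lg1 g e)\<^sup>2 \<partial>noise g)"
proof -
  interpret prob_space "noise g" by fact
  have fm: "finite_measure (noise g)" by unfold_locales
  have [measurable_cong]: "sets (noise g) = sets borel" by (simp add: noise_def)
  note lg_measurable [measurable]
  show i1: "integrable (noise g) (lg1 g)" by (rule integrable_of_square[OF fm _ i(1)]) measurable
  show i2: "integrable (noise g) (lg2 g)" by (rule integrable_of_square[OF fm _ i(2)]) measurable
  have eq1: "g x * lg1 g x = deriv g x" for x using g(1)[of x] by (simp add: lg1_def)
  have eq2: "g x * lg2 g x = deriv (deriv g) x - g x * (lg1 g x)\<^sup>2" for x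
    using g(1)[of x] by (simp add: lg2_def right_diff_distrib)
  have "integrable (noise g) (\<lambda>x. 1 :: real)" by simp
  then have ig: "integrable lborel g" by (subst (asm) integrable_noise_iff) auto
  have ig1: "integrable lborel (deriv g)"
    using i1 by (subst (asm) integrable_noise_iff) (auto simp: eq1)
  have isq: "integrable lborel (\<lambda>x. g x * (lg1 g x)\<^sup>2)"
    using i(1) by (subst (asm) integrable_noise_iff) auto
  have "integrable lborel (\<lambda>x. g x * lg2 g x)"
    using i2 by (subst (asm) integrable_noise_iff) auto
  then have "integrable lborel (\<lambda>x. g x * lg2 g x + g x * (lg1 g x)\<^sup>2)"
    using isq by (rule Bochner_Integration.integrable_add)
  then have ig2: "integrable lborel (deriv (deriv g))" by (simp add: eq2)
  show "(\<integral>e. lg1 g e \<partial>noise g) = 0"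
    using integral_derivative_eq_0[OF C3_real_deriv(1) C3_real_isCont(2) ig ig1] g(2)
    by (subst integral_noise_eq) (auto simp: eq1)
  have "(\<integral>x. deriv (deriv g) x \<partial>lborel) = 0"
    using integral_derivative_eq_0[OF C3_real_deriv(2) C3_real_isCont(3) ig1 ig2] g(2) by simp
  then show "(\<integral>e. lg2 g e \<partial>noise g) = - (\<integral>e. (lg1 g e)\<^sup>2 \<partial>noise g)"
    using ig2 isq by (subst (1 2) integral_noise_eq) (auto simp: eq2)
qed

end


section \<open>Derivatives of the log-likelihood\<close>

lemma grad_eqI:
  assumes "(f has_derivative f') (at t)" shows "grad f t = (\<chi> i. f' (axis i 1))"
  using frechet_derivative_at[OF assms] by (simp add: grad_def)

lemma linear_eq_inner:
  fixes f :: "real^'d \<Rightarrow> real"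
  assumes "linear f" shows "f w = (\<chi> i. f (axis i 1)) \<bullet> w"
proof -
  have "f w = f (\<Sum>i\<in>UNIV. w $ i *\<^sub>R axis i 1)"
    by (simp add: basis_expansion flip: scalar_mult_eq_scaleR)
  also have "\<dots> = (\<Sum>i\<in>UNIV. w $ i * f (axis i 1))"
    using assms by (simp add: linear_sum linear_scale)
  finally show ?thesis by (simp add: inner_vec_def mult.commute)
qed

lemma grad_has_derivative:
  assumes "f differentiable (at t)" shows "(f has_derivative (\<lambda>w. grad f t \<bullet> w)) (at t)"
proof -
  obtain f' where f': "(f has_derivative f') (at t)" using assms by (auto simp: differentiable_def)
  have "f' w = grad f t \<bullet> w" for w
    unfolding grad_eqI[OF f'] by (rule linear_eq_inner[OF has_derivative_linear[OF f']])
  then show ?thesis using f' by (metis ext)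
qed

lemma grad_unique:
  assumes "(f has_derivative (\<lambda>w. v \<bullet> w)) (at t)" shows "grad f t = v"
  by (simp add: grad_eqI[OF assms] vec_eq_iff inner_axis)

lemma jacobian_has_derivative:
  fixes f :: "real^'d \<Rightarrow> real^'e"
  assumes "f differentiable (at t)" shows "(f has_derivative (\<lambda>w. jacobian f (at t) *v w)) (at t)"
  using assms jacobian_works by blast

lemma jacobian_unique:
  fixes f :: "real^'d \<Rightarrow> real^'e"
  assumes "(f has_derivative (\<lambda>w. A *v w)) (at t)" shows "jacobian f (at t) = A"
  using frechet_derivative_at[OF assms] by (metis jacobian_def matrix_of_matrix_vector_mul)

lemma differentiable_vecI:
  fixes f :: "'a::real_normed_vector \<Rightarrow> 'b::euclidean_space^'n"
  assumes "\<And>i. (\<lambda>x. f x $ i) differentiable (at t)"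
  shows "f differentiable (at t)"
proof (subst differentiable_componentwise_within, safe)
  fix b :: "'b^'n" assume "b \<in> Basis"
  then obtain i u where "b = axis i u" by (auto simp: Basis_vec_def)
  then show "(\<lambda>x. f x \<bullet> b) differentiable (at t)"
    using assms[of i] by (auto simp: inner_axis intro: differentiable_inner)
qed

lemma differentiable_vec_nth:
  fixes f :: "'a::real_normed_vector \<Rightarrow> 'b::real_normed_vector^'n"
  assumes "f differentiable (at t)" shows "(\<lambda>x. f x $ i) differentiable (at t)"
  using assms bounded_linear.has_derivative[OF bounded_linear_vec_nth] unfolding differentiable_def by blast

context
  fixes \<Theta> :: "(real^'d) set" and S :: "real^'d \<Rightarrow> real \<Rightarrow> real" and g :: "real \<Rightarrow> real"
  assumes open_Theta: "open \<Theta>" and S_C3: "\<And>x. C3_on \<Theta> (\<lambda>t. S t x)"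
    and g: "\<And>x. 0 < g x" "C3_real g"
begin

lemma S_derivs:
  assumes "t \<in> \<Theta>"
  shows "((\<lambda>u. S u x) has_derivative (\<lambda>w. grad (\<lambda>u. S u x) t \<bullet> w)) (at t)"
    and "(grad (\<lambda>u. S u x) has_derivative (\<lambda>w. jacobian (grad (\<lambda>u. S u x)) (at t) *v w)) (at t)"
    and "(\<lambda>v. jacobian (grad (\<lambda>u. S u x)) (at v)) differentiable (at t)"
  using S_C3[of x] assms grad_has_derivative jacobian_has_derivative unfolding C3_on_def by blast+

lemma residual_deriv:
  assumes "t \<in> \<Theta>"
  shows "((\<lambda>u. x' - S u x) has_derivative (\<lambda>w. - (grad (\<lambda>u. S u x) t \<bullet> w))) (at t)"
  by (rule has_derivative_eq_rhs[OF has_derivative_diff[OF has_derivative_const S_derivs(1)[OF assms]]]) simp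

lemma ldot_eq:
  assumes "t \<in> \<Theta>"
  shows "ldot S g t x x' = - lg1 g (x' - S t x) *\<^sub>R grad (\<lambda>u. S u x) t"
    and "(\<lambda>u. ell S g u x x') differentiable (at t)"
proof -
  have *: "((\<lambda>u. ln (g (x' - S u x))) has_derivative
      (\<lambda>w. lg1 g (x' - S t x) * (- (grad (\<lambda>u. S u x) t \<bullet> w)))) (at t)"
    by (rule has_derivative_compose[OF residual_deriv[OF assms]
          lg1_deriv[OF g, of "x' - S t x", unfolded has_field_derivative_def]])
  then show "(\<lambda>u. ell S g u x x') differentiable (at t)"
    unfolding ell_def by (auto simp: differentiable_def)
  from * have "((\<lambda>u. ell S g u x x') has_derivative (\<lambda>w. (- lg1 g (x' - S t x) *\<^sub>R grad (\<lambda>u. S u x) t) \<bullet> w)) (at t)"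
    unfolding ell_def by (rule has_derivative_eq_rhs) simp
  then show "ldot S g t x x' = - lg1 g (x' - S t x) *\<^sub>R grad (\<lambda>u. S u x) t"
    unfolding ldot_def by (rule grad_unique)
qed

lemma lg1_S_deriv:
  assumes "t \<in> \<Theta>"
  shows "((\<lambda>u. lg1 g (x' - S u x)) has_derivative
      (\<lambda>w. lg2 g (x' - S t x) * (- (grad (\<lambda>u. S u x) t \<bullet> w)))) (at t)"
  by (rule has_derivative_compose[OF residual_deriv[OF assms]
        lg2_deriv[OF g, of "x' - S t x", unfolded has_field_derivative_def]])

lemma lddot_eq:
  assumes t: "t \<in> \<Theta>"
  shows "lddot S g t x x' = (\<chi> i j. lg2 g (x' - S t x) * (grad (\<lambda>u. S u x) t $ i * grad (\<lambda>u. S u x) t $ j)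
            - lg1 g (x' - S t x) * jacobian (grad (\<lambda>u. S u x)) (at t) $ i $ j)" (is "_ = ?A")
    and "((\<lambda>u. ldot S g u x x') has_derivative (\<lambda>w. lddot S g t x x' *v w)) (at t)"
proof -
  let ?e = "x' - S t x" and ?G = "grad (\<lambda>u. S u x)" and ?J = "jacobian (grad (\<lambda>u. S u x)) (at t)"
  have "((\<lambda>u. - lg1 g (x' - S u x) *\<^sub>R ?G u) has_derivative
     (\<lambda>w. - lg1 g ?e *\<^sub>R (?J *v w) + (lg2 g ?e * (?G t \<bullet> w)) *\<^sub>R ?G t)) (at t)"
    by (rule has_derivative_eq_rhs[OF has_derivative_scaleR[OF has_derivative_minus[OF lg1_S_deriv[OF t]] S_derivs(2)[OF t]]])
       simp
  moreover have "- lg1 g ?e *\<^sub>R (?J *v w) + (lg2 g ?e * (?G t \<bullet> w)) *\<^sub>R ?G t = ?A *v w" for w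
    by (simp add: vec_eq_iff matrix_vector_mult_def inner_vec_def sum_distrib_left sum_distrib_right
        sum_subtractf[symmetric] algebra_simps)
  ultimately have "((\<lambda>u. - lg1 g (x' - S u x) *\<^sub>R ?G u) has_derivative (\<lambda>w. ?A *v w)) (at t)"
    by simp
  then have D: "((\<lambda>u. ldot S g u x x') has_derivative (\<lambda>w. ?A *v w)) (at t)"
    by (rule has_derivative_transform_within_open[OF _ open_Theta t]) (simp add: ldot_eq(1))
  show eq: "lddot S g t x x' = ?A"
    unfolding lddot_def by (rule jacobian_unique[OF D])
  show "((\<lambda>u. ldot S g u x x') has_derivative (\<lambda>w. lddot S g t x x' *v w)) (at t)"
    using D unfolding eq .
qed

lemma lddot_differentiable:
  assumes t: "t \<in> \<Theta>"
  shows "(\<lambda>u. lddot S g u x x') differentiable (at t)"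
proof -
  have "(\<lambda>u. lg2 g (x' - S u x)) differentiable (at t)"
    using has_derivative_compose[OF residual_deriv[OF t]] lg2_differentiable[OF g, of "x' - S t x"]
    unfolding differentiable_def by blast
  moreover have "(\<lambda>u. lg1 g (x' - S u x)) differentiable (at t)"
    using lg1_S_deriv[OF t] by (auto simp: differentiable_def)
  moreover have "(\<lambda>u. grad (\<lambda>u. S u x) u $ i) differentiable (at t)" for i
    using S_derivs(2)[OF t] by (intro differentiable_vec_nth) (auto simp: differentiable_def)
  moreover have "(\<lambda>u. jacobian (grad (\<lambda>u. S u x)) (at u) $ i $ j) differentiable (at t)" for i j
    using S_derivs(3)[OF t] by (intro differentiable_vec_nth)
  ultimately have "(\<lambda>t. (\<chi> i j. lg2 g (x' - S t x) * (grad (\<lambda>u. S u x) t $ i * grad (\<lambda>u. S u x) t $ j)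
            - lg1 g (x' - S t x) * jacobian (grad (\<lambda>u. S u x)) (at t) $ i $ j)) differentiable (at t)"
    by (intro differentiable_vecI) (auto intro!: derivative_intros)
  then obtain D where "((\<lambda>t. (\<chi> i j. lg2 g (x' - S t x) * (grad (\<lambda>u. S u x) t $ i * grad (\<lambda>u. S u x) t $ j)
            - lg1 g (x' - S t x) * jacobian (grad (\<lambda>u. S u x)) (at t) $ i $ j)) has_derivative D) (at t)"
    by (auto simp: differentiable_def)
  then have "((\<lambda>u. lddot S g u x x') has_derivative D) (at t)"
    by (rule has_derivative_transform_within_open[OF _ open_Theta t]) (simp add: lddot_eq(1))
  then show ?thesis by (auto simp: differentiable_def)
qed

lemma norm_lddot_derivative_le:
  assumes t: "t \<in> \<Theta>"
  shows "((\<lambda>u. lddot S g u x x') has_derivative frechet_derivative (\<lambda>u. lddot S g u x x') (at t)) (at t)"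
    and "norm (frechet_derivative (\<lambda>u. lddot S g u x x') (at t) w) \<le> norm (l3dot S g t x x') * norm w"
proof -
  let ?D = "frechet_derivative (\<lambda>u. lddot S g u x x') (at t)"
  let ?L = "l3dot S g t x x'"
  show D: "((\<lambda>u. lddot S g u x x') has_derivative ?D) (at t)"
    using lddot_differentiable[OF t] frechet_derivative_works by blast
  have L: "?L $ i $ j $ k = ?D (axis k 1) $ i $ j" for i j k
    by (simp add: l3dot_def third_deriv_def lddot_def[abs_def] ldot_def[abs_def])
  have row: "?D w $ i = ?L $ i *v w" for i
  proof (subst vec_eq_iff, rule allI)
    fix j
    have lin: "linear (\<lambda>w. ?D w $ i $ j)"
      using has_derivative_linear[OF D]
      by (intro linearI) (simp_all add: linear_add linear_scale)
    show "?D w $ i $ j = (?L $ i *v w) $ j"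
      by (subst linear_eq_inner[OF lin, of w]) (simp add: matrix_vector_mult_def inner_vec_def L)
  qed
  have "norm (?D w) = L2_set (\<lambda>i. norm (?L $ i *v w)) UNIV"
    by (simp add: norm_vec_def[of "?D w"] row)
  also have "\<dots> \<le> L2_set (\<lambda>i. norm (?L $ i) * norm w) UNIV"
    by (intro L2_set_mono norm_matrix_vector_mult_le) auto
  also have "\<dots> = norm ?L * norm w"
    by (simp add: norm_vec_def[of ?L] L2_set_left_distrib)
  finally show "norm (?D w) \<le> norm ?L * norm w" .
qed

lemma ldot_taylor:
  assumes conv: "convex \<Theta>" and t: "t \<in> \<Theta>" and u: "u \<in> \<Theta>"
    and R: "\<And>v. v \<in> \<Theta> \<Longrightarrow> norm (l3dot S g v x x') \<le> R"
  shows "norm (ldot S g u x x' - ldot S g t x x' - lddot S g t x x' *v (u - t)) \<le> R * (norm (u - t))\<^sup>2"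
proof -
  have R0: "R \<ge> 0" using R[OF t] norm_ge_zero order_trans by blast
  have lip: "norm (lddot S g v x x' - lddot S g t x x') \<le> R * norm (v - t)" if v: "v \<in> \<Theta>" for v
  proof (rule differentiable_bound[OF conv _ _ v t])
    show "((\<lambda>u. lddot S g u x x') has_derivative frechet_derivative (\<lambda>u. lddot S g u x x') (at y)) (at y within \<Theta>)"
      if "y \<in> \<Theta>" for y using norm_lddot_derivative_le(1)[OF that] by (rule has_derivative_at_withinI)
    show "onorm (frechet_derivative (\<lambda>u. lddot S g u x x') (at y)) \<le> R" if "y \<in> \<Theta>" for y
      using norm_lddot_derivative_le(2)[OF that] R[OF that] R0
      by (intro onorm_le) (meson mult_right_mono norm_ge_zero order_trans)
  qed
  define f where "f v = ldot S g v x x' - lddot S g t x x' *v v" for v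
  have seg: "closed_segment t u \<subseteq> \<Theta>" using conv t u by (simp add: closed_segment_subset)
  have "norm (f u - f t) \<le> (R * norm (u - t)) * norm (u - t)"
  proof (rule differentiable_bound[OF convex_closed_segment])
    fix v assume v: "v \<in> closed_segment t u"
    then have vT: "v \<in> \<Theta>" using seg by auto
    show "(f has_derivative (\<lambda>w. lddot S g v x x' *v w - lddot S g t x x' *v w)) (at v within closed_segment t u)"
      unfolding f_def
      by (rule has_derivative_at_withinI[OF has_derivative_diff[OF lddot_eq(2)[OF vT]
            linear_imp_has_derivative[OF matrix_vector_mul_linear]]])
    have "norm (lddot S g v x x' *v w - lddot S g t x x' *v w) \<le> (R * norm (u - t)) * norm w" for w
    proof -
      have "norm (lddot S g v x x' *v w - lddot S g t x x' *v w) \<le> norm (lddot S g v x x' - lddot S g t x x') * norm w"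
        by (metis matrix_vector_mult_diff_rdistrib norm_matrix_vector_mult_le)
      also have "\<dots> \<le> (R * norm (v - t)) * norm w" by (intro mult_right_mono lip vT) simp
      also have "\<dots> \<le> (R * norm (u - t)) * norm w"
        using segment_bound1[OF v] R0 by (intro mult_right_mono mult_left_mono) (auto simp: norm_minus_commute)
      finally show ?thesis .
    qed
    then show "onorm (\<lambda>w. lddot S g v x x' *v w - lddot S g t x x' *v w) \<le> R * norm (u - t)"
      by (intro onorm_le)
  qed auto
  moreover have "f u - f t = ldot S g u x x' - ldot S g t x x' - lddot S g t x x' *v (u - t)"
    by (simp add: f_def matrix_vector_mult_diff_distrib)
  ultimately show ?thesis unfolding power2_eq_square mult.assoc by metis
qed

end

section \<open>The autoregressive model\<close>

lemma borel_measurable_directional_derivative: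
  fixes f :: "'p::real_normed_vector \<Rightarrow> 'x \<Rightarrow> 'b::{real_normed_vector, second_countable_topology}"
  assumes "open T" "t \<in> T" and f: "\<And>u. u \<in> T \<Longrightarrow> f u \<in> borel_measurable M"
    and D: "\<And>x. ((\<lambda>u. f u x) has_derivative D x) (at t)"
  shows "(\<lambda>x. D x w) \<in> borel_measurable M"
proof (cases "w = 0")
  case True
  then have "D x w = 0" for x using has_derivative_linear[OF D] linear_0 by blast
  then show ?thesis by simp
next
  case False
  define h where "h n = inverse (real (Suc n))" for n
  have h: "h n > 0" for n by (simp add: h_def)
  have h0: "h \<longlonglongrightarrow> 0" unfolding h_def by (rule LIMSEQ_inverse_real_of_nat)
  have y0: "(\<lambda>n. t + h n *\<^sub>R w) \<longlonglongrightarrow> t"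
    using tendsto_add[OF tendsto_const tendsto_scaleR[OF h0 tendsto_const], of t w] by simp
  then have ev: "\<forall>\<^sub>F n in sequentially. t + h n *\<^sub>R w \<in> T"
    using assms(1,2) by (rule topological_tendstoD)
  define q where "q n x = (if t + h n *\<^sub>R w \<in> T then inverse (h n) *\<^sub>R (f (t + h n *\<^sub>R w) x - f t x) else 0)" for n x
  have "q n \<in> borel_measurable M" for n
    unfolding q_def using f assms(2) by (cases "t + h n *\<^sub>R w \<in> T") auto
  moreover have "(\<lambda>n. q n x) \<longlonglongrightarrow> D x w" for x
  proof -
    have lin: "linear (D x)" by (rule has_derivative_linear[OF D])
    have "filterlim (\<lambda>n. t + h n *\<^sub>R w) (at t) sequentially"
      unfolding filterlim_at using y0 h False by (auto simp: less_imp_neq[symmetric])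
    moreover have "(\<lambda>y. (f y x - f t x - D x (y - t)) /\<^sub>R norm (y - t)) \<midarrow>t\<rightarrow> 0"
      using D[of x] by (simp add: has_derivative_at_within)
    ultimately have "(\<lambda>n. (f (t + h n *\<^sub>R w) x - f t x - D x (t + h n *\<^sub>R w - t)) /\<^sub>R norm (t + h n *\<^sub>R w - t)) \<longlonglongrightarrow> 0"
      by (rule filterlim_compose[rotated])
    then have "(\<lambda>n. norm w *\<^sub>R ((f (t + h n *\<^sub>R w) x - f t x - D x (h n *\<^sub>R w)) /\<^sub>R norm (h n *\<^sub>R w))) \<longlonglongrightarrow> norm w *\<^sub>R 0"
      by (intro tendsto_scaleR tendsto_const) simp
    moreover have "norm w *\<^sub>R ((f (t + h n *\<^sub>R w) x - f t x - D x (h n *\<^sub>R w)) /\<^sub>R norm (h n *\<^sub>R w))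
       = inverse (h n) *\<^sub>R (f (t + h n *\<^sub>R w) x - f t x) - D x w" for n
    proof -
      have "norm w *\<^sub>R (v /\<^sub>R norm (h n *\<^sub>R w)) = v /\<^sub>R h n" for v :: 'b
        using h[of n] False by (simp add: field_simps)
      then show ?thesis
        using h[of n] by (simp only: linear_scale[OF lin]) (simp add: scaleR_diff_right)
    qed
    ultimately have "(\<lambda>n. inverse (h n) *\<^sub>R (f (t + h n *\<^sub>R w) x - f t x) - D x w) \<longlonglongrightarrow> 0" by simp
    then have "(\<lambda>n. inverse (h n) *\<^sub>R (f (t + h n *\<^sub>R w) x - f t x)) \<longlonglongrightarrow> D x w" by (simp add: LIM_zero_iff)
    then show ?thesis
      by (rule Lim_transform_eventually) (use ev in \<open>auto simp: q_def elim: eventually_mono\<close>)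
  qed
  ultimately show ?thesis by (rule borel_measurable_LIMSEQ_metric)
qed

lemma space_path [simp]: "space path_space = UNIV"
  by (simp add: path_space_def space_PiM)

lemma measurable_coordinate [measurable]: "(\<lambda>\<omega>. \<omega> j) \<in> borel_measurable path_space"
  unfolding path_space_def by (rule measurable_component_singleton) simp

lemma measurable_into_path:
  "(\<And>j. (\<lambda>x. f x j) \<in> borel_measurable M) \<Longrightarrow> f \<in> measurable M path_space"
  unfolding path_space_def by (rule measurable_PiM_single') (auto simp: space_PiM)

definition past :: "nat \<Rightarrow> (nat \<Rightarrow> real) \<Rightarrow> nat \<Rightarrow> real" where
  "past j \<omega> = (\<lambda>i. if i < j then \<omega> i else 0)"

lemma past_apply: "i < j \<Longrightarrow> past j \<omega> i = \<omega> i" by (simp add: past_def)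

lemma measurable_past [measurable]: "past j \<in> measurable path_space path_space"
proof (rule measurable_into_path)
  show "(\<lambda>\<omega>. past j \<omega> i) \<in> borel_measurable path_space" for i
    by (cases "i < j") (simp_all add: past_def)
qed

locale ar_model =
  fixes \<Theta> :: "(real^'d) set"
    and S :: "real^'d \<Rightarrow> real \<Rightarrow> real"
    and g :: "real \<Rightarrow> real"
    and P :: "real^'d \<Rightarrow> (nat \<Rightarrow> real) measure"
  assumes open_Theta: "open \<Theta>" and convex_Theta: "convex \<Theta>"
    and model_prob: "\<And>t. t \<in> \<Theta> \<Longrightarrow> prob_space (P t) \<and> sets (P t) = sets path_space"
    and model_indep: "\<And>t. t \<in> \<Theta> \<Longrightarrow> prob_space.indep_vars (P t) (\<lambda>_. borel)
              (\<lambda>j \<omega>. if j = 0 then \<omega> 0 else \<omega> j - S t (\<omega> (j - 1))) UNIV"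
    and model_noise: "\<And>t j. t \<in> \<Theta> \<Longrightarrow> 1 \<le> j \<Longrightarrow>
              distributed (P t) lborel (\<lambda>\<omega>. \<omega> j - S t (\<omega> (j - 1))) (\<lambda>x. ennreal (g x))"
    and S_C3: "\<And>x. C3_on \<Theta> (\<lambda>t. S t x)"
    and g_pos: "\<And>x. 0 < g x" and g_C3: "C3_real g"
    and R3_bounds: "\<exists>R1 R2 R3 C.
              (\<forall>t\<in>\<Theta>. \<forall>x x'. norm (ldot S g t x x') \<le> R1 x x'
                          \<and> norm (lddot S g t x x') \<le> R2 x x'
                          \<and> norm (l3dot S g t x x') \<le> R3 x x') \<and>
              (\<forall>t\<in>\<Theta>. \<forall>j\<ge>1.
                  (\<integral>\<^sup>+\<omega>. ennreal (\<bar>R1 (\<omega> (j - 1)) (\<omega> j)\<bar>\<^sup>2) \<partial>P t) < ennreal C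
                \<and> (\<integral>\<^sup>+\<omega>. ennreal (\<bar>R2 (\<omega> (j - 1)) (\<omega> j)\<bar>\<^sup>2) \<partial>P t) < ennreal C
                \<and> (\<integral>\<^sup>+\<omega>. ennreal (\<bar>R3 (\<omega> (j - 1)) (\<omega> j)\<bar>\<^sup>2) \<partial>P t) < ennreal C)"
    and R4_tight: "unif_tight \<Theta> P
              (\<lambda>n t \<omega>. (1 / sqrt (real n)) *\<^sub>R (\<Sum>j=1..n. lddot S g t (\<omega> (j - 1)) (\<omega> j) + fisher P S g t))"
    and R5_Lip: "\<exists>L. \<forall>t1\<in>\<Theta>. \<forall>t2\<in>\<Theta>. norm (fisher P S g t1 - fisher P S g t2) \<le> L * norm (t1 - t2)"
    and R5_nondeg: "\<exists>c>0. \<forall>t\<in>\<Theta>. \<forall>v::real^'d. norm v = 1 \<longrightarrow> c \<le> v \<bullet> (fisher P S g t *v v)"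
    and R5_bdd: "\<exists>C. \<forall>t\<in>\<Theta>. \<forall>v::real^'d. norm v = 1 \<longrightarrow> v \<bullet> (fisher P S g t *v v) \<le> C"
    and meas_ldot: "(\<lambda>(t, x, x'). ldot S g t x x') \<in> borel_measurable borel"
    and meas_fisher: "fisher P S g \<in> borel_measurable borel"
    and Theta_ne: "\<Theta> \<noteq> {}"
begin

abbreviation "Sd t x \<equiv> grad (\<lambda>u. S u x) t"
abbreviation "eps t j \<omega> \<equiv> \<omega> j - S t (\<omega> (j - 1))"
abbreviation "score t j \<omega> \<equiv> ldot S g t (\<omega> (j - 1)) (\<omega> j)"
abbreviation "hess t j \<omega> \<equiv> lddot S g t (\<omega> (j - 1)) (\<omega> j)"
abbreviation "I \<equiv> fisher P S g"

lemma P_prob: "t \<in> \<Theta> \<Longrightarrow> prob_space (P t)" and sets_P: "t \<in> \<Theta> \<Longrightarrow> sets (P t) = sets path_space"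
  using model_prob by auto

lemma space_P: "t \<in> \<Theta> \<Longrightarrow> space (P t) = UNIV"
  using sets_eq_imp_space_eq[OF sets_P] by simp

lemma measurable_P: "t \<in> \<Theta> \<Longrightarrow> measurable (P t) N = measurable path_space N"
  by (rule measurable_cong_sets) (simp_all add: sets_P)

lemma measurable_eps: "t \<in> \<Theta> \<Longrightarrow> (\<lambda>\<omega>. eps t (Suc j) \<omega>) \<in> borel_measurable path_space"
proof -
  assume t: "t \<in> \<Theta>"
  interpret prob_space "P t" by (rule P_prob[OF t])
  have "\<forall>j\<in>UNIV. random_variable borel (\<lambda>\<omega>. if j = 0 then \<omega> 0 else \<omega> j - S t (\<omega> (j - 1)))"
    using model_indep[OF t] unfolding indep_vars_def by blast
  from bspec[OF this UNIV_I, of "Suc j"] show "(\<lambda>\<omega>. eps t (Suc j) \<omega>) \<in> borel_measurable path_space"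
    by (simp add: measurable_P[OF t])
qed

lemma measurable_S: "t \<in> \<Theta> \<Longrightarrow> S t \<in> borel_measurable borel"
proof -
  assume t: "t \<in> \<Theta>"
  have "(\<lambda>x. \<lambda>_. x) \<in> measurable borel path_space"
    by (rule measurable_into_path) simp
  from measurable_compose[OF this measurable_eps[OF t, of 0]]
  have "(\<lambda>x. x - S t x) \<in> borel_measurable borel" by simp
  then have "(\<lambda>x. x - (x - S t x)) \<in> borel_measurable borel"
    by (rule borel_measurable_diff[rotated]) simp
  moreover have "(\<lambda>x. x - (x - S t x)) = S t" by auto
  ultimately show "S t \<in> borel_measurable borel" by metis
qed

lemma S_has_derivative:
  assumes "t \<in> \<Theta>"
  shows "((\<lambda>u. S u x) has_derivative (\<lambda>w. Sd t x \<bullet> w)) (at t)"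
  by (rule S_derivs(1)[where S = S, OF open_Theta S_C3 g_pos g_C3 assms])

lemma ldot_has_derivative:
  assumes "t \<in> \<Theta>"
  shows "((\<lambda>u. ldot S g u x x') has_derivative (\<lambda>w. lddot S g t x x' *v w)) (at t)"
  by (rule lddot_eq(2)[where S = S, OF open_Theta S_C3 g_pos g_C3 assms])

lemma measurable_Sd:
  assumes t: "t \<in> \<Theta>" shows "Sd t \<in> borel_measurable borel"
proof -
  have "(\<lambda>x. Sd t x \<bullet> w) \<in> borel_measurable borel" for w
    by (rule borel_measurable_directional_derivative[OF open_Theta t measurable_S S_has_derivative[OF t]])
  then show ?thesis by (subst borel_measurable_euclidean_space) simp
qed

lemma measurable_ldot:
  assumes [measurable]: "u \<in> borel_measurable M" "a \<in> borel_measurable M" "b \<in> borel_measurable M"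
  shows "(\<lambda>\<omega>. ldot S g (u \<omega>) (a \<omega>) (b \<omega>)) \<in> borel_measurable M"
  using measurable_compose[OF _ meas_ldot, of "\<lambda>\<omega>. (u \<omega>, a \<omega>, b \<omega>)" M] by simp

lemma measurable_lddot:
  assumes t: "t \<in> \<Theta>" and ab: "a \<in> borel_measurable M" "b \<in> borel_measurable M"
  shows "(\<lambda>\<omega>. lddot S g t (a \<omega>) (b \<omega>)) \<in> borel_measurable M"
proof -
  have "(\<lambda>\<omega>. lddot S g t (a \<omega>) (b \<omega>) *v w) \<in> borel_measurable M" for w
    by (rule borel_measurable_directional_derivative[OF open_Theta t, of "\<lambda>u \<omega>. ldot S g u (a \<omega>) (b \<omega>)"])
       (use ab in \<open>auto intro!: measurable_ldot ldot_has_derivative[OF t]\<close>)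
  then have "(\<lambda>\<omega>. (lddot S g t (a \<omega>) (b \<omega>) *v axis j 1) $ i) \<in> borel_measurable M" for i j
    by (rule borel_measurable_vec_nth)
  then have "(\<lambda>\<omega>. lddot S g t (a \<omega>) (b \<omega>) $ i $ j) \<in> borel_measurable M" for i j
    unfolding matrix_vector_mult_basis column_def vec_lambda_beta .
  then have "(\<lambda>\<omega>. \<chi> i j. lddot S g t (a \<omega>) (b \<omega>) $ i $ j) \<in> borel_measurable M"
    by (intro borel_measurable_vec_lambda)
  then show ?thesis by simp
qed

lemma measurable_score: "t \<in> \<Theta> \<Longrightarrow> score t j \<in> borel_measurable path_space"
  and measurable_hess: "t \<in> \<Theta> \<Longrightarrow> hess t j \<in> borel_measurable path_space"
  by (auto intro!: measurable_ldot measurable_lddot)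

lemma sets_noise [simp, measurable_cong]: "sets (noise g) = sets borel"
  and space_noise [simp]: "space (noise g) = UNIV"
  by (simp_all add: noise_def)

lemma noise_distr: "t \<in> \<Theta> \<Longrightarrow> distr (P t) borel (eps t (Suc j)) = noise g"
proof -
  assume t: "t \<in> \<Theta>"
  have "distr (P t) borel (eps t (Suc j)) = distr (P t) lborel (eps t (Suc j))"
    by (rule distr_cong) auto
  also have "\<dots> = noise g"
    using model_noise[OF t, of "Suc j"] by (simp add: distributed_def noise_def)
  finally show ?thesis .
qed

lemma prob_noise: "prob_space (noise g)"
proof -
  obtain t where t: "t \<in> \<Theta>" using Theta_ne by auto
  interpret prob_space "P t" by (rule P_prob[OF t])
  show ?thesis
    using prob_space_distr[of "eps t (Suc 0)" borel] measurable_eps[OF t, of 0] noise_distr[OF t, of 0]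
    by (simp add: measurable_P[OF t])
qed

fun path_of_noise :: "real^'d \<Rightarrow> (nat \<Rightarrow> real) \<Rightarrow> nat \<Rightarrow> real" where
  "path_of_noise t y 0 = y 0"
| "path_of_noise t y (Suc i) = S t (path_of_noise t y i) + y (Suc i)"

lemma joint_law:
  assumes t: "t \<in> \<Theta>"
  shows "distr (P t) (path_space \<Otimes>\<^sub>M borel) (\<lambda>\<omega>. (past (Suc j) \<omega>, eps t (Suc j) \<omega>))
       = distr (P t) path_space (past (Suc j)) \<Otimes>\<^sub>M noise g"
proof -
  interpret prob_space "P t" by (rule P_prob[OF t])
  have [measurable]: "S t \<in> borel_measurable borel" by (rule measurable_S[OF t])
  define Y :: "nat \<Rightarrow> (nat \<Rightarrow> real) \<Rightarrow> real" where "Y = (\<lambda>j \<omega>. if j = 0 then \<omega> 0 else \<omega> j - S t (\<omega> (j - 1)))"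
  have iY: "indep_vars (\<lambda>_. borel) Y UNIV" unfolding Y_def by (rule model_indep[OF t])
  define h where "h y = (\<lambda>i. if i < Suc j then path_of_noise t y i else 0)" for y
  have mb: "i < Suc j \<Longrightarrow> (\<lambda>y. path_of_noise t y i) \<in> borel_measurable (Pi\<^sub>M {..<Suc j} (\<lambda>_. borel))" for i
  proof (induction i)
    case (Suc i)
    then have "(\<lambda>y. path_of_noise t y i) \<in> borel_measurable (Pi\<^sub>M {..<Suc j} (\<lambda>_. borel))" by simp
    then have "(\<lambda>y. S t (path_of_noise t y i)) \<in> borel_measurable (Pi\<^sub>M {..<Suc j} (\<lambda>_. borel))" by measurable
    moreover have "(\<lambda>y. y (Suc i)) \<in> borel_measurable (Pi\<^sub>M {..<Suc j} (\<lambda>_. borel))"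
      using Suc.prems by (intro measurable_component_singleton) simp
    ultimately have "(\<lambda>y. S t (path_of_noise t y i) + y (Suc i)) \<in> borel_measurable (Pi\<^sub>M {..<Suc j} (\<lambda>_. borel))"
      by (rule borel_measurable_add)
    then show ?case by simp
  qed simp
  have mh: "h \<in> measurable (Pi\<^sub>M {..<Suc j} (\<lambda>_. borel)) path_space"
  proof (rule measurable_into_path)
    show "(\<lambda>y. h y i) \<in> borel_measurable (Pi\<^sub>M {..<Suc j} (\<lambda>_. borel))" for i
      by (cases "i < Suc j") (simp_all add: h_def mb del: path_of_noise.simps)
  qed
  have "indep_var (Pi\<^sub>M {..<Suc j} (\<lambda>_. borel)) (\<lambda>\<omega>. restrict (\<lambda>i. Y i \<omega>) {..<Suc j})
      (Pi\<^sub>M {Suc j} (\<lambda>_. borel)) (\<lambda>\<omega>. restrict (\<lambda>i. Y i \<omega>) {Suc j})"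
    by (rule indep_var_restrict[OF iY]) auto
  then have "indep_var path_space (h \<circ> (\<lambda>\<omega>. restrict (\<lambda>i. Y i \<omega>) {..<Suc j}))
      path_space ((\<lambda>y _. y (Suc j)) \<circ> (\<lambda>\<omega>. restrict (\<lambda>i. Y i \<omega>) {Suc j}))"
    by (rule indep_var_compose[OF _ mh]) (rule measurable_into_path, rule measurable_component_singleton, simp)
  moreover have "h \<circ> (\<lambda>\<omega>. restrict (\<lambda>i. Y i \<omega>) {..<Suc j}) = past (Suc j)"
  proof (intro ext)
    fix \<omega> i
    have "i < Suc j \<Longrightarrow> path_of_noise t (restrict (\<lambda>i. Y i \<omega>) {..<Suc j}) i = \<omega> i"
      by (induction i) (auto simp: Y_def)
    then show "(h \<circ> (\<lambda>\<omega>. restrict (\<lambda>i. Y i \<omega>) {..<Suc j})) \<omega> i = past (Suc j) \<omega> i"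
      by (simp add: h_def past_def)
  qed
  moreover have "(\<lambda>y (_ :: nat). y (Suc j)) \<circ> (\<lambda>\<omega>. restrict (\<lambda>i. Y i \<omega>) {Suc j}) = (\<lambda>\<omega> _. eps t (Suc j) \<omega>)"
    by (auto simp: Y_def)
  ultimately have "indep_var path_space (past (Suc j)) path_space (\<lambda>\<omega> _. eps t (Suc j) \<omega>)"
    by (simp only:)
  then have eq: "distr (P t) path_space (past (Suc j)) \<Otimes>\<^sub>M distr (P t) path_space (\<lambda>\<omega> _. eps t (Suc j) \<omega>)
      = distr (P t) (path_space \<Otimes>\<^sub>M path_space) (\<lambda>\<omega>. (past (Suc j) \<omega>, \<lambda>_. eps t (Suc j) \<omega>))"
    unfolding indep_var_distribution_eq by blast
  have [measurable]: "eps t (Suc j) \<in> borel_measurable (P t)" "past (Suc j) \<in> measurable (P t) path_space"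
    using measurable_eps[OF t] by (simp_all add: measurable_P[OF t])
  have mE: "(\<lambda>\<omega> _. eps t (Suc j) \<omega>) \<in> measurable (P t) path_space"
    by (rule measurable_into_path) fact
  have n: "distr (distr (P t) path_space (\<lambda>\<omega> _. eps t (Suc j) \<omega>)) borel (\<lambda>y. y 0) = noise g"
    unfolding noise_distr[OF t, of j, symmetric] by (subst distr_distr[OF _ mE]) (simp_all add: o_def)
  have "distr (P t) path_space (past (Suc j)) \<Otimes>\<^sub>M noise g
     = distr (distr (P t) path_space (past (Suc j))) path_space (\<lambda>x. x) \<Otimes>\<^sub>M
       distr (distr (P t) path_space (\<lambda>\<omega> _. eps t (Suc j) \<omega>)) borel (\<lambda>y. y 0)"
    unfolding n by (simp add: distr_id2)
  also have "\<dots> = distr (distr (P t) path_space (past (Suc j)) \<Otimes>\<^sub>M distr (P t) path_space (\<lambda>\<omega> _. eps t (Suc j) \<omega>))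
       (path_space \<Otimes>\<^sub>M borel) (\<lambda>(x, y). (x, y 0))"
  proof (rule pair_measure_distr)
    show "sigma_finite_measure (distr (distr (P t) path_space (\<lambda>\<omega> _. eps t (Suc j) \<omega>)) borel (\<lambda>y. y 0))"
      unfolding n by (intro prob_space_imp_sigma_finite prob_noise)
  qed simp_all
  also have "\<dots> = distr (P t) (path_space \<Otimes>\<^sub>M borel) (\<lambda>\<omega>. (past (Suc j) \<omega>, eps t (Suc j) \<omega>))"
    unfolding eq
    by (subst distr_distr[OF _ measurable_Pair[OF \<open>past (Suc j) \<in> measurable (P t) path_space\<close> mE]])
       (simp_all add: o_def)
  finally show ?thesis by simp
qed

lemma measurable_past_eps:
  "t \<in> \<Theta> \<Longrightarrow> (\<lambda>\<omega>. (past (Suc j) \<omega>, eps t (Suc j) \<omega>)) \<in> measurable (P t) (path_space \<Otimes>\<^sub>M borel)"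
  using measurable_eps[of t j] unfolding measurable_P by measurable

lemma prob_past: "t \<in> \<Theta> \<Longrightarrow> prob_space (distr (P t) path_space (past j))"
  by (rule prob_space.prob_space_distr[OF P_prob]) (simp_all add: measurable_P)

lemma nn_integral_step:
  assumes t: "t \<in> \<Theta>" and F[measurable]: "F \<in> borel_measurable (path_space \<Otimes>\<^sub>M borel)"
  shows "(\<integral>\<^sup>+\<omega>. F (past (Suc j) \<omega>, eps t (Suc j) \<omega>) \<partial>P t) = (\<integral>\<^sup>+\<omega>. \<integral>\<^sup>+e. F (past (Suc j) \<omega>, e) \<partial>noise g \<partial>P t)"
proof -
  interpret prob_space "noise g" by (rule prob_noise)
  let ?C = "distr (P t) path_space (past (Suc j))"
  have "(\<integral>\<^sup>+\<omega>. F (past (Suc j) \<omega>, eps t (Suc j) \<omega>) \<partial>P t) = (\<integral>\<^sup>+z. F z \<partial>(?C \<Otimes>\<^sub>M noise g))"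
    unfolding joint_law[OF t, symmetric] using measurable_past_eps[OF t] by (subst nn_integral_distr) simp_all
  also have "\<dots> = (\<integral>\<^sup>+\<omega>. \<integral>\<^sup>+e. F (\<omega>, e) \<partial>noise g \<partial>?C)"
    by (rule nn_integral_fst[symmetric]) simp
  also have "\<dots> = (\<integral>\<^sup>+\<omega>. \<integral>\<^sup>+e. F (past (Suc j) \<omega>, e) \<partial>noise g \<partial>P t)"
    by (subst nn_integral_distr) (simp_all add: measurable_P[OF t])
  finally show ?thesis .
qed

lemma integral_step:
  fixes F :: "(nat \<Rightarrow> real) \<times> real \<Rightarrow> 'b::{banach, second_countable_topology}"
  assumes t: "t \<in> \<Theta>" and F[measurable]: "F \<in> borel_measurable (path_space \<Otimes>\<^sub>M borel)"
    and i: "integrable (P t) (\<lambda>\<omega>. F (past (Suc j) \<omega>, eps t (Suc j) \<omega>))"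
  shows "(\<integral>\<omega>. F (past (Suc j) \<omega>, eps t (Suc j) \<omega>) \<partial>P t) = (\<integral>\<omega>. \<integral>e. F (past (Suc j) \<omega>, e) \<partial>noise g \<partial>P t)"
proof -
  let ?C = "distr (P t) path_space (past (Suc j))"
  interpret N: prob_space "noise g" by (rule prob_noise)
  interpret C: prob_space ?C by (rule prob_past[OF t])
  interpret pair_sigma_finite ?C "noise g" ..
  have "integrable (distr (P t) (path_space \<Otimes>\<^sub>M borel) (\<lambda>\<omega>. (past (Suc j) \<omega>, eps t (Suc j) \<omega>))) F"
    using i measurable_past_eps[OF t] by (subst integrable_distr_eq) simp_all
  then have iF: "integrable (?C \<Otimes>\<^sub>M noise g) F" unfolding joint_law[OF t] .
  have "(\<integral>\<omega>. F (past (Suc j) \<omega>, eps t (Suc j) \<omega>) \<partial>P t) = (\<integral>z. F z \<partial>(?C \<Otimes>\<^sub>M noise g))"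
    unfolding joint_law[OF t, symmetric] using measurable_past_eps[OF t] by (subst integral_distr) simp_all
  also have "\<dots> = (\<integral>\<omega>. \<integral>e. F (\<omega>, e) \<partial>noise g \<partial>?C)"
    by (rule integral_fst'[symmetric]) fact
  also have "\<dots> = (\<integral>\<omega>. \<integral>e. F (past (Suc j) \<omega>, e) \<partial>noise g \<partial>P t)"
    by (subst integral_distr) (simp_all add: measurable_P[OF t])
  finally show ?thesis .
qed


lemma measurable_lg [measurable]: "lg1 g \<in> borel_measurable borel" "lg2 g \<in> borel_measurable borel"
  using lg_measurable[OF g_pos g_C3] by auto

lemma ldot_residual:
  assumes "t \<in> \<Theta>"
  shows "ldot S g t x (S t x + e) = - lg1 g e *\<^sub>R Sd t x"
  using ldot_eq(1)[where S = S, OF open_Theta S_C3 g_pos g_C3 assms, of x "S t x + e"] by simp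

definition Sdd :: "real^'d \<Rightarrow> real \<Rightarrow> real^'d^'d" where
  "Sdd t x = jacobian (grad (\<lambda>u. S u x)) (at t)"

lemma lddot_residual:
  assumes "t \<in> \<Theta>"
  shows "w \<bullet> (lddot S g t x (S t x + e) *v w) = lg2 g e * (w \<bullet> Sd t x)\<^sup>2 - lg1 g e * (w \<bullet> (Sdd t x *v w))"
proof -
  have sq: "(w \<bullet> Sd t x)\<^sup>2 = (\<Sum>i\<in>UNIV. \<Sum>j\<in>UNIV. (w $ i * Sd t x $ i) * (w $ j * Sd t x $ j))"
    by (simp add: inner_vec_def power2_eq_square sum_product)
  show ?thesis
    unfolding lddot_eq(1)[where S = S, OF open_Theta S_C3 g_pos g_C3 assms] sq
    by (simp add: inner_vec_def matrix_vector_mult_def Sdd_def sum_distrib_left sum_subtractf[symmetric] algebra_simps)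
qed

lemma moment_bounds:
  "\<exists>C>0. \<forall>t\<in>\<Theta>. \<forall>j. (\<integral>\<^sup>+\<omega>. ennreal ((norm (score t (Suc j) \<omega>))\<^sup>2) \<partial>P t) \<le> ennreal C
       \<and> (\<integral>\<^sup>+\<omega>. ennreal ((norm (hess t (Suc j) \<omega>))\<^sup>2) \<partial>P t) \<le> ennreal C"
proof -
  obtain R1 R2 R3 C where R: "\<And>t x x'. t \<in> \<Theta> \<Longrightarrow> norm (ldot S g t x x') \<le> R1 x x'"
      "\<And>t x x'. t \<in> \<Theta> \<Longrightarrow> norm (lddot S g t x x') \<le> R2 x x'"
    and C: "\<And>t j. t \<in> \<Theta> \<Longrightarrow> 1 \<le> j \<Longrightarrow> (\<integral>\<^sup>+\<omega>. ennreal (\<bar>R1 (\<omega> (j - 1)) (\<omega> j)\<bar>\<^sup>2) \<partial>P t) < ennreal C"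
      "\<And>t j. t \<in> \<Theta> \<Longrightarrow> 1 \<le> j \<Longrightarrow> (\<integral>\<^sup>+\<omega>. ennreal (\<bar>R2 (\<omega> (j - 1)) (\<omega> j)\<bar>\<^sup>2) \<partial>P t) < ennreal C"
    using R3_bounds by blast
  have "(\<integral>\<^sup>+\<omega>. ennreal ((norm (score t (Suc j) \<omega>))\<^sup>2) \<partial>P t) \<le> ennreal (max C 1)
       \<and> (\<integral>\<^sup>+\<omega>. ennreal ((norm (hess t (Suc j) \<omega>))\<^sup>2) \<partial>P t) \<le> ennreal (max C 1)" if t: "t \<in> \<Theta>" for t j
  proof
    have le: "ennreal ((norm v)\<^sup>2) \<le> ennreal (\<bar>r\<bar>\<^sup>2)" if "norm v \<le> r" for r and v :: "'z::real_normed_vector"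
      using that by (intro ennreal_leI power_mono) auto
    have "(\<integral>\<^sup>+\<omega>. ennreal ((norm (score t (Suc j) \<omega>))\<^sup>2) \<partial>P t) \<le> (\<integral>\<^sup>+\<omega>. ennreal (\<bar>R1 (\<omega> (Suc j - 1)) (\<omega> (Suc j))\<bar>\<^sup>2) \<partial>P t)"
      by (intro nn_integral_mono le R(1) t)
    also have "\<dots> \<le> ennreal (max C 1)"
      using C(1)[OF t, of "Suc j"] by (intro order_trans[OF less_imp_le ennreal_leI]) auto
    finally show "(\<integral>\<^sup>+\<omega>. ennreal ((norm (score t (Suc j) \<omega>))\<^sup>2) \<partial>P t) \<le> ennreal (max C 1)" .
    have "(\<integral>\<^sup>+\<omega>. ennreal ((norm (hess t (Suc j) \<omega>))\<^sup>2) \<partial>P t) \<le> (\<integral>\<^sup>+\<omega>. ennreal (\<bar>R2 (\<omega> (Suc j - 1)) (\<omega> (Suc j))\<bar>\<^sup>2) \<partial>P t)"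
      by (intro nn_integral_mono le R(2) t)
    also have "\<dots> \<le> ennreal (max C 1)"
      using C(2)[OF t, of "Suc j"] by (intro order_trans[OF less_imp_le ennreal_leI]) auto
    finally show "(\<integral>\<^sup>+\<omega>. ennreal ((norm (hess t (Suc j) \<omega>))\<^sup>2) \<partial>P t) \<le> ennreal (max C 1)" .
  qed
  then show ?thesis by (intro exI[of _ "max C 1"]) auto
qed

lemma nn_integral_transition:
  assumes t: "t \<in> \<Theta>" and f: "(\<lambda>(x, x'). f x x') \<in> borel_measurable (borel \<Otimes>\<^sub>M borel)"
  shows "(\<integral>\<^sup>+\<omega>. f (\<omega> j) (\<omega> (Suc j)) \<partial>P t) = (\<integral>\<^sup>+\<omega>. \<integral>\<^sup>+e. f (\<omega> j) (S t (\<omega> j) + e) \<partial>noise g \<partial>P t)"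
proof -
  have [measurable]: "S t \<in> borel_measurable borel" by (rule measurable_S[OF t])
  let ?F = "\<lambda>(\<eta> :: nat \<Rightarrow> real, e). f (\<eta> j) (S t (\<eta> j) + e)"
  have "(\<lambda>z. (fst z j, S t (fst z j) + snd z)) \<in> measurable (path_space \<Otimes>\<^sub>M borel) (borel \<Otimes>\<^sub>M borel)"
    by measurable
  from measurable_compose[OF this f]
  have "?F \<in> borel_measurable (path_space \<Otimes>\<^sub>M borel)" by (simp add: case_prod_beta')
  from nn_integral_step[OF t this, of j] show ?thesis by (simp add: past_apply)
qed

lemma measurable_transition:
  assumes t: "t \<in> \<Theta>" and f: "(\<lambda>(x, x'). f x x') \<in> borel_measurable (borel \<Otimes>\<^sub>M borel)"
  shows "(\<lambda>\<omega>. f (\<omega> j) (\<omega> (Suc j))) \<in> borel_measurable path_space"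
    and "(\<lambda>e. f x (S t x + e)) \<in> borel_measurable borel"
    and "(\<lambda>(x, e). f x (S t x + e)) \<in> borel_measurable (borel \<Otimes>\<^sub>M borel)"
proof -
  have [measurable]: "S t \<in> borel_measurable borel" by (rule measurable_S[OF t])
  have "(\<lambda>\<omega>. (\<omega> j, \<omega> (Suc j))) \<in> measurable path_space (borel \<Otimes>\<^sub>M borel)" by measurable
  from measurable_compose[OF this f] show "(\<lambda>\<omega>. f (\<omega> j) (\<omega> (Suc j))) \<in> borel_measurable path_space" by simp
  have "(\<lambda>e. (x, S t x + e)) \<in> measurable borel (borel \<Otimes>\<^sub>M borel)" by measurable
  from measurable_compose[OF this f] show "(\<lambda>e. f x (S t x + e)) \<in> borel_measurable borel" by simp
  have "(\<lambda>z. (fst z, S t (fst z) + snd z)) \<in> measurable (borel \<Otimes>\<^sub>M borel) (borel \<Otimes>\<^sub>M borel)" by measurable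
  from measurable_compose[OF this f] show "(\<lambda>(x, e). f x (S t x + e)) \<in> borel_measurable (borel \<Otimes>\<^sub>M borel)"
    by (simp add: case_prod_beta')
qed

lemma measurable_inner_transition:
  assumes t: "t \<in> \<Theta>" and f: "(\<lambda>(x, x'). f x x') \<in> borel_measurable (borel \<Otimes>\<^sub>M borel)"
  shows "(\<lambda>\<omega>. \<integral>\<^sup>+e. f (\<omega> j) (S t (\<omega> j) + e) \<partial>noise g) \<in> borel_measurable path_space"
proof -
  interpret prob_space "noise g" by (rule prob_noise)
  have "(\<lambda>(x, e). f x (S t x + e)) \<in> borel_measurable (borel \<Otimes>\<^sub>M noise g)"
    unfolding measurable_cong_sets[OF sets_pair_measure_cong[OF refl sets_noise] refl]
    by (rule measurable_transition(3)[OF t f])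
  from borel_measurable_nn_integral[OF this]
  have "(\<lambda>x. \<integral>\<^sup>+e. f x (S t x + e) \<partial>noise g) \<in> borel_measurable borel" .
  from measurable_compose[OF measurable_coordinate this] show ?thesis .
qed

lemma measurable_ldot_pair: "(\<lambda>(x, x'). ldot S g t x x') \<in> borel_measurable (borel \<Otimes>\<^sub>M borel)"
  unfolding case_prod_beta' by (rule measurable_ldot) simp_all

lemma measurable_lddot_pair: "t \<in> \<Theta> \<Longrightarrow> (\<lambda>(x, x'). lddot S g t x x') \<in> borel_measurable (borel \<Otimes>\<^sub>M borel)"
  unfolding case_prod_beta' by (rule measurable_lddot) simp_all

lemma fisher_nonzero:
  assumes "t \<in> \<Theta>" shows "\<not> (AE \<omega> in P t. ldot S g t (\<omega> 0) (\<omega> 1) = 0)"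
proof
  assume AE: "AE \<omega> in P t. ldot S g t (\<omega> 0) (\<omega> 1) = 0"
  have "(\<integral>\<omega>. ldot S g t (\<omega> 0) (\<omega> 1) $ i * ldot S g t (\<omega> 0) (\<omega> 1) $ j \<partial>P t) = 0" for i j
    by (rule integral_eq_zero_AE) (use AE in eventually_elim, simp)
  then have "I t = 0" by (simp add: fisher_def vec_eq_iff)
  moreover obtain c where "c > 0" "\<And>v::real^'d. norm v = 1 \<Longrightarrow> c \<le> v \<bullet> (I t *v v)"
    using R5_nondeg assms by blast
  from this(1) this(2)[of "axis undefined 1"] have "0 < axis undefined 1 \<bullet> (I t *v axis undefined 1)" by simp
  ultimately show False by simp
qed

text \<open>One such $x$ suffices: there the bounds on $\dot\ell$ and $\ddot\ell$ turn into square
  integrability of $(\ln g)'$ and $(\ln g)''$ under the noise density.\<close>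
lemma exists_regular_point:
  "\<exists>t\<in>\<Theta>. \<exists>x. Sd t x \<noteq> 0 \<and> (\<integral>\<^sup>+e. ennreal ((norm (ldot S g t x (S t x + e)))\<^sup>2) \<partial>noise g) \<noteq> \<infinity>
     \<and> (\<integral>\<^sup>+e. ennreal ((norm (lddot S g t x (S t x + e)))\<^sup>2) \<partial>noise g) \<noteq> \<infinity>"
proof -
  obtain t where t: "t \<in> \<Theta>" using Theta_ne by auto
  interpret prob_space "P t" by (rule P_prob[OF t])
  obtain C where C: "(\<integral>\<^sup>+\<omega>. ennreal ((norm (score t (Suc 0) \<omega>))\<^sup>2) \<partial>P t) \<le> ennreal C"
     "(\<integral>\<^sup>+\<omega>. ennreal ((norm (hess t (Suc 0) \<omega>))\<^sup>2) \<partial>P t) \<le> ennreal C"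
    using moment_bounds t by blast
  have m1: "(\<lambda>(x, x'). ennreal ((norm (ldot S g t x x'))\<^sup>2)) \<in> borel_measurable (borel \<Otimes>\<^sub>M borel)"
    using measurable_ldot_pair[of t] by (simp add: case_prod_beta')
  have m2: "(\<lambda>(x, x'). ennreal ((norm (lddot S g t x x'))\<^sup>2)) \<in> borel_measurable (borel \<Otimes>\<^sub>M borel)"
    using measurable_lddot_pair[OF t] by (simp add: case_prod_beta')
  have "AE \<omega> in P t. (\<integral>\<^sup>+e. ennreal ((norm (ldot S g t (\<omega> 0) (S t (\<omega> 0) + e)))\<^sup>2) \<partial>noise g) \<noteq> \<infinity>"
    using measurable_inner_transition[OF t m1, of 0] nn_integral_transition[OF t m1, of 0] C(1)
    by (intro nn_integral_noteq_infinite) (auto simp: measurable_P[OF t] top_unique)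
  moreover have "AE \<omega> in P t. (\<integral>\<^sup>+e. ennreal ((norm (lddot S g t (\<omega> 0) (S t (\<omega> 0) + e)))\<^sup>2) \<partial>noise g) \<noteq> \<infinity>"
    using measurable_inner_transition[OF t m2, of 0] nn_integral_transition[OF t m2, of 0] C(2)
    by (intro nn_integral_noteq_infinite) (auto simp: measurable_P[OF t] top_unique)
  ultimately have AE: "AE \<omega> in P t. (\<integral>\<^sup>+e. ennreal ((norm (ldot S g t (\<omega> 0) (S t (\<omega> 0) + e)))\<^sup>2) \<partial>noise g) \<noteq> \<infinity>
     \<and> (\<integral>\<^sup>+e. ennreal ((norm (lddot S g t (\<omega> 0) (S t (\<omega> 0) + e)))\<^sup>2) \<partial>noise g) \<noteq> \<infinity>" by eventually_elim simp
  have sc: "ldot S g t (\<omega> 0) (\<omega> 1) = - lg1 g (eps t 1 \<omega>) *\<^sub>R Sd t (\<omega> 0)" for \<omega> :: "nat \<Rightarrow> real"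
    using ldot_residual[OF t, of "\<omega> 0" "eps t 1 \<omega>"] by simp
  show ?thesis
  proof (rule ccontr)
    assume no: "\<not> ?thesis"
    have "AE \<omega> in P t. ldot S g t (\<omega> 0) (\<omega> 1) = 0"
      using AE
    proof eventually_elim
      case (elim \<omega>)
      then have "Sd t (\<omega> 0) = 0" using no t by blast
      then show ?case by (simp only: sc scaleR_zero_right)
    qed
    then show False using fisher_nonzero[OF t] by blast
  qed
qed

lemma measurable_noise: "measurable (noise g) N = measurable borel N"
  by (rule measurable_cong_sets) simp_all

lemma square_integrable_iff:
  fixes f :: "real \<Rightarrow> real"
  assumes "f \<in> borel_measurable borel"
  shows "integrable (noise g) (\<lambda>e. (f e)\<^sup>2) \<longleftrightarrow> (\<integral>\<^sup>+e. ennreal ((f e)\<^sup>2) \<partial>noise g) \<noteq> \<infinity>"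
  using assms by (subst integrable_iff_bounded) (auto simp: top.not_eq_extremum measurable_noise)

lemma lg_square_integrable:
  "integrable (noise g) (\<lambda>e. (lg1 g e)\<^sup>2)" "integrable (noise g) (\<lambda>e. (lg2 g e)\<^sup>2)"
proof -
  obtain t x where t: "t \<in> \<Theta>" and w0: "Sd t x \<noteq> 0"
     and f1: "(\<integral>\<^sup>+e. ennreal ((norm (ldot S g t x (S t x + e)))\<^sup>2) \<partial>noise g) \<noteq> \<infinity>"
     and f2: "(\<integral>\<^sup>+e. ennreal ((norm (lddot S g t x (S t x + e)))\<^sup>2) \<partial>noise g) \<noteq> \<infinity>"
    using exists_regular_point by blast
  define w where "w = Sd t x"
  have w: "norm w > 0" "w \<bullet> w > 0" using w0 by (auto simp: w_def)
  define h where "h e = norm (lddot S g t x (S t x + e))" for e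
  have [measurable]: "h \<in> borel_measurable borel"
    unfolding h_def using measurable_lddot[OF t, of "\<lambda>_. x" borel "\<lambda>e. S t x + e"] by simp
  have mn: "(\<lambda>e. norm (ldot S g t x (S t x + e))) \<in> borel_measurable borel"
    using measurable_ldot[of "\<lambda>_. t" borel "\<lambda>_. x" "\<lambda>e. S t x + e"] by simp
  have ih: "integrable (noise g) (\<lambda>e. (h e)\<^sup>2)"
    using f2 by (subst square_integrable_iff) (auto simp: h_def)
  have "integrable (noise g) (\<lambda>e. (norm (ldot S g t x (S t x + e)))\<^sup>2)"
    using f1 mn by (subst square_integrable_iff) auto
  then have "integrable (noise g) (\<lambda>e. (lg1 g e)\<^sup>2 * (norm w)\<^sup>2)"
    by (simp add: ldot_residual[OF t] w_def power_mult_distrib)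
  then have "integrable (noise g) (\<lambda>e. ((lg1 g e)\<^sup>2 * (norm w)\<^sup>2) / (norm w)\<^sup>2)" by (rule integrable_divide_zero)
  then show i1: "integrable (noise g) (\<lambda>e. (lg1 g e)\<^sup>2)" using w by simp
  define q where "q = w \<bullet> (Sdd t x *v w)"
  define B where "B e = 2 * ((norm w)\<^sup>2 * h e)\<^sup>2 + 2 * (lg1 g e * q)\<^sup>2" for e
  have iB: "integrable (noise g) (\<lambda>e. B e / (w \<bullet> w)^4)"
    unfolding B_def power_mult_distrib using ih i1 by simp
  have bd: "(lg2 g e)\<^sup>2 \<le> B e / (w \<bullet> w)^4" for e
  proof -
    define a where "a = w \<bullet> (lddot S g t x (S t x + e) *v w)"
    have "\<bar>a\<bar> \<le> norm w * norm (lddot S g t x (S t x + e) *v w)"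
      unfolding a_def by (rule Cauchy_Schwarz_ineq2)
    also have "\<dots> \<le> norm w * (h e * norm w)"
      unfolding h_def by (intro mult_left_mono norm_matrix_vector_mult_le) simp
    finally have a: "\<bar>a\<bar> \<le> (norm w)\<^sup>2 * h e" by (simp add: power2_eq_square mult_ac)
    then have a2: "a\<^sup>2 \<le> ((norm w)\<^sup>2 * h e)\<^sup>2" by (metis abs_ge_zero power2_abs power_mono)
    have "lg2 g e * (w \<bullet> w)\<^sup>2 = a + lg1 g e * q"
      unfolding a_def lddot_residual[OF t] q_def w_def[symmetric] by simp
    then have "(lg2 g e)\<^sup>2 * (w \<bullet> w)^4 = (a + lg1 g e * q)\<^sup>2"
      by (metis (no_types, lifting) power_mult_distrib power2_eq_square power4_eq_xxxx mult.assoc)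
    also have "\<dots> \<le> 2 * a\<^sup>2 + 2 * (lg1 g e * q)\<^sup>2"
      using zero_le_power2[of "a - lg1 g e * q"] by (simp add: power2_diff power2_sum)
    also have "\<dots> \<le> B e" using a2 by (simp add: B_def)
    finally show ?thesis using w by (simp add: field_simps)
  qed
  show "integrable (noise g) (\<lambda>e. (lg2 g e)\<^sup>2)"
    by (rule Bochner_Integration.integrable_bound[OF iB])
       (unfold measurable_noise, use order_trans[OF bd abs_ge_self] in \<open>simp_all add: AE_I2\<close>)
qed

definition J :: real where "J = (\<integral>e. (lg1 g e)\<^sup>2 \<partial>noise g)"

lemma lg_identities:
  "integrable (noise g) (lg1 g)" "integrable (noise g) (lg2 g)"
  "(\<integral>e. lg1 g e \<partial>noise g) = 0" "(\<integral>e. lg2 g e \<partial>noise g) = - J"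
  using score_identities[OF g_pos g_C3 prob_noise lg_square_integrable] by (auto simp: J_def)

lemma J_pos: "J > 0"
proof -
  have "J \<noteq> 0"
  proof
    assume "J = 0"
    then have AE: "AE e in noise g. (lg1 g e)\<^sup>2 = 0"
      unfolding J_def using lg_square_integrable(1) by (subst (asm) integral_nonneg_eq_0_iff_AE) auto
    obtain t where t: "t \<in> \<Theta>" using Theta_ne by auto
    have "AE \<omega> in P t. (lg1 g (eps t (Suc 0) \<omega>))\<^sup>2 = 0"
      using AE unfolding noise_distr[OF t, of 0, symmetric]
      by (subst (asm) AE_distr_iff) (use measurable_eps[OF t, of 0] in \<open>auto simp: measurable_P[OF t]\<close>)
    then have "AE \<omega> in P t. ldot S g t (\<omega> 0) (\<omega> 1) = 0"
    proof eventually_elim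
      case (elim \<omega>)
      then show ?case using ldot_residual[OF t, of "\<omega> 0" "eps t 1 \<omega>"] by simp
    qed
    then show False using fisher_nonzero[OF t] by blast
  qed
  moreover have "J \<ge> 0" unfolding J_def by simp
  ultimately show ?thesis by simp
qed

lemma hess_form_moments:
  assumes t: "t \<in> \<Theta>"
  shows "integrable (noise g) (\<lambda>e. w \<bullet> (lddot S g t x (S t x + e) *v w))" (is ?A)
    and "(\<integral>e. w \<bullet> (lddot S g t x (S t x + e) *v w) \<partial>noise g) = - (J * (w \<bullet> Sd t x)\<^sup>2)" (is ?B)
    and "ennreal ((J * (w \<bullet> Sd t x)\<^sup>2)\<^sup>2) \<le> (\<integral>\<^sup>+e. ennreal ((w \<bullet> (lddot S g t x (S t x + e) *v w))\<^sup>2) \<partial>noise g)" (is ?C)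
proof -
  interpret prob_space "noise g" by (rule prob_noise)
  define a b where "a = (w \<bullet> Sd t x)\<^sup>2" and "b = w \<bullet> (Sdd t x *v w)"
  let ?q = "\<lambda>e. lg2 g e * a - lg1 g e * b"
  have eq: "w \<bullet> (lddot S g t x (S t x + e) *v w) = ?q e" for e
    unfolding lddot_residual[OF t] a_def b_def ..
  show ?A unfolding eq using lg_identities by simp
  show B: ?B unfolding eq using lg_identities by (simp add: a_def)
  have i2: "integrable (noise g) (\<lambda>e. (?q e)\<^sup>2)"
  proof (rule Bochner_Integration.integrable_bound)
    show "integrable (noise g) (\<lambda>e. 2 * ((lg2 g e)\<^sup>2 * a\<^sup>2) + 2 * ((lg1 g e)\<^sup>2 * b\<^sup>2))"
      using lg_square_integrable by simp
    have "(u - v)\<^sup>2 \<le> 2 * u\<^sup>2 + 2 * v\<^sup>2" for u v :: real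
      using zero_le_power2[of "u + v"] by (simp add: power2_diff power2_sum)
    from this[of "lg2 g e * a" "lg1 g e * b" for e]
    show "AE e in noise g. norm ((?q e)\<^sup>2) \<le> norm (2 * ((lg2 g e)\<^sup>2 * a\<^sup>2) + 2 * ((lg1 g e)\<^sup>2 * b\<^sup>2))"
      by (intro AE_I2) (simp add: power_mult_distrib)
  qed (unfold measurable_noise, simp)
  have "0 \<le> variance ?q" by simp
  also have "\<dots> = expectation (\<lambda>e. (?q e)\<^sup>2) - (expectation ?q)\<^sup>2"
    using lg_identities i2 by (intro variance_eq) auto
  finally have "(J * a)\<^sup>2 \<le> expectation (\<lambda>e. (?q e)\<^sup>2)"
    using B unfolding eq by (simp add: a_def)
  then show ?C unfolding eq a_def[symmetric] by (subst nn_integral_eq_integral[OF i2]) auto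
qed

lemma fourth_moment:
  "\<exists>A>0. \<forall>t\<in>\<Theta>. \<forall>j w. integrable (P t) (\<lambda>\<omega>. (w \<bullet> Sd t (\<omega> j))^4) \<and> (\<integral>\<omega>. (w \<bullet> Sd t (\<omega> j))^4 \<partial>P t) \<le> A * (norm w)^4"
proof -
  obtain C where C: "C > 0" "\<And>t j. t \<in> \<Theta> \<Longrightarrow> (\<integral>\<^sup>+\<omega>. ennreal ((norm (hess t (Suc j) \<omega>))\<^sup>2) \<partial>P t) \<le> ennreal C"
    using moment_bounds by blast
  show ?thesis
  proof (intro exI[of _ "C / J\<^sup>2"] conjI ballI allI)
    show "C / J\<^sup>2 > 0" using C J_pos by simp
    fix t j and w :: "real^'d" assume t: "t \<in> \<Theta>"
    have [measurable]: "Sd t \<in> borel_measurable borel" by (rule measurable_Sd[OF t])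
    let ?f = "\<lambda>\<omega> :: nat \<Rightarrow> real. (w \<bullet> Sd t (\<omega> j))^4"
    have m: "(\<lambda>(x, x'). ennreal ((w \<bullet> (lddot S g t x x' *v w))\<^sup>2)) \<in> borel_measurable (borel \<Otimes>\<^sub>M borel)"
      using measurable_lddot_pair[OF t] by (simp add: case_prod_beta')
    have "(\<integral>\<^sup>+\<omega>. ennreal (J\<^sup>2 * ?f \<omega>) \<partial>P t) = (\<integral>\<^sup>+\<omega>. ennreal ((J * (w \<bullet> Sd t (\<omega> j))\<^sup>2)\<^sup>2) \<partial>P t)"
      by (simp add: power_mult_distrib power_mult[symmetric])
    also have "\<dots> \<le> (\<integral>\<^sup>+\<omega>. \<integral>\<^sup>+e. ennreal ((w \<bullet> (lddot S g t (\<omega> j) (S t (\<omega> j) + e) *v w))\<^sup>2) \<partial>noise g \<partial>P t)"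
      by (intro nn_integral_mono hess_form_moments[OF t])
    also have "\<dots> = (\<integral>\<^sup>+\<omega>. ennreal ((w \<bullet> (lddot S g t (\<omega> j) (\<omega> (Suc j)) *v w))\<^sup>2) \<partial>P t)"
      by (rule nn_integral_transition[OF t m, symmetric])
    also have "\<dots> \<le> (\<integral>\<^sup>+\<omega>. ennreal ((norm w)^4) * ennreal ((norm (hess t (Suc j) \<omega>))\<^sup>2) \<partial>P t)"
    proof (rule nn_integral_mono)
      fix \<omega> :: "nat \<Rightarrow> real"
      have "(w \<bullet> (hess t (Suc j) \<omega> *v w))\<^sup>2 \<le> ((norm w)\<^sup>2 * norm (hess t (Suc j) \<omega>))\<^sup>2"
        using norm_quadratic_form_le[of w "hess t (Suc j) \<omega>"] by (metis abs_ge_zero power2_abs power_mono)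
      then show "ennreal ((w \<bullet> (lddot S g t (\<omega> j) (\<omega> (Suc j)) *v w))\<^sup>2) \<le> ennreal ((norm w)^4) * ennreal ((norm (hess t (Suc j) \<omega>))\<^sup>2)"
        by (subst ennreal_mult[symmetric]) (auto simp: power_mult_distrib power_mult[symmetric] intro!: ennreal_leI)
    qed
    also have "\<dots> = ennreal ((norm w)^4) * (\<integral>\<^sup>+\<omega>. ennreal ((norm (hess t (Suc j) \<omega>))\<^sup>2) \<partial>P t)"
      by (rule nn_integral_cmult) (use measurable_hess[OF t, of "Suc j"] in \<open>simp add: measurable_P[OF t]\<close>)
    also have "\<dots> \<le> ennreal ((norm w)^4) * ennreal C" by (intro mult_left_mono C t) simp
    also have "\<dots> = ennreal ((norm w)^4 * C)" using C by (simp add: ennreal_mult)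
    finally have bd: "(\<integral>\<^sup>+\<omega>. ennreal (J\<^sup>2 * ?f \<omega>) \<partial>P t) \<le> ennreal ((norm w)^4 * C)" .
    have mf: "(\<lambda>\<omega>. J\<^sup>2 * ?f \<omega>) \<in> borel_measurable (P t)" unfolding measurable_P[OF t] by measurable
    have i: "integrable (P t) (\<lambda>\<omega>. J\<^sup>2 * ?f \<omega>)"
      using mf bd by (intro integrableI_bounded) (auto simp: abs_mult power_even_abs le_less_trans)
    from i have "integrable (P t) (\<lambda>\<omega>. J\<^sup>2 * ?f \<omega> / J\<^sup>2)" by (rule integrable_divide_zero)
    then show i': "integrable (P t) ?f" using J_pos by simp
    have "ennreal (\<integral>\<omega>. J\<^sup>2 * ?f \<omega> \<partial>P t) \<le> ennreal ((norm w)^4 * C)"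
      using bd by (subst (asm) nn_integral_eq_integral[OF i]) auto
    then have "J\<^sup>2 * (\<integral>\<omega>. ?f \<omega> \<partial>P t) \<le> (norm w)^4 * C" using C by (subst (asm) ennreal_le_iff) auto
    then show "(\<integral>\<omega>. ?f \<omega> \<partial>P t) \<le> C / J\<^sup>2 * (norm w)^4" using J_pos by (simp add: field_simps)
  qed
qed

lemma martingale_L2:
  assumes t: "t \<in> \<Theta>" and d: "(\<lambda>(x, x'). d x x') \<in> borel_measurable (borel \<Otimes>\<^sub>M borel)"
    and c: "\<And>x. (\<integral>e. d x (S t x + e) \<partial>noise g) = (0::real)"
    and i: "\<And>j. integrable (P t) (\<lambda>\<omega>. (d (\<omega> j) (\<omega> (Suc j)))\<^sup>2)"
    and C: "\<And>j. (\<integral>\<omega>. (d (\<omega> j) (\<omega> (Suc j)))\<^sup>2 \<partial>P t) \<le> C"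
  shows "integrable (P t) (\<lambda>\<omega>. (\<Sum>j<n. d (\<omega> j) (\<omega> (Suc j)))\<^sup>2) \<and> (\<integral>\<omega>. (\<Sum>j<n. d (\<omega> j) (\<omega> (Suc j)))\<^sup>2 \<partial>P t) \<le> real n * C"
proof (induction n)
  case (Suc n)
  let ?M = "\<lambda>\<omega>. \<Sum>j<n. d (\<omega> j) (\<omega> (Suc j))" and ?D = "\<lambda>\<omega>. d (\<omega> n) (\<omega> (Suc n))"
  have [measurable]: "(\<lambda>\<omega>. d (\<omega> j) (\<omega> (Suc j))) \<in> borel_measurable path_space" for j
    by (rule measurable_transition(1)[OF t d])
  have [measurable]: "S t \<in> borel_measurable borel" by (rule measurable_S[OF t])
  have imd: "integrable (P t) (\<lambda>\<omega>. ?M \<omega> * ?D \<omega>)"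
  proof (rule Bochner_Integration.integrable_bound)
    show "integrable (P t) (\<lambda>\<omega>. (?M \<omega>)\<^sup>2 + (?D \<omega>)\<^sup>2)" using Suc i by simp
    have "\<bar>u * v\<bar> \<le> u\<^sup>2 + v\<^sup>2" for u v :: real
    proof -
      have "2 * (\<bar>u\<bar> * \<bar>v\<bar>) \<le> u\<^sup>2 + v\<^sup>2" using zero_le_power2[of "\<bar>u\<bar> - \<bar>v\<bar>"] by (simp add: power2_diff)
      moreover have "0 \<le> \<bar>u\<bar> * \<bar>v\<bar>" by simp
      ultimately show ?thesis unfolding abs_mult by linarith
    qed
    then show "AE \<omega> in P t. norm (?M \<omega> * ?D \<omega>) \<le> norm ((?M \<omega>)\<^sup>2 + (?D \<omega>)\<^sup>2)"
      by (intro AE_I2) simp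
  qed (simp add: measurable_P[OF t])
  have "(\<integral>\<omega>. ?M \<omega> * ?D \<omega> \<partial>P t) = 0"
  proof -
    let ?F = "\<lambda>(\<eta> :: nat \<Rightarrow> real, e). ?M \<eta> * d (\<eta> n) (S t (\<eta> n) + e)"
    have m1: "(\<lambda>z. d (fst z n) (S t (fst z n) + snd z)) \<in> borel_measurable (path_space \<Otimes>\<^sub>M borel)"
      using measurable_compose[OF _ d, of "\<lambda>z. (fst z n, S t (fst z n) + snd z)" "path_space \<Otimes>\<^sub>M borel"] by simp
    have "(\<lambda>z. ?M (fst z)) \<in> borel_measurable (path_space \<Otimes>\<^sub>M borel)"
      by (rule measurable_compose[OF measurable_fst]) measurable
    with m1 have m: "?F \<in> borel_measurable (path_space \<Otimes>\<^sub>M borel)" by (simp add: case_prod_beta')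
    have Mc: "?M (past (Suc n) \<omega>) = ?M \<omega>" for \<omega> by (intro sum.cong) (auto simp: past_def)
    have "(\<integral>\<omega>. ?F (past (Suc n) \<omega>, eps t (Suc n) \<omega>) \<partial>P t) = (\<integral>\<omega>. \<integral>e. ?F (past (Suc n) \<omega>, e) \<partial>noise g \<partial>P t)"
      by (rule integral_step[OF t m]) (use imd in \<open>simp add: Mc past_apply\<close>)
    then show ?thesis by (simp add: Mc past_apply c)
  qed
  then have "(\<integral>\<omega>. (?M \<omega>)\<^sup>2 + 2 * (?M \<omega> * ?D \<omega>) + (?D \<omega>)\<^sup>2 \<partial>P t) \<le> real n * C + C"
    using Suc i imd C[of n] by simp
  moreover have "integrable (P t) (\<lambda>\<omega>. (?M \<omega>)\<^sup>2 + 2 * (?M \<omega> * ?D \<omega>) + (?D \<omega>)\<^sup>2)"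
    using Suc i imd by simp
  moreover have "(\<Sum>j<Suc n. d (\<omega> j) (\<omega> (Suc j)))\<^sup>2 = (?M \<omega>)\<^sup>2 + 2 * (?M \<omega> * ?D \<omega>) + (?D \<omega>)\<^sup>2" for \<omega>
    by (simp add: power2_sum)
  ultimately show ?case by (simp add: algebra_simps)
qed simp

lemma martingale_tail:
  assumes t: "t \<in> \<Theta>" and d: "(\<lambda>(x, x'). d x x') \<in> borel_measurable (borel \<Otimes>\<^sub>M borel)"
    and c: "\<And>x. (\<integral>e. d x (S t x + e) \<partial>noise g) = (0::real)"
    and C: "\<And>j. (\<integral>\<^sup>+\<omega>. ennreal ((d (\<omega> j) (\<omega> (Suc j)))\<^sup>2) \<partial>P t) \<le> ennreal C" "C \<ge> 0" and K: "K > 0"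
  shows "measure (P t) {\<omega>. \<bar>\<Sum>j<n. d (\<omega> j) (\<omega> (Suc j))\<bar> > K} \<le> real n * C / K\<^sup>2"
proof -
  interpret prob_space "P t" by (rule P_prob[OF t])
  let ?M = "\<lambda>\<omega>. \<Sum>j<n. d (\<omega> j) (\<omega> (Suc j))"
  have md [measurable]: "(\<lambda>\<omega>. d (\<omega> j) (\<omega> (Suc j))) \<in> borel_measurable (P t)" for j
    unfolding measurable_P[OF t] by (rule measurable_transition(1)[OF t d])
  have i: "integrable (P t) (\<lambda>\<omega>. (d (\<omega> j) (\<omega> (Suc j)))\<^sup>2)" for j
    using C(1)[of j] by (intro integrableI_bounded) (auto simp: le_less_trans)
  have "(\<integral>\<omega>. (d (\<omega> j) (\<omega> (Suc j)))\<^sup>2 \<partial>P t) \<le> C" for j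
    using C(1)[of j] C(2) by (subst (asm) nn_integral_eq_integral[OF i]) (auto simp: ennreal_le_iff)
  from martingale_L2[OF t d c i this]
  have M: "integrable (P t) (\<lambda>\<omega>. (?M \<omega>)\<^sup>2)" "(\<integral>\<omega>. (?M \<omega>)\<^sup>2 \<partial>P t) \<le> real n * C" by auto
  have "measure (P t) {\<omega>. \<bar>?M \<omega>\<bar> > K} \<le> measure (P t) {\<omega> \<in> space (P t). (?M \<omega>)\<^sup>2 \<ge> K\<^sup>2}"
  proof (rule finite_measure_mono)
    show "{\<omega>. \<bar>?M \<omega>\<bar> > K} \<subseteq> {\<omega> \<in> space (P t). (?M \<omega>)\<^sup>2 \<ge> K\<^sup>2}"
      using K by (auto simp: space_P[OF t] abs_le_square_iff[symmetric])
  qed measurable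
  also have "\<dots> \<le> (\<integral>\<omega>. (?M \<omega>)\<^sup>2 \<partial>P t) / K\<^sup>2"
    by (rule integral_Markov_inequality_measure[OF M(1), of "{}"]) (use K in auto)
  also have "\<dots> \<le> real n * C / K\<^sup>2" using M(2) by (simp add: divide_right_mono)
  finally show ?thesis .
qed


definition phi :: "real \<Rightarrow> complex" where
  "phi b = (CLINT e|noise g. iexp (b * lg1 g e))"

lemma phi_expansion:
  assumes "\<eta> > 0"
  shows "\<exists>M\<ge>0. \<forall>b. cmod (phi b - of_real (exp (- J * b\<^sup>2 / 2))) \<le> \<eta> * b\<^sup>2 + M * b^4"
proof -
  interpret prob_space "noise g" by (rule prob_noise)
  have m [measurable]: "lg1 g \<in> borel_measurable (noise g)" unfolding measurable_noise by measurable
  define \<psi> where "\<psi> b = expectation (\<lambda>e. min (6 * (lg1 g e)\<^sup>2) (\<bar>b\<bar> * \<bar>lg1 g e\<bar>^3))" for b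
  have ii: "integrable (noise g) (\<lambda>e. 6 * (lg1 g e)\<^sup>2)" using lg_square_integrable by simp
  have imin: "integrable (noise g) (\<lambda>e. min (6 * (lg1 g e)\<^sup>2) (\<bar>b\<bar> * \<bar>lg1 g e\<bar>^3))" for b
    by (rule Bochner_Integration.integrable_bound[OF ii]) auto
  have char: "char (distr (noise g) borel (lg1 g)) b = phi b" for b
    unfolding char_def phi_def by (subst integral_distr) simp_all
  have phi: "cmod (phi b - (1 - b\<^sup>2 * J / 2)) \<le> b\<^sup>2 / 6 * \<psi> b" for b
    unfolding char[symmetric] \<psi>_def
    by (rule char_approx3') (use lg_identities lg_square_integrable in \<open>auto simp: J_def\<close>)
  have \<psi>J: "\<psi> b \<le> 6 * J" for b
  proof -
    have "\<psi> b \<le> expectation (\<lambda>e. 6 * (lg1 g e)\<^sup>2)"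
      unfolding \<psi>_def by (rule integral_mono[OF imin ii]) simp
    then show ?thesis by (simp add: J_def)
  qed
  have "(\<psi> \<longlongrightarrow> 0) (at 0)"
  proof (subst tendsto_at_iff_sequentially, safe)
    fix X :: "nat \<Rightarrow> real" assume X: "X \<longlonglongrightarrow> 0"
    have "(\<lambda>n. expectation (\<lambda>e. min (6 * (lg1 g e)\<^sup>2) (\<bar>X n\<bar> * \<bar>lg1 g e\<bar>^3))) \<longlonglongrightarrow> expectation (\<lambda>e. 0)"
    proof (rule integral_dominated_convergence[OF _ _ ii])
      show "AE e in noise g. (\<lambda>n. min (6 * (lg1 g e)\<^sup>2) (\<bar>X n\<bar> * \<bar>lg1 g e\<bar>^3)) \<longlonglongrightarrow> 0"
      proof (rule AE_I2)
        fix e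
        have "(\<lambda>n. min (6 * (lg1 g e)\<^sup>2) (\<bar>X n\<bar> * \<bar>lg1 g e\<bar>^3)) \<longlonglongrightarrow> min (6 * (lg1 g e)\<^sup>2) (\<bar>0\<bar> * \<bar>lg1 g e\<bar>^3)"
          by (intro tendsto_intros X)
        then show "(\<lambda>n. min (6 * (lg1 g e)\<^sup>2) (\<bar>X n\<bar> * \<bar>lg1 g e\<bar>^3)) \<longlonglongrightarrow> 0" by (simp add: min_absorb2)
      qed
    qed auto
    then show "(\<psi> \<circ> X) \<longlonglongrightarrow> 0" by (simp add: \<psi>_def o_def)
  qed
  then have "\<forall>\<^sub>F b in at 0. \<psi> b < 6 * \<eta>" using assms by (intro order_tendstoD(2)) auto
  then obtain b0 where b0: "b0 > 0" "\<And>b. b \<noteq> 0 \<Longrightarrow> \<bar>b\<bar> < b0 \<Longrightarrow> \<psi> b < 6 * \<eta>"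
    by (auto simp: eventually_at dist_real_def)
  show ?thesis
  proof (intro exI[of _ "J / b0\<^sup>2 + J\<^sup>2 / 8"] conjI allI)
    show "0 \<le> J / b0\<^sup>2 + J\<^sup>2 / 8" using J_pos by simp
    fix b
    have e: "\<bar>exp (- y) - (1 - y)\<bar> \<le> y\<^sup>2 / 2" if "y \<ge> 0" for y :: real
    proof -
      have "exp (- y) * (1 + y + y\<^sup>2 / 2) \<le> exp (- y) * exp y"
        using exp_lower_Taylor_quadratic[OF that] by (intro mult_left_mono) auto
      also have "\<dots> \<le> (1 - y + y\<^sup>2 / 2) * (1 + y + y\<^sup>2 / 2)"
      proof -
        have "(1 - y + y\<^sup>2 / 2) * (1 + y + y\<^sup>2 / 2) = 1 + (y\<^sup>2)\<^sup>2 / 4"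
          by (simp add: power2_eq_square algebra_simps)
        then show ?thesis by (simp flip: exp_add)
      qed
      finally have "exp (- y) \<le> 1 - y + y\<^sup>2 / 2"
        by (rule mult_right_le_imp_le) (use that in \<open>simp add: add_pos_nonneg\<close>)
      moreover have "1 - y \<le> exp (- y)" using exp_ge_add_one_self[of "- y"] by simp
      ultimately show ?thesis by simp
    qed
    have 1: "\<bar>(1 - b\<^sup>2 * J / 2) - exp (- J * b\<^sup>2 / 2)\<bar> \<le> J\<^sup>2 / 8 * b^4"
      using e[of "J * b\<^sup>2 / 2"] J_pos by (simp add: abs_minus_commute power_mult_distrib power_divide power_mult[symmetric] mult_ac)
    have 2: "b\<^sup>2 / 6 * \<psi> b \<le> \<eta> * b\<^sup>2 + J / b0\<^sup>2 * b^4"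
    proof (cases "b = 0 \<or> \<bar>b\<bar> < b0")
      case True
      then have "b\<^sup>2 * \<psi> b \<le> b\<^sup>2 * (6 * \<eta>)" using b0(2)[of b] by (cases "b = 0") (auto intro: mult_left_mono)
      moreover have "0 \<le> J / b0\<^sup>2 * b^4" using J_pos by simp
      moreover have "b\<^sup>2 / 6 * \<psi> b = b\<^sup>2 * \<psi> b / 6" "\<eta> * b\<^sup>2 = b\<^sup>2 * (6 * \<eta>) / 6" by simp_all
      ultimately show ?thesis by linarith
    next
      case False
      have "b\<^sup>2 / 6 * \<psi> b \<le> b\<^sup>2 / 6 * (6 * J)" by (intro mult_left_mono \<psi>J) auto
      also have "\<dots> = J / b0\<^sup>2 * (b0\<^sup>2 * b\<^sup>2)" using b0 by simp
      also have "\<dots> \<le> J / b0\<^sup>2 * (b\<^sup>2 * b\<^sup>2)"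
        using False b0(1) J_pos by (intro mult_left_mono mult_right_mono) (auto simp: abs_le_square_iff[symmetric])
      also have "\<dots> = J / b0\<^sup>2 * b^4" by (simp add: power2_eq_square power4_eq_xxxx)
      finally show ?thesis using assms by (simp add: add_increasing)
    qed
    have "cmod (phi b - of_real (exp (- J * b\<^sup>2 / 2)))
        \<le> cmod (phi b - (1 - b\<^sup>2 * J / 2)) + cmod (of_real ((1 - b\<^sup>2 * J / 2) - exp (- J * b\<^sup>2 / 2)))"
      by (rule order_trans[OF _ norm_triangle_ineq]) simp
    also have "\<dots> \<le> (\<eta> * b\<^sup>2 + J / b0\<^sup>2 * b^4) + J\<^sup>2 / 8 * b^4"
      unfolding norm_of_real by (intro add_mono order_trans[OF phi 2] 1)
    finally show "cmod (phi b - of_real (exp (- J * b\<^sup>2 / 2))) \<le> \<eta> * b\<^sup>2 + (J / b0\<^sup>2 + J\<^sup>2 / 8) * b^4"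
      by (simp add: algebra_simps)
  qed
qed

lemma measurable_phi [measurable]: "phi \<in> borel_measurable borel"
proof -
  interpret prob_space "noise g" by (rule prob_noise)
  have "(\<lambda>(b, e). iexp (b * lg1 g e)) \<in> borel_measurable (borel \<Otimes>\<^sub>M noise g)"
    unfolding measurable_cong_sets[OF sets_pair_measure_cong[OF refl sets_noise] refl] by measurable
  from borel_measurable_lebesgue_integral[OF this] show ?thesis unfolding phi_def[abs_def] .
qed

lemma cmod_phi_le: "cmod (phi b) \<le> 1"
proof -
  interpret prob_space "noise g" by (rule prob_noise)
  have "cmod (phi b) \<le> expectation (\<lambda>e. cmod (iexp (b * lg1 g e)))" unfolding phi_def by (rule integral_norm_bound)
  then show ?thesis using prob_space by (simp flip: of_real_mult)
qed

text \<open>The regressors are switched off once the accumulated conditional variance exceeds $s + 1$. This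
  keeps the factor $\exp(V/2)$, which compensates the characteristic function, bounded.\<close>
lemma cf_bound:
  fixes w :: "real^'d"
  assumes t: "t \<in> \<Theta>" and k: "k > 0" and s: "s \<ge> 0" and \<gamma>: "0 < \<gamma>" "\<gamma> \<le> 1"
    and p: "measure (P t) {\<omega>. \<bar>(\<Sum>j<k. J * (w \<bullet> Sd t (\<omega> j))\<^sup>2) / real k - s\<bar> > \<gamma>} \<le> p"
    and \<phi>: "\<And>b. cmod (phi b - of_real (exp (- J * b\<^sup>2 / 2))) \<le> \<eta> * b\<^sup>2 + M * b^4" and \<eta>: "\<eta> \<ge> 0" and M: "M \<ge> 0"
    and A: "\<And>j. integrable (P t) (\<lambda>\<omega>. (w \<bullet> Sd t (\<omega> j))^4)" "\<And>j. (\<integral>\<omega>. (w \<bullet> Sd t (\<omega> j))^4 \<partial>P t) \<le> A"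
  shows "cmod ((CLINT \<omega>|P t. iexp (w \<bullet> ((1 / sqrt (real k)) *\<^sub>R (\<Sum>j<k. score t (Suc j) \<omega>)))) - of_real (exp (- s / 2)))
     \<le> \<gamma> + 5 * p + exp ((s + 1) / 2) * (\<eta> * (s + 1) / J + M * A / real k)"
proof -
  interpret prob_space "P t" by (rule P_prob[OF t])
  have [measurable]: "Sd t \<in> borel_measurable borel" "S t \<in> borel_measurable borel"
    by (rule measurable_Sd[OF t], rule measurable_S[OF t])
  have mcoord [measurable]: "(\<lambda>\<omega>. \<omega> j) \<in> borel_measurable (P t)" for j by (simp add: measurable_P[OF t])
  have [simp]: "real k > 0" using k by simp
  define a where "a j \<omega> = w \<bullet> Sd t (\<omega> j)" for j and \<omega> :: "nat \<Rightarrow> real"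
  define V where "V m \<omega> = (\<Sum>j<m. J * (a j \<omega>)\<^sup>2) / real k" for m \<omega>
  define tr where "tr j \<omega> = (if V (Suc j) \<omega> \<le> s + 1 then a j \<omega> else 0)" for j \<omega>
  define Vt where "Vt m \<omega> = (\<Sum>j<m. J * (tr j \<omega>)\<^sup>2) / real k" for m \<omega>
  define X where "X j \<omega> = - lg1 g (eps t (Suc j) \<omega>) * tr j \<omega> / sqrt (real k)" for j \<omega>
  define Z where "Z m \<omega> = iexp (\<Sum>j<m. X j \<omega>)" for m \<omega>
  define E where "E m \<omega> = exp (Vt m \<omega> / 2)" for m \<omega>
  define Y where "Y \<omega> = iexp (w \<bullet> ((1 / sqrt (real k)) *\<^sub>R (\<Sum>j<k. score t (Suc j) \<omega>)))" for \<omega>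
  have mp: "a j \<in> borel_measurable path_space" "V m \<in> borel_measurable path_space"
    "tr j \<in> borel_measurable path_space" "Vt m \<in> borel_measurable path_space"
    "X j \<in> borel_measurable path_space" "Z m \<in> borel_measurable path_space" "E m \<in> borel_measurable path_space" for j m
  proof -
    show a [measurable]: "a j \<in> borel_measurable path_space" for j unfolding a_def by measurable
    show V [measurable]: "V m \<in> borel_measurable path_space" for m unfolding V_def by measurable
    show [measurable]: "tr j \<in> borel_measurable path_space" for j unfolding tr_def by measurable
    show Vt [measurable]: "Vt m \<in> borel_measurable path_space" for m unfolding Vt_def by measurable
    show X [measurable]: "X j \<in> borel_measurable path_space" for j unfolding X_def by measurable
    show "Z m \<in> borel_measurable path_space" for m unfolding Z_def by measurable
    show "E m \<in> borel_measurable path_space" for m unfolding E_def by measurable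
  qed
  note mP = mp[folded measurable_P[OF t]]
  note [measurable] = mP
  have Vle: "Vt m \<omega> \<le> s + 1" for m \<omega>
  proof (induction m)
    case (Suc m)
    show ?case
    proof (cases "V (Suc m) \<omega> \<le> s + 1")
      case True
      have "tr j \<omega> = a j \<omega>" if "j < Suc m" for j
      proof -
        have "V (Suc j) \<omega> \<le> V (Suc m) \<omega>"
          unfolding V_def using that J_pos by (intro divide_right_mono sum_mono2) auto
        then show ?thesis using True by (simp add: tr_def)
      qed
      then have "Vt (Suc m) \<omega> = V (Suc m) \<omega>" by (simp add: Vt_def V_def)
      then show ?thesis using True by simp
    next
      case False
      then have "Vt (Suc m) \<omega> = Vt m \<omega>" by (simp add: Vt_def tr_def)
      then show ?thesis using Suc by simp
    qed
  qed (use s in \<open>simp add: Vt_def\<close>)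
  have Vt0: "0 \<le> Vt m \<omega>" for m \<omega> unfolding Vt_def using J_pos by (auto intro!: divide_nonneg_nonneg sum_nonneg)
  have VSuc: "Vt (Suc m) \<omega> = Vt m \<omega> + J * (tr m \<omega>)\<^sup>2 / real k" for m \<omega>
    by (simp add: Vt_def add_divide_distrib)
  have Eb: "E m \<omega> \<le> exp ((s + 1) / 2)" for m \<omega> unfolding E_def using Vle[of m \<omega>] by simp
  have E0: "E m \<omega> > 0" for m \<omega> unfolding E_def by simp
  have Zn: "cmod (Z m \<omega>) = 1" for m \<omega> unfolding Z_def by simp
  define b where "b m \<omega> = - tr m \<omega> / sqrt (real k)" for m \<omega>
  have b2: "(b m \<omega>)\<^sup>2 = (tr m \<omega>)\<^sup>2 / real k" "(b m \<omega>)^4 = (tr m \<omega>)^4 / (real k)\<^sup>2" for m \<omega>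
  proof -
    show *: "(b m \<omega>)\<^sup>2 = (tr m \<omega>)\<^sup>2 / real k" by (simp add: b_def power_divide)
    have "(b m \<omega>)^4 = ((b m \<omega>)\<^sup>2)\<^sup>2" by simp
    also have "\<dots> = (tr m \<omega>)^4 / (real k)\<^sup>2" unfolding * by (simp add: power_divide)
    finally show "(b m \<omega>)^4 = (tr m \<omega>)^4 / (real k)\<^sup>2" .
  qed
  have tr_le: "(tr m \<omega>)^4 \<le> (a m \<omega>)^4" "\<bar>tr m \<omega>\<bar> \<le> \<bar>a m \<omega>\<bar>" for m \<omega> by (auto simp: tr_def)
  have itr2: "integrable (P t) (\<lambda>\<omega>. (tr m \<omega>)\<^sup>2)" for m
  proof (rule integrable_const_bound[of _ "real k * (s + 1) / J"])
    show "AE \<omega> in P t. norm ((tr m \<omega>)\<^sup>2) \<le> real k * (s + 1) / J"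
    proof (rule AE_I2)
      fix \<omega>
      have "J * (tr m \<omega>)\<^sup>2 / real k \<le> s + 1" using Vle[of "Suc m" \<omega>] Vt0[of m \<omega>] VSuc[of m \<omega>] by linarith
      then have "J * (tr m \<omega>)\<^sup>2 \<le> (s + 1) * real k" using k by (subst (asm) pos_divide_le_eq) auto
      then show "norm ((tr m \<omega>)\<^sup>2) \<le> real k * (s + 1) / J" using J_pos by (simp add: field_simps)
    qed
  qed simp
  have itr4: "integrable (P t) (\<lambda>\<omega>. (tr m \<omega>)^4)" for m
    by (rule Bochner_Integration.integrable_bound[OF A(1)[of m, folded a_def]]) (use tr_le in auto)
  have Etr4: "(\<integral>\<omega>. (tr m \<omega>)^4 \<partial>P t) \<le> A" for m
    by (rule order_trans[OF integral_mono[OF itr4 A(1)[of m, folded a_def] tr_le(1)] A(2)[of m, folded a_def]])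
  have iW: "integrable (P t) (\<lambda>\<omega>. Z m \<omega> * of_real (E m' \<omega>))" for m m'
    by (rule integrable_const_bound[of _ "exp ((s + 1) / 2)"]) (use Eb E0 in \<open>auto simp: norm_mult Zn less_imp_le\<close>)
  have step: "cmod ((CLINT \<omega>|P t. Z (Suc m) \<omega> * of_real (E (Suc m) \<omega>)) - (CLINT \<omega>|P t. Z m \<omega> * of_real (E m \<omega>)))
     \<le> exp ((s + 1) / 2) * (\<eta> * (\<integral>\<omega>. (tr m \<omega>)\<^sup>2 \<partial>P t) / real k + M * A / (real k)\<^sup>2)" for m
  proof -
    let ?c = "past (Suc m)"
    have ac: "a j (?c \<omega>) = a j \<omega>" if "j \<le> m" for j \<omega> using that by (simp add: a_def past_def)
    have Vc: "V (Suc j) (?c \<omega>) = V (Suc j) \<omega>" if "j \<le> m" for j \<omega> using that by (simp add: V_def ac)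
    have trc: "tr j (?c \<omega>) = tr j \<omega>" if "j \<le> m" for j \<omega> using that by (simp add: tr_def ac Vc)
    have Vtc: "Vt (Suc m) (?c \<omega>) = Vt (Suc m) \<omega>" for \<omega> by (simp add: Vt_def trc)
    have Xc: "X j (?c \<omega>) = X j \<omega>" if "j < m" for j \<omega> using that by (simp add: X_def trc past_apply)
    have Zc: "Z m (?c \<omega>) = Z m \<omega>" for \<omega> by (simp add: Z_def Xc)
    let ?F = "\<lambda>(\<eta>, e). Z m \<eta> * of_real (E (Suc m) \<eta>) * iexp (b m \<eta> * lg1 g e)"
    have mF: "?F \<in> borel_measurable (path_space \<Otimes>\<^sub>M borel)"
      unfolding case_prod_beta' b_def using mp by measurable
    have Feq: "?F (?c \<omega>, eps t (Suc m) \<omega>) = Z (Suc m) \<omega> * of_real (E (Suc m) \<omega>)" for \<omega>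
    proof -
      have "X m \<omega> = b m \<omega> * lg1 g (eps t (Suc m) \<omega>)" by (simp add: X_def b_def)
      moreover have "Z (Suc m) \<omega> = Z m \<omega> * iexp (X m \<omega>)" by (simp add: Z_def exp_add distrib_left)
      ultimately have "Z (Suc m) \<omega> = Z m \<omega> * iexp (b m \<omega> * lg1 g (eps t (Suc m) \<omega>))" by metis
      then show ?thesis by (simp add: Zc E_def Vtc b_def trc)
    qed
    have "(CLINT \<omega>|P t. Z (Suc m) \<omega> * of_real (E (Suc m) \<omega>)) = (CLINT \<omega>|P t. ?F (?c \<omega>, eps t (Suc m) \<omega>))"
      unfolding Feq ..
    also have "\<dots> = (CLINT \<omega>|P t. CLINT e|noise g. ?F (?c \<omega>, e))"
      by (rule integral_step[OF t mF]) (unfold Feq, rule iW)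
    also have "\<dots> = (CLINT \<omega>|P t. Z m \<omega> * of_real (E (Suc m) \<omega>) * phi (b m \<omega>))"
      by (simp add: phi_def Zc E_def Vtc b_def trc)
    finally have 1: "(CLINT \<omega>|P t. Z (Suc m) \<omega> * of_real (E (Suc m) \<omega>)) = \<dots>" .
    have EE: "E m \<omega> = E (Suc m) \<omega> * exp (- J * (b m \<omega>)\<^sup>2 / 2)" for \<omega>
      unfolding E_def exp_add[symmetric] VSuc b2 by (simp add: add_divide_distrib)
    have mb: "b m \<in> borel_measurable (P t)" unfolding b_def by measurable
    then have mphi: "(\<lambda>\<omega>. phi (b m \<omega>)) \<in> borel_measurable (P t)" by measurable
    have i1: "integrable (P t) (\<lambda>\<omega>. Z m \<omega> * of_real (E (Suc m) \<omega>) * phi (b m \<omega>))"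
    proof (rule integrable_const_bound[of _ "exp ((s + 1) / 2)"])
      show "AE \<omega> in P t. cmod (Z m \<omega> * of_real (E (Suc m) \<omega>) * phi (b m \<omega>)) \<le> exp ((s + 1) / 2)"
        using mult_mono[OF Eb cmod_phi_le] E0 by (intro AE_I2) (auto simp: norm_mult Zn less_imp_le)
    qed (use mphi in measurable)
    have "cmod ((CLINT \<omega>|P t. Z (Suc m) \<omega> * of_real (E (Suc m) \<omega>)) - (CLINT \<omega>|P t. Z m \<omega> * of_real (E m \<omega>)))
       = cmod (CLINT \<omega>|P t. Z m \<omega> * of_real (E (Suc m) \<omega>) * phi (b m \<omega>) - Z m \<omega> * of_real (E m \<omega>))"
      unfolding 1 using i1 iW by simp
    also have "\<dots> \<le> (\<integral>\<omega>. cmod (Z m \<omega> * of_real (E (Suc m) \<omega>) * phi (b m \<omega>) - Z m \<omega> * of_real (E m \<omega>)) \<partial>P t)"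
      by (rule integral_norm_bound)
    also have "\<dots> \<le> (\<integral>\<omega>. exp ((s + 1) / 2) * (\<eta> * ((tr m \<omega>)\<^sup>2 / real k) + M * ((tr m \<omega>)^4 / (real k)\<^sup>2)) \<partial>P t)"
    proof (rule integral_mono)
      fix \<omega>
      have "Z m \<omega> * of_real (E (Suc m) \<omega>) * phi (b m \<omega>) - Z m \<omega> * of_real (E m \<omega>)
         = Z m \<omega> * of_real (E (Suc m) \<omega>) * (phi (b m \<omega>) - of_real (exp (- J * (b m \<omega>)\<^sup>2 / 2)))"
        unfolding EE[of \<omega>] by (simp add: right_diff_distrib mult_ac)
      then have "cmod (Z m \<omega> * of_real (E (Suc m) \<omega>) * phi (b m \<omega>) - Z m \<omega> * of_real (E m \<omega>))
         = E (Suc m) \<omega> * cmod (phi (b m \<omega>) - of_real (exp (- J * (b m \<omega>)\<^sup>2 / 2)))"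
        using E0[of "Suc m" \<omega>] by (simp add: norm_mult Zn)
      also have "\<dots> \<le> exp ((s + 1) / 2) * (\<eta> * (b m \<omega>)\<^sup>2 + M * (b m \<omega>)^4)"
        by (intro mult_mono Eb \<phi>) auto
      finally show "cmod (Z m \<omega> * of_real (E (Suc m) \<omega>) * phi (b m \<omega>) - Z m \<omega> * of_real (E m \<omega>))
         \<le> exp ((s + 1) / 2) * (\<eta> * ((tr m \<omega>)\<^sup>2 / real k) + M * ((tr m \<omega>)^4 / (real k)\<^sup>2))"
        unfolding b2 .
    qed (use i1 iW itr2 itr4 in auto)
    also have "\<dots> = exp ((s + 1) / 2) * (\<eta> * ((\<integral>\<omega>. (tr m \<omega>)\<^sup>2 \<partial>P t) / real k) + M * ((\<integral>\<omega>. (tr m \<omega>)^4 \<partial>P t) / (real k)\<^sup>2))"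
      using itr2 itr4 by simp
    also have "\<dots> \<le> exp ((s + 1) / 2) * (\<eta> * ((\<integral>\<omega>. (tr m \<omega>)\<^sup>2 \<partial>P t) / real k) + M * (A / (real k)\<^sup>2))"
      using M by (intro mult_left_mono add_left_mono divide_right_mono Etr4) auto
    finally show ?thesis by simp
  qed
  have tel: "cmod ((CLINT \<omega>|P t. Z k \<omega> * of_real (E k \<omega>)) - 1)
     \<le> exp ((s + 1) / 2) * (\<eta> * (s + 1) / J + M * A / real k)"
  proof -
    let ?W = "\<lambda>m. (CLINT \<omega>|P t. Z m \<omega> * of_real (E m \<omega>))"
    have "?W 0 = 1" by (simp add: Z_def E_def Vt_def prob_space)
    moreover have "(\<Sum>m<k. ?W (Suc m) - ?W m) = ?W k - ?W 0" by (rule sum_lessThan_telescope)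
    ultimately have "cmod (?W k - 1) = cmod (\<Sum>m<k. ?W (Suc m) - ?W m)" by (simp only:)
    also have "\<dots> \<le> (\<Sum>m<k. cmod (?W (Suc m) - ?W m))" by (rule norm_sum)
    also have "\<dots> \<le> (\<Sum>m<k. exp ((s + 1) / 2) * (\<eta> * (\<integral>\<omega>. (tr m \<omega>)\<^sup>2 \<partial>P t) / real k + M * A / (real k)\<^sup>2))"
      by (intro sum_mono step)
    also have "\<dots> = exp ((s + 1) / 2) * (\<eta> / J * (\<integral>\<omega>. Vt k \<omega> \<partial>P t) + M * A / real k)"
    proof -
      have "(\<integral>\<omega>. Vt k \<omega> \<partial>P t) = (\<Sum>m<k. J * (\<integral>\<omega>. (tr m \<omega>)\<^sup>2 \<partial>P t)) / real k"
        unfolding Vt_def using itr2 by simp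
      then have "\<eta> / J * (\<integral>\<omega>. Vt k \<omega> \<partial>P t) = (\<Sum>m<k. \<eta> * (\<integral>\<omega>. (tr m \<omega>)\<^sup>2 \<partial>P t) / real k)"
        using J_pos by (simp add: sum_distrib_left sum_divide_distrib)
      moreover have "(\<Sum>m<k. M * A / (real k)\<^sup>2) = M * A / real k"
        by (simp add: power2_eq_square)
      ultimately show ?thesis by (simp only: sum_distrib_left[symmetric] sum.distrib)
    qed
    also have "\<dots> \<le> exp ((s + 1) / 2) * (\<eta> / J * (s + 1) + M * A / real k)"
    proof (intro mult_left_mono add_right_mono)
      have "integrable (P t) (Vt k)"
        by (rule integrable_const_bound[of _ "s + 1"]) (use Vle Vt0 in auto)
      then have "(\<integral>\<omega>. Vt k \<omega> \<partial>P t) \<le> (\<integral>\<omega>. s + 1 \<partial>P t)" by (intro integral_mono Vle) auto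
      then show "(\<integral>\<omega>. Vt k \<omega> \<partial>P t) \<le> s + 1" by (simp add: prob_space)
    qed (use \<eta> J_pos in auto)
    finally show ?thesis by simp
  qed
  define bad where "bad = {\<omega>. \<bar>V k \<omega> - s\<bar> > \<gamma>}"
  have bad: "bad \<in> sets (P t)"
  proof -
    have "{\<omega> \<in> space (P t). \<bar>V k \<omega> - s\<bar> > \<gamma>} \<in> sets (P t)" by measurable
    then show ?thesis by (simp add: bad_def space_P[OF t])
  qed
  have pb: "measure (P t) bad \<le> p" using p by (simp add: bad_def V_def a_def)
  have ibad: "integrable (P t) (indicat_real bad)"
    using bad by (intro integrable_real_indicator) (auto simp: less_top[symmetric])
  have good: "tr j \<omega> = a j \<omega>" if "\<omega> \<notin> bad" "j < k" for j \<omega>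
  proof -
    have "V (Suc j) \<omega> \<le> V k \<omega>"
      unfolding V_def using that J_pos by (intro divide_right_mono sum_mono2) auto
    also have "V k \<omega> \<le> s + 1" using that(1) \<gamma> by (auto simp: bad_def)
    finally show ?thesis by (simp add: tr_def)
  qed
  have mY: "Y \<in> borel_measurable (P t)"
  proof -
    have [measurable]: "score t (Suc j) \<in> borel_measurable (P t)" for j
      using measurable_score[OF t, of "Suc j"] by (simp add: measurable_P[OF t])
    show ?thesis unfolding Y_def by measurable
  qed
  have iY: "integrable (P t) Y"
    by (rule integrable_const_bound[of _ 1]) (use mY in \<open>auto simp: Y_def\<close>)
  have iZ: "integrable (P t) (Z k)"
    by (rule integrable_const_bound[of _ 1]) (auto simp: Zn)
  have YZ: "Y \<omega> = Z k \<omega>" if "\<omega> \<notin> bad" for \<omega>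
  proof -
    have "w \<bullet> score t (Suc j) \<omega> = - lg1 g (eps t (Suc j) \<omega>) * a j \<omega>" for j
      using ldot_residual[OF t, of "\<omega> j" "eps t (Suc j) \<omega>"] by (simp add: a_def)
    then have "w \<bullet> ((1 / sqrt (real k)) *\<^sub>R (\<Sum>j<k. score t (Suc j) \<omega>)) = (\<Sum>j<k. X j \<omega>)"
      by (simp add: inner_sum_right sum_divide_distrib X_def good[OF that])
    then show ?thesis by (simp add: Y_def Z_def)
  qed
  have "cmod ((CLINT \<omega>|P t. Y \<omega>) - (CLINT \<omega>|P t. Z k \<omega>)) \<le> (\<integral>\<omega>. cmod (Y \<omega> - Z k \<omega>) \<partial>P t)"
    unfolding Bochner_Integration.integral_diff[OF iY iZ, symmetric] by (rule integral_norm_bound)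
  also have "\<dots> \<le> (\<integral>\<omega>. 2 * indicator bad \<omega> \<partial>P t)"
  proof (rule integral_mono)
    show "cmod (Y \<omega> - Z k \<omega>) \<le> 2 * indicator bad \<omega>" for \<omega>
      using norm_triangle_ineq4[of "Y \<omega>" "Z k \<omega>"] YZ[of \<omega>] by (cases "\<omega> \<in> bad") (auto simp: Zn Y_def)
  qed (use iY iZ ibad in auto)
  also have "\<dots> = 2 * measure (P t) bad" using bad by simp
  finally have d1: "cmod ((CLINT \<omega>|P t. Y \<omega>) - (CLINT \<omega>|P t. Z k \<omega>)) \<le> 2 * p" using pb by linarith
  have "cmod ((CLINT \<omega>|P t. Z k \<omega>) - (CLINT \<omega>|P t. of_real (exp (- s / 2)) * (Z k \<omega> * of_real (E k \<omega>))))
    \<le> (\<integral>\<omega>. cmod (Z k \<omega> - of_real (exp (- s / 2)) * (Z k \<omega> * of_real (E k \<omega>))) \<partial>P t)"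
    unfolding Bochner_Integration.integral_diff[OF iZ integrable_mult_right[OF iW], symmetric] by (rule integral_norm_bound)
  also have "\<dots> \<le> (\<integral>\<omega>. \<gamma> + 3 * indicator bad \<omega> \<partial>P t)"
  proof (rule integral_mono)
    fix \<omega>
    define x where "x = (Vt k \<omega> - s) / 2"
    have ex: "exp (- s / 2) * E k \<omega> = exp x" by (simp add: E_def x_def exp_add[symmetric] diff_divide_distrib)
    have "Z k \<omega> - of_real (exp (- s / 2)) * (Z k \<omega> * of_real (E k \<omega>)) = Z k \<omega> * of_real (1 - exp x)"
      unfolding ex[symmetric] by (simp add: algebra_simps)
    then have "cmod (Z k \<omega> - of_real (exp (- s / 2)) * (Z k \<omega> * of_real (E k \<omega>))) = \<bar>1 - exp x\<bar>"
      by (simp only: norm_mult Zn norm_of_real mult_1)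
    also have "\<dots> \<le> \<gamma> + 3 * indicator bad \<omega>"
    proof (cases "\<omega> \<in> bad")
      case True
      have "x \<le> 1 / 2" using Vle[of k \<omega>] by (simp add: x_def)
      then have "exp x \<le> exp (1 / 2)" by simp
      also have "\<dots> \<le> exp 1" by simp
      also have "\<dots> \<le> 3" by (rule exp_le)
      finally have "exp x \<le> 3" .
      moreover have "exp x > 0" by simp
      ultimately have "\<bar>1 - exp x\<bar> \<le> 3" unfolding abs_le_iff by linarith
      then show ?thesis using True \<gamma> by simp
    next
      case False
      have "Vt k \<omega> = V k \<omega>" by (simp add: Vt_def V_def good[OF False])
      then have "\<bar>x\<bar> \<le> \<gamma> / 2" using False by (simp add: bad_def x_def)
      moreover have "\<bar>exp x - 1\<bar> \<le> 2 * \<bar>x\<bar>"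
      proof (cases "x \<ge> 0")
        case True
        then show ?thesis using real_exp_bound_lemma[of x] \<open>\<bar>x\<bar> \<le> \<gamma> / 2\<close> \<gamma> by simp
      next
        case False
        then have "exp x \<le> 1" by simp
        then show ?thesis using False exp_ge_add_one_self[of x] by linarith
      qed
      ultimately show ?thesis using False by (simp add: abs_minus_commute)
    qed
    finally show "cmod (Z k \<omega> - of_real (exp (- s / 2)) * (Z k \<omega> * of_real (E k \<omega>))) \<le> \<gamma> + 3 * indicator bad \<omega>" .
  qed (use iZ iW ibad in auto)
  also have "\<dots> = \<gamma> + 3 * measure (P t) bad" using bad ibad by (simp add: prob_space)
  finally have d2: "cmod ((CLINT \<omega>|P t. Z k \<omega>) - of_real (exp (- s / 2)) * (CLINT \<omega>|P t. Z k \<omega> * of_real (E k \<omega>))) \<le> \<gamma> + 3 * p"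
    using pb by simp
  have "cmod (of_real (exp (- s / 2)) * (CLINT \<omega>|P t. Z k \<omega> * of_real (E k \<omega>)) - of_real (exp (- s / 2)))
    = exp (- s / 2) * cmod ((CLINT \<omega>|P t. Z k \<omega> * of_real (E k \<omega>)) - 1)"
    by (subst norm_of_real[of "exp (- s / 2)", where 'a = complex, unfolded abs_exp_cancel, symmetric], subst norm_mult[symmetric]) (simp add: right_diff_distrib)
  also have "\<dots> \<le> 1 * cmod ((CLINT \<omega>|P t. Z k \<omega> * of_real (E k \<omega>)) - 1)"
    using s by (intro mult_right_mono) auto
  finally have d3: "cmod (of_real (exp (- s / 2)) * (CLINT \<omega>|P t. Z k \<omega> * of_real (E k \<omega>)) - of_real (exp (- s / 2)))
      \<le> exp ((s + 1) / 2) * (\<eta> * (s + 1) / J + M * A / real k)" using tel by simp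
  have "cmod (y - e) \<le> cmod (y - z) + cmod (z - v) + cmod (v - e)" for y z v e
    using norm_triangle_ineq[of "y - z" "z - v"] norm_triangle_ineq[of "y - v" "v - e"] by simp
  from this[of "CLINT \<omega>|P t. Y \<omega>" "of_real (exp (- s / 2))" "CLINT \<omega>|P t. Z k \<omega>"
      "of_real (exp (- s / 2)) * (CLINT \<omega>|P t. Z k \<omega> * of_real (E k \<omega>))"] d1 d2 d3
  show ?thesis unfolding Y_def by linarith
qed

lemma fisher_form_bounds:
  obtains c C where "c > 0" "C > 0" "\<And>t v. t \<in> \<Theta> \<Longrightarrow> norm v = 1 \<Longrightarrow> c \<le> v \<bullet> (I t *v v)"
    "\<And>t v. t \<in> \<Theta> \<Longrightarrow> 0 \<le> v \<bullet> (I t *v v)" "\<And>t v. t \<in> \<Theta> \<Longrightarrow> v \<bullet> (I t *v v) \<le> C * (norm v)\<^sup>2"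
proof -
  obtain c where c: "c > 0" "\<And>t v. t \<in> \<Theta> \<Longrightarrow> norm v = 1 \<Longrightarrow> c \<le> v \<bullet> (I t *v v)"
    using R5_nondeg by blast
  obtain C where C: "\<And>t v. t \<in> \<Theta> \<Longrightarrow> norm v = 1 \<Longrightarrow> v \<bullet> (I t *v v) \<le> C"
    using R5_bdd by blast
  have sc: "v \<bullet> (I t *v v) = (norm v)\<^sup>2 * ((v /\<^sub>R norm v) \<bullet> (I t *v (v /\<^sub>R norm v)))" if "v \<noteq> 0" for v t
    using that by (simp add: matrix_vector_mult_scaleR power2_eq_square field_simps)
  show ?thesis
  proof
    show "c > 0" "max C 1 > 0" using c by auto
    show "c \<le> v \<bullet> (I t *v v)" if "t \<in> \<Theta>" "norm v = 1" for t v using c that by blast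
    show "0 \<le> v \<bullet> (I t *v v)" if t: "t \<in> \<Theta>" for t v
    proof (cases "v = 0")
      case False
      then have "0 \<le> (v /\<^sub>R norm v) \<bullet> (I t *v (v /\<^sub>R norm v))" using c(1) c(2)[OF t, of "v /\<^sub>R norm v"] by simp
      then show ?thesis unfolding sc[OF False] by simp
    qed simp
    show "v \<bullet> (I t *v v) \<le> max C 1 * (norm v)\<^sup>2" if t: "t \<in> \<Theta>" for t v
    proof (cases "v = 0")
      case False
      then have "(v /\<^sub>R norm v) \<bullet> (I t *v (v /\<^sub>R norm v)) \<le> max C 1" using C[OF t, of "v /\<^sub>R norm v"] by simp
      then show ?thesis unfolding sc[OF False] by (subst mult.commute) (rule mult_right_mono, simp_all)
    qed simp
  qed
qed

lemma hess_tight: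
  assumes "compact K" "K \<subseteq> \<Theta>" "e > 0"
  obtains H where "H > 0" "\<And>n t. t \<in> K \<Longrightarrow> measure (P t) {\<omega>. norm ((1 / sqrt (real n)) *\<^sub>R (\<Sum>j<n. hess t (Suc j) \<omega> + I t)) > H} \<le> e"
proof -
  obtain H where H: "H > 0" "\<forall>n. \<forall>t\<in>K. measure (P t) {\<omega>\<in>space (P t). norm ((1 / sqrt (real n)) *\<^sub>R (\<Sum>j=1..n. lddot S g t (\<omega> (j - 1)) (\<omega> j) + I t)) > H} \<le> e"
    using R4_tight assms unfolding unif_tight_def by meson
  show ?thesis
  proof (rule that[OF H(1)])
    fix n t assume t: "t \<in> K"
    then have "t \<in> \<Theta>" using assms by auto
    then show "measure (P t) {\<omega>. norm ((1 / sqrt (real n)) *\<^sub>R (\<Sum>j<n. hess t (Suc j) \<omega> + I t)) > H} \<le> e"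
      using H(2)[rule_format, OF t, of n] by (simp add: space_P sum.atLeast1_atMost_eq)
  qed
qed

lemma variance_concentration:
  assumes K: "compact K" "K \<subseteq> \<Theta>" and e: "e > 0" and \<gamma>: "\<gamma> > 0" and B: "B > 0"
  shows "\<exists>k0>0. \<forall>k\<ge>k0. \<forall>t\<in>K. \<forall>w. norm w \<le> B \<longrightarrow>
     measure (P t) {\<omega>. \<bar>(\<Sum>j<k. J * (w \<bullet> Sd t (\<omega> j))\<^sup>2) / real k - w \<bullet> (I t *v w)\<bar> > \<gamma>} \<le> e"
proof -
  obtain C where C: "C > 0" "\<And>t j. t \<in> \<Theta> \<Longrightarrow> (\<integral>\<^sup>+\<omega>. ennreal ((norm (hess t (Suc j) \<omega>))\<^sup>2) \<partial>P t) \<le> ennreal C"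
    using moment_bounds by blast
  obtain A where A: "A > 0" "\<And>t j w. t \<in> \<Theta> \<Longrightarrow> integrable (P t) (\<lambda>\<omega>. (w \<bullet> Sd t (\<omega> j))^4)"
    "\<And>t j w. t \<in> \<Theta> \<Longrightarrow> (\<integral>\<omega>. (w \<bullet> Sd t (\<omega> j))^4 \<partial>P t) \<le> A * (norm w)^4"
    using fourth_moment by blast
  obtain H where H: "H > 0" "\<And>n t. t \<in> K \<Longrightarrow> measure (P t) {\<omega>. norm ((1 / sqrt (real n)) *\<^sub>R (\<Sum>j<n. hess t (Suc j) \<omega> + I t)) > H} \<le> e / 2"
    using hess_tight[OF K, of "e / 2"] e by auto
  define C' where "C' = 2 * (B^4 * C) + 2 * J\<^sup>2 * (A * B^4)"
  have C': "C' > 0" unfolding C'_def using B C A J_pos by (intro add_pos_pos mult_pos_pos) auto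
  have "\<forall>\<^sub>F k in sequentially. 4 * C' / (\<gamma>\<^sup>2 * real k) \<le> e / 2 \<and> H * B\<^sup>2 \<le> sqrt (real k) * (\<gamma> / 2)"
  proof (rule eventually_conj)
    have "(\<lambda>k. 4 * C' / (\<gamma>\<^sup>2 * real k)) \<longlonglongrightarrow> 0"
      using \<gamma> by real_asymp
    then have "\<forall>\<^sub>F k in sequentially. 4 * C' / (\<gamma>\<^sup>2 * real k) < e / 2" using e by (intro order_tendstoD(2)) auto
    then show "\<forall>\<^sub>F k in sequentially. 4 * C' / (\<gamma>\<^sup>2 * real k) \<le> e / 2" by (rule eventually_mono) simp
    have "filterlim (\<lambda>k. sqrt (real k) * (\<gamma> / 2)) at_top sequentially" using \<gamma> by real_asymp
    then show "\<forall>\<^sub>F k in sequentially. H * B\<^sup>2 \<le> sqrt (real k) * (\<gamma> / 2)"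
      by (auto simp: filterlim_at_top)
  qed
  then obtain k0 where k0: "\<And>k. k \<ge> k0 \<Longrightarrow> 4 * C' / (\<gamma>\<^sup>2 * real k) \<le> e / 2 \<and> H * B\<^sup>2 \<le> sqrt (real k) * (\<gamma> / 2)"
    by (auto simp: eventually_sequentially)
  show ?thesis
  proof (intro exI[of _ "Suc k0"] conjI allI ballI impI)
    fix k t and w :: "real^'d" assume k: "k \<ge> Suc k0" and tK: "t \<in> K" and w: "norm w \<le> B"
    have t: "t \<in> \<Theta>" using tK K by auto
    interpret prob_space "P t" by (rule P_prob[OF t])
    have [measurable]: "Sd t \<in> borel_measurable borel" by (rule measurable_Sd[OF t])
    have [measurable]: "hess t (Suc j) \<in> borel_measurable (P t)" for j
      using measurable_hess[OF t, of "Suc j"] by (simp add: measurable_P[OF t])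
    then have [measurable]: "(\<lambda>\<omega>. lddot S g t (\<omega> j) (\<omega> (Suc j))) \<in> borel_measurable (P t)" for j by simp
    have [measurable]: "(\<lambda>\<omega>. \<omega> j) \<in> borel_measurable (P t)" for j by (simp add: measurable_P[OF t])
    define d where "d x x' = w \<bullet> (lddot S g t x x' *v w) + J * (w \<bullet> Sd t x)\<^sup>2" for x x'
    have md: "(\<lambda>(x, x'). d x x') \<in> borel_measurable (borel \<Otimes>\<^sub>M borel)"
      unfolding d_def using measurable_lddot_pair[OF t] by (simp add: case_prod_beta')
    have cd: "(\<integral>e. d x (S t x + e) \<partial>noise g) = 0" for x
    proof -
      interpret N: prob_space "noise g" by (rule prob_noise)
      show ?thesis unfolding d_def using hess_form_moments(1,2)[OF t, of w x] N.prob_space by simp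
    qed
    have w4: "(norm w)^4 \<le> B^4" using w by (intro power_mono) auto
    have dC: "(\<integral>\<^sup>+\<omega>. ennreal ((d (\<omega> j) (\<omega> (Suc j)))\<^sup>2) \<partial>P t) \<le> ennreal C'" for j
    proof -
      have "(\<integral>\<^sup>+\<omega>. ennreal ((d (\<omega> j) (\<omega> (Suc j)))\<^sup>2) \<partial>P t)
        \<le> (\<integral>\<^sup>+\<omega>. ennreal (2 * B^4) * ennreal ((norm (hess t (Suc j) \<omega>))\<^sup>2) + ennreal (2 * J\<^sup>2) * ennreal ((w \<bullet> Sd t (\<omega> j))^4) \<partial>P t)"
      proof (rule nn_integral_mono)
        fix \<omega> :: "nat \<Rightarrow> real"
        have "(w \<bullet> (hess t (Suc j) \<omega> *v w))\<^sup>2 \<le> ((norm w)\<^sup>2 * norm (hess t (Suc j) \<omega>))\<^sup>2"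
          using norm_quadratic_form_le[of w "hess t (Suc j) \<omega>"] by (metis abs_ge_zero power2_abs power_mono)
        also have "\<dots> = (norm w)^4 * (norm (hess t (Suc j) \<omega>))\<^sup>2" by (simp add: power_mult_distrib power_mult[symmetric])
        also have "\<dots> \<le> B^4 * (norm (hess t (Suc j) \<omega>))\<^sup>2" by (intro mult_right_mono w4) simp
        finally have 1: "(w \<bullet> (hess t (Suc j) \<omega> *v w))\<^sup>2 \<le> B^4 * (norm (hess t (Suc j) \<omega>))\<^sup>2" .
        have uv: "(u + v)\<^sup>2 \<le> 2 * u\<^sup>2 + 2 * v\<^sup>2" for u v :: real
          using zero_le_power2[of "u - v"] by (simp add: power2_diff power2_sum)
        have "(d (\<omega> j) (\<omega> (Suc j)))\<^sup>2 \<le> 2 * (w \<bullet> (hess t (Suc j) \<omega> *v w))\<^sup>2 + 2 * (J * (w \<bullet> Sd t (\<omega> j))\<^sup>2)\<^sup>2"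
          unfolding d_def using uv by simp
        also have "\<dots> \<le> 2 * B^4 * (norm (hess t (Suc j) \<omega>))\<^sup>2 + 2 * J\<^sup>2 * (w \<bullet> Sd t (\<omega> j))^4"
          using 1 by (simp add: power_mult_distrib power_mult[symmetric])
        finally have "ennreal ((d (\<omega> j) (\<omega> (Suc j)))\<^sup>2) \<le> ennreal (2 * B^4 * (norm (hess t (Suc j) \<omega>))\<^sup>2 + 2 * J\<^sup>2 * (w \<bullet> Sd t (\<omega> j))^4)"
          by (rule ennreal_leI)
        then show "ennreal ((d (\<omega> j) (\<omega> (Suc j)))\<^sup>2) \<le> ennreal (2 * B^4) * ennreal ((norm (hess t (Suc j) \<omega>))\<^sup>2) + ennreal (2 * J\<^sup>2) * ennreal ((w \<bullet> Sd t (\<omega> j))^4)"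
          by (simp add: ennreal_mult ennreal_plus)
      qed
      also have "\<dots> = ennreal (2 * B^4) * (\<integral>\<^sup>+\<omega>. ennreal ((norm (hess t (Suc j) \<omega>))\<^sup>2) \<partial>P t) + ennreal (2 * J\<^sup>2) * (\<integral>\<^sup>+\<omega>. ennreal ((w \<bullet> Sd t (\<omega> j))^4) \<partial>P t)"
        by (subst nn_integral_add) (simp_all add: nn_integral_cmult)
      also have "\<dots> \<le> ennreal (2 * B^4) * ennreal C + ennreal (2 * J\<^sup>2) * ennreal (A * B^4)"
      proof (intro add_mono mult_left_mono C(2) t)
        have "(\<integral>\<^sup>+\<omega>. ennreal ((w \<bullet> Sd t (\<omega> j))^4) \<partial>P t) = ennreal (\<integral>\<omega>. (w \<bullet> Sd t (\<omega> j))^4 \<partial>P t)"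
          by (rule nn_integral_eq_integral[OF A(2)[OF t]]) simp
        also have "\<dots> \<le> ennreal (A * B^4)"
          by (intro ennreal_leI order_trans[OF A(3)[OF t]] mult_left_mono w4) (use A in simp)
        finally show "(\<integral>\<^sup>+\<omega>. ennreal ((w \<bullet> Sd t (\<omega> j))^4) \<partial>P t) \<le> ennreal (A * B^4)" .
      qed simp_all
      also have "\<dots> = ennreal C'" unfolding C'_def using A C by (simp add: ennreal_mult[symmetric] ennreal_plus[symmetric] mult_ac del: ennreal_plus)
      finally show ?thesis .
    qed
    have kpos: "real k > 0" using k by simp
    let ?N = "\<lambda>\<omega>. (1 / sqrt (real k)) *\<^sub>R (\<Sum>j<k. hess t (Suc j) \<omega> + I t)"
    let ?D = "\<lambda>\<omega>. \<Sum>j<k. d (\<omega> j) (\<omega> (Suc j))"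
    have [measurable]: "(\<lambda>\<omega>. d (\<omega> j) (\<omega> (Suc j))) \<in> borel_measurable (P t)" for j
      unfolding measurable_P[OF t] by (rule measurable_transition(1)[OF t md])
    have mD: "{\<omega>. \<bar>?D \<omega>\<bar> > real k * (\<gamma> / 2)} \<in> events"
    proof -
      have "{\<omega> \<in> space (P t). \<bar>?D \<omega>\<bar> > real k * (\<gamma> / 2)} \<in> events" by measurable
      then show ?thesis by (simp add: space_P[OF t])
    qed
    have mN: "{\<omega>. norm (?N \<omega>) > H} \<in> events"
    proof -
      have "{\<omega> \<in> space (P t). norm (?N \<omega>) > H} \<in> events" by measurable
      then show ?thesis by (simp add: space_P[OF t])
    qed
    have "measure (P t) {\<omega>. \<bar>(\<Sum>j<k. J * (w \<bullet> Sd t (\<omega> j))\<^sup>2) / real k - w \<bullet> (I t *v w)\<bar> > \<gamma>}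
      \<le> measure (P t) ({\<omega>. \<bar>?D \<omega>\<bar> > real k * (\<gamma> / 2)} \<union> {\<omega>. norm (?N \<omega>) > H})"
    proof (rule finite_measure_mono)
      show "{\<omega>. \<bar>(\<Sum>j<k. J * (w \<bullet> Sd t (\<omega> j))\<^sup>2) / real k - w \<bullet> (I t *v w)\<bar> > \<gamma>}
        \<subseteq> {\<omega>. \<bar>?D \<omega>\<bar> > real k * (\<gamma> / 2)} \<union> {\<omega>. norm (?N \<omega>) > H}"
      proof (rule subsetI, rule ccontr)
        fix \<omega> assume big: "\<omega> \<in> {\<omega>. \<bar>(\<Sum>j<k. J * (w \<bullet> Sd t (\<omega> j))\<^sup>2) / real k - w \<bullet> (I t *v w)\<bar> > \<gamma>}"
          and "\<omega> \<notin> {\<omega>. \<bar>?D \<omega>\<bar> > real k * (\<gamma> / 2)} \<union> {\<omega>. norm (?N \<omega>) > H}"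
        then have D: "\<bar>?D \<omega>\<bar> \<le> real k * (\<gamma> / 2)" and N: "norm (?N \<omega>) \<le> H" by (auto simp: not_less)
        have lin: "w \<bullet> ((\<Sum>j<k. F j) *v w) = (\<Sum>j<k. w \<bullet> (F j *v w))" for F :: "nat \<Rightarrow> real^'d^'d"
          by (induction k) (simp_all add: matrix_vector_mult_add_rdistrib inner_add_right)
        have sc: "w \<bullet> ((r *\<^sub>R F) *v w) = r * (w \<bullet> (F *v w))" for r and F :: "real^'d^'d"
          by (simp add: scaleR_matrix_vector_assoc[symmetric])
        have "w \<bullet> (?N \<omega> *v w) = (\<Sum>j<k. w \<bullet> (hess t (Suc j) \<omega> *v w) + w \<bullet> (I t *v w)) / sqrt (real k)"
          unfolding sc lin by (simp add: matrix_vector_mult_add_rdistrib inner_add_right)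
        then have "sqrt (real k) * (w \<bullet> (?N \<omega> *v w)) = (\<Sum>j<k. w \<bullet> (hess t (Suc j) \<omega> *v w)) + real k * (w \<bullet> (I t *v w))"
          using kpos by (simp add: sum.distrib)
        then have "(\<Sum>j<k. J * (w \<bullet> Sd t (\<omega> j))\<^sup>2) - real k * (w \<bullet> (I t *v w)) = ?D \<omega> - sqrt (real k) * (w \<bullet> (?N \<omega> *v w))"
          unfolding d_def by (simp add: sum.distrib)
        then have "\<bar>(\<Sum>j<k. J * (w \<bullet> Sd t (\<omega> j))\<^sup>2) - real k * (w \<bullet> (I t *v w))\<bar> \<le> \<bar>?D \<omega>\<bar> + \<bar>sqrt (real k) * (w \<bullet> (?N \<omega> *v w))\<bar>"
          by (simp only: abs_triangle_ineq4)
        also have "\<dots> \<le> real k * (\<gamma> / 2) + sqrt (real k) * (sqrt (real k) * (\<gamma> / 2))"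
        proof (rule add_mono[OF D])
          have "\<bar>w \<bullet> (?N \<omega> *v w)\<bar> \<le> (norm w)\<^sup>2 * norm (?N \<omega>)" by (rule norm_quadratic_form_le)
          also have "\<dots> \<le> B\<^sup>2 * H" using w N by (intro mult_mono power_mono) auto
          also have "\<dots> \<le> sqrt (real k) * (\<gamma> / 2)" using k0[of k] k by (simp add: mult.commute)
          finally show "\<bar>sqrt (real k) * (w \<bullet> (?N \<omega> *v w))\<bar> \<le> sqrt (real k) * (sqrt (real k) * (\<gamma> / 2))"
            unfolding abs_mult by (intro mult_mono) auto
        qed
        also have "\<dots> = real k * \<gamma>" using kpos by (simp add: mult.assoc[symmetric])
        finally have "\<bar>(\<Sum>j<k. J * (w \<bullet> Sd t (\<omega> j))\<^sup>2) - real k * (w \<bullet> (I t *v w))\<bar> / real k \<le> \<gamma>"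
          using kpos by (simp add: divide_le_eq mult.commute)
        moreover have "\<bar>(\<Sum>j<k. J * (w \<bullet> Sd t (\<omega> j))\<^sup>2) - real k * (w \<bullet> (I t *v w))\<bar> / real k
          = \<bar>(\<Sum>j<k. J * (w \<bullet> Sd t (\<omega> j))\<^sup>2) / real k - w \<bullet> (I t *v w)\<bar>"
        proof -
          have "\<bar>y - real k * z\<bar> / real k = \<bar>y / real k - z\<bar>" for y z :: real
          proof -
            have "y / real k - z = (y - real k * z) / real k" using kpos by (simp add: diff_divide_distrib)
            then show ?thesis by (simp add: abs_divide)
          qed
          then show ?thesis .
        qed
        ultimately show False using big by simp
      qed
    qed (use mD mN in simp)
    also have "\<dots> \<le> measure (P t) {\<omega>. \<bar>?D \<omega>\<bar> > real k * (\<gamma> / 2)} + measure (P t) {\<omega>. norm (?N \<omega>) > H}"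
      by (rule measure_Un_le[OF mD mN])
    also have "\<dots> \<le> e / 2 + e / 2"
    proof (rule add_mono)
      have "measure (P t) {\<omega>. \<bar>?D \<omega>\<bar> > real k * (\<gamma> / 2)} \<le> real k * C' / (real k * (\<gamma> / 2))\<^sup>2"
        by (rule martingale_tail[OF t md cd dC]) (use C' kpos \<gamma> in auto)
      also have "\<dots> = 4 * C' / (\<gamma>\<^sup>2 * real k)" using kpos \<gamma> by (simp add: power2_eq_square field_simps)
      also have "\<dots> \<le> e / 2" using k0[of k] k by simp
      finally show "measure (P t) {\<omega>. \<bar>?D \<omega>\<bar> > real k * (\<gamma> / 2)} \<le> e / 2" .
    qed (rule H(2)[OF tK])
    finally show "measure (P t) {\<omega>. \<bar>(\<Sum>j<k. J * (w \<bullet> Sd t (\<omega> j))\<^sup>2) / real k - w \<bullet> (I t *v w)\<bar> > \<gamma>} \<le> e" by simp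
  qed simp
qed

lemma score_tail:
  "\<exists>C>0. \<forall>t\<in>\<Theta>. \<forall>k>0. \<forall>K>0. measure (P t) {\<omega>. norm ((1 / sqrt (real k)) *\<^sub>R (\<Sum>j<k. score t (Suc j) \<omega>)) > K} \<le> C / K\<^sup>2"
proof -
  obtain C where C: "C > 0" "\<And>t j. t \<in> \<Theta> \<Longrightarrow> (\<integral>\<^sup>+\<omega>. ennreal ((norm (score t (Suc j) \<omega>))\<^sup>2) \<partial>P t) \<le> ennreal C"
    using moment_bounds by blast
  define d where "d = real CARD('d)"
  have d: "d > 0" by (simp add: d_def)
  show ?thesis
  proof (intro exI[of _ "d * (C * d\<^sup>2)"] conjI ballI allI impI)
    show "d * (C * d\<^sup>2) > 0" using C d by simp
    fix t k and K :: real assume t: "t \<in> \<Theta>" and k: "k > (0::nat)" and K: "K > 0"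
    interpret prob_space "P t" by (rule P_prob[OF t])
    have ms: "score t (Suc j) \<in> borel_measurable (P t)" for j
      using measurable_score[OF t, of "Suc j"] by (simp add: measurable_P[OF t])
    let ?Bad = "\<lambda>i. {\<omega>. \<bar>\<Sum>j<k. score t (Suc j) \<omega> $ i\<bar> > sqrt (real k) * (K / d)}"
    have mB: "?Bad i \<in> events" for i
    proof -
      have "{\<omega> \<in> space (P t). \<bar>\<Sum>j<k. score t (Suc j) \<omega> $ i\<bar> > sqrt (real k) * (K / d)} \<in> events"
        using ms by measurable
      then show ?thesis by (simp add: space_P[OF t])
    qed
    have "measure (P t) {\<omega>. norm ((1 / sqrt (real k)) *\<^sub>R (\<Sum>j<k. score t (Suc j) \<omega>)) > K} \<le> measure (P t) (\<Union>i\<in>UNIV. ?Bad i)"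
    proof (rule finite_measure_mono)
      show "{\<omega>. norm ((1 / sqrt (real k)) *\<^sub>R (\<Sum>j<k. score t (Suc j) \<omega>)) > K} \<subseteq> (\<Union>i\<in>UNIV. ?Bad i)"
      proof (rule subsetI, rule ccontr)
        fix \<omega> assume big: "\<omega> \<in> {\<omega>. norm ((1 / sqrt (real k)) *\<^sub>R (\<Sum>j<k. score t (Suc j) \<omega>)) > K}"
          and "\<omega> \<notin> (\<Union>i\<in>UNIV. ?Bad i)"
        then have le: "\<bar>\<Sum>j<k. score t (Suc j) \<omega> $ i\<bar> \<le> sqrt (real k) * (K / d)" for i by (simp add: not_less)
        have "norm (\<Sum>j<k. score t (Suc j) \<omega>) \<le> (\<Sum>i\<in>UNIV. \<bar>(\<Sum>j<k. score t (Suc j) \<omega>) $ i\<bar>)"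
          by (rule norm_le_l1_cart)
        also have "\<dots> \<le> (\<Sum>i\<in>(UNIV :: 'd set). sqrt (real k) * (K / d))"
          using le by (intro sum_mono) simp
        also have "\<dots> = sqrt (real k) * K" using d by (simp add: d_def)
        finally have "norm ((1 / sqrt (real k)) *\<^sub>R (\<Sum>j<k. score t (Suc j) \<omega>)) \<le> K"
          using k by (simp add: field_simps)
        then show False using big by simp
      qed
    qed (use mB in auto)
    also have "\<dots> \<le> (\<Sum>i\<in>UNIV. measure (P t) (?Bad i))"
      by (rule finite_measure_subadditive_finite) (use mB in auto)
    also have "\<dots> \<le> (\<Sum>i\<in>(UNIV :: 'd set). real k * C / (sqrt (real k) * (K / d))\<^sup>2)"
    proof (rule sum_mono)
      fix i :: 'd
      have "measure (P t) {\<omega>. \<bar>\<Sum>j<k. ldot S g t (\<omega> j) (\<omega> (Suc j)) $ i\<bar> > sqrt (real k) * (K / d)} \<le> real k * C / (sqrt (real k) * (K / d))\<^sup>2"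
      proof (rule martingale_tail[OF t])
        show "(\<lambda>(x, x'). ldot S g t x x' $ i) \<in> borel_measurable (borel \<Otimes>\<^sub>M borel)"
          using measurable_ldot_pair[of t] unfolding case_prod_beta' by (rule borel_measurable_vec_nth)
        show "(\<integral>e. ldot S g t x (S t x + e) $ i \<partial>noise g) = 0" for x
          using lg_identities by (simp add: ldot_residual[OF t])
        fix j
        have "(\<integral>\<^sup>+\<omega>. ennreal ((ldot S g t (\<omega> j) (\<omega> (Suc j)) $ i)\<^sup>2) \<partial>P t) \<le> (\<integral>\<^sup>+\<omega>. ennreal ((norm (score t (Suc j) \<omega>))\<^sup>2) \<partial>P t)"
        proof (intro nn_integral_mono ennreal_leI)
          show "(ldot S g t (\<omega> j) (\<omega> (Suc j)) $ i)\<^sup>2 \<le> (norm (score t (Suc j) \<omega>))\<^sup>2" for \<omega> :: "nat \<Rightarrow> real"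
            using component_le_norm_cart[of "score t (Suc j) \<omega>" i] by (metis abs_ge_zero diff_Suc_1 power2_abs power_mono)
        qed
        also have "\<dots> \<le> ennreal C" by (rule C(2)[OF t])
        finally show "(\<integral>\<^sup>+\<omega>. ennreal ((ldot S g t (\<omega> j) (\<omega> (Suc j)) $ i)\<^sup>2) \<partial>P t) \<le> ennreal C" .
      qed (use C k K d in auto)
      then show "measure (P t) (?Bad i) \<le> real k * C / (sqrt (real k) * (K / d))\<^sup>2" by simp
    qed
    also have "\<dots> = d * (C * d\<^sup>2) / K\<^sup>2" using k K d
      by (simp add: power_mult_distrib power_divide d_def)
    finally show "measure (P t) {\<omega>. norm ((1 / sqrt (real k)) *\<^sub>R (\<Sum>j<k. score t (Suc j) \<omega>)) > K} \<le> d * (C * d\<^sup>2) / K\<^sup>2" .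
  qed
qed

lemma score_cf_limit:
  fixes w :: "nat \<Rightarrow> real^'d"
  assumes K: "compact K" "K \<subseteq> \<Theta>" and T: "\<And>n. T n \<in> K" and m: "filterlim m at_top sequentially"
    and B: "\<And>n. norm (w n) \<le> B"
  shows "(\<lambda>n. (CLINT \<omega>|P (T n). iexp (w n \<bullet> ((1 / sqrt (real (m n))) *\<^sub>R (\<Sum>j<m n. score (T n) (Suc j) \<omega>))))
     - of_real (exp (- (w n \<bullet> (I (T n) *v w n)) / 2))) \<longlonglongrightarrow> 0"
proof -
  have TT: "T n \<in> \<Theta>" for n using T K by auto
  obtain c C where c: "\<And>t v. t \<in> \<Theta> \<Longrightarrow> 0 \<le> v \<bullet> (I t *v v)" and "C > 0"
    and C: "\<And>t v. t \<in> \<Theta> \<Longrightarrow> v \<bullet> (I t *v v) \<le> C * (norm v)\<^sup>2"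
    by (rule fisher_form_bounds) blast
  define s where "s n = w n \<bullet> (I (T n) *v w n)" for n
  define B' where "B' = max B 1"
  have B': "norm (w n) \<le> B'" "B' > 0" for n using B[of n] by (auto simp: B'_def)
  define s1 where "s1 = C * B'\<^sup>2"
  have s0: "s n \<ge> 0" for n unfolding s_def by (rule c[OF TT])
  have s1: "s n \<le> s1" for n
    unfolding s_def s1_def
    by (rule order_trans[OF C[OF TT] mult_left_mono[OF power_mono[OF B'(1)]]]) (use \<open>C > 0\<close> in auto)
  have s10: "s1 \<ge> 0" using s0[of 0] s1[of 0] by simp
  obtain A where A: "A > 0" "\<And>t j w. t \<in> \<Theta> \<Longrightarrow> integrable (P t) (\<lambda>\<omega>. (w \<bullet> Sd t (\<omega> j))^4)"
    "\<And>t j w. t \<in> \<Theta> \<Longrightarrow> (\<integral>\<omega>. (w \<bullet> Sd t (\<omega> j))^4 \<partial>P t) \<le> A * (norm w)^4"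
    using fourth_moment by blast
  define A' where "A' = A * B'^4"
  have A': "(\<integral>\<omega>. (w n \<bullet> Sd (T n) (\<omega> j))^4 \<partial>P (T n)) \<le> A'" for n j
    unfolding A'_def
    by (rule order_trans[OF A(3)[OF TT] mult_left_mono[OF power_mono[OF B'(1)]]]) (use A(1) in auto)
  define c1 where "c1 = exp ((s1 + 1) / 2)"
  have c1: "c1 > 0" by (simp add: c1_def)
  show ?thesis
  proof (rule LIMSEQ_I)
    fix r :: real assume r: "r > 0"
    define \<gamma> where "\<gamma> = min 1 (r / 8)"
    define p where "p = r / 40"
    define \<eta> where "\<eta> = r * J / (8 * c1 * (s1 + 1))"
    have pos: "\<gamma> > 0" "\<gamma> \<le> 1" "p > 0" "\<eta> > 0" using r c1 J_pos s10 by (auto simp: \<gamma>_def p_def \<eta>_def)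
    obtain M where M: "M \<ge> 0" "\<And>b. cmod (phi b - of_real (exp (- J * b\<^sup>2 / 2))) \<le> \<eta> * b\<^sup>2 + M * b^4"
      using phi_expansion[OF pos(4)] by blast
    obtain k0 where k0: "\<And>k t w. k \<ge> k0 \<Longrightarrow> t \<in> K \<Longrightarrow> norm w \<le> B' \<Longrightarrow>
       measure (P t) {\<omega>. \<bar>(\<Sum>j<k. J * (w \<bullet> Sd t (\<omega> j))\<^sup>2) / real k - w \<bullet> (I t *v w)\<bar> > \<gamma>} \<le> p"
      using variance_concentration[OF K pos(3) pos(1) B'(2)] by blast
    have "(\<lambda>k. c1 * (M * A' / real k)) \<longlonglongrightarrow> 0" by real_asymp
    then have "\<forall>\<^sub>F k in sequentially. c1 * (M * A' / real k) < r / 8" using r by (intro order_tendstoD(2)) auto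
    then have "\<forall>\<^sub>F k in sequentially. c1 * (M * A' / real k) < r / 8 \<and> k \<ge> k0 \<and> k \<ge> 1"
      by (intro eventually_conj eventually_ge_at_top)
    with m have "\<forall>\<^sub>F n in sequentially. c1 * (M * A' / real (m n)) < r / 8 \<and> m n \<ge> k0 \<and> m n \<ge> 1"
      by (rule eventually_compose_filterlim[rotated])
    then have "\<forall>\<^sub>F n in sequentially. cmod ((CLINT \<omega>|P (T n). iexp (w n \<bullet> ((1 / sqrt (real (m n))) *\<^sub>R (\<Sum>j<m n. score (T n) (Suc j) \<omega>))))
     - of_real (exp (- s n / 2))) < r"
    proof eventually_elim
      case (elim n)
      have "cmod ((CLINT \<omega>|P (T n). iexp (w n \<bullet> ((1 / sqrt (real (m n))) *\<^sub>R (\<Sum>j<m n. score (T n) (Suc j) \<omega>))))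
         - of_real (exp (- s n / 2))) \<le> \<gamma> + 5 * p + exp ((s n + 1) / 2) * (\<eta> * (s n + 1) / J + M * A' / real (m n))"
        by (rule cf_bound[OF TT _ s0 pos(1,2) _ M(2) _ M(1) A(2)[OF TT] A'])
           (use elim pos k0[OF _ T B'(1), of "m n" n] in \<open>auto simp: s_def\<close>)
      also have "exp ((s n + 1) / 2) * (\<eta> * (s n + 1) / J + M * A' / real (m n)) \<le> c1 * (\<eta> * (s1 + 1) / J + M * A' / real (m n))"
        unfolding c1_def using s1[of n] s0[of n] pos J_pos M A(1)
        by (intro mult_mono add_mono divide_right_mono mult_left_mono) (auto simp: A'_def intro!: add_nonneg_nonneg divide_nonneg_nonneg mult_nonneg_nonneg)
      also have "c1 * (\<eta> * (s1 + 1) / J + M * A' / real (m n)) = c1 * (\<eta> * (s1 + 1) / J) + c1 * (M * A' / real (m n))"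
        by (simp add: distrib_left)
      also have "c1 * (\<eta> * (s1 + 1) / J) = r / 8"
      proof -
        have "c1 * (r * J / (8 * c1 * q) * q / J) = r / 8" if "q > 0" for q
          using c1 J_pos that by simp
        from this[of "s1 + 1"] show ?thesis using s10 by (simp add: \<eta>_def)
      qed
      finally have "cmod ((CLINT \<omega>|P (T n). iexp (w n \<bullet> ((1 / sqrt (real (m n))) *\<^sub>R (\<Sum>j<m n. score (T n) (Suc j) \<omega>))))
         - of_real (exp (- s n / 2))) \<le> \<gamma> + 5 * p + (r / 8 + c1 * (M * A' / real (m n)))" by simp
      moreover have "\<gamma> \<le> r / 8" "5 * p = r / 8" by (simp_all add: \<gamma>_def p_def)
      ultimately show ?case using elim r by linarith
    qed
    then show "\<exists>no. \<forall>n\<ge>no. cmod ((CLINT \<omega>|P (T n). iexp (w n \<bullet> ((1 / sqrt (real (m n))) *\<^sub>R (\<Sum>j<m n. score (T n) (Suc j) \<omega>))))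
     - of_real (exp (- (w n \<bullet> (I (T n) *v w n)) / 2)) - 0) < r"
      by (auto simp: eventually_sequentially s_def)
  qed
qed

end

section \<open>The one-step correction\<close>

context ar_model
begin

text \<open>The bound $R_3$ is not known to be measurable, so the averages need a measurable substitute: the
  supremum of the Taylor quotients over a countable dense set of parameters.\<close>
lemma taylor_envelope:
  "\<exists>C>0. \<forall>t\<in>\<Theta>. \<exists>G :: real \<Rightarrow> real \<Rightarrow> real. (\<forall>x x'. G x x' \<ge> 0) \<and>
     (\<lambda>(x, x'). G x x') \<in> borel_measurable (borel \<Otimes>\<^sub>M borel) \<and>
     (\<forall>u\<in>\<Theta>. \<forall>x x'. norm (ldot S g u x x' - ldot S g t x x' - lddot S g t x x' *v (u - t)) \<le> G x x' * (norm (u - t))\<^sup>2) \<and>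
     (\<forall>j. (\<integral>\<^sup>+\<omega>. ennreal ((G (\<omega> j) (\<omega> (Suc j)))\<^sup>2) \<partial>P t) \<le> ennreal C)"
proof -
  obtain R3 C where R: "\<And>t x x'. t \<in> \<Theta> \<Longrightarrow> norm (l3dot S g t x x') \<le> R3 x x'"
    and C: "\<And>t j. t \<in> \<Theta> \<Longrightarrow> 1 \<le> j \<Longrightarrow> (\<integral>\<^sup>+\<omega>. ennreal (\<bar>R3 (\<omega> (j - 1)) (\<omega> j)\<bar>\<^sup>2) \<partial>P t) < ennreal C"
    using R3_bounds by blast
  obtain D :: "(real^'d) set" where D: "countable D" "\<And>X. open X \<Longrightarrow> X \<noteq> {} \<Longrightarrow> \<exists>d\<in>D. d \<in> X"
    using countable_dense_exists by blast
  define D' where "D' = D \<inter> \<Theta>"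
  have D'c: "countable D'" and D'ne: "D' \<noteq> {}" using D(1) D(2)[OF open_Theta Theta_ne] by (auto simp: D'_def)
  have "\<exists>G :: real \<Rightarrow> real \<Rightarrow> real. (\<forall>x x'. G x x' \<ge> 0) \<and>
     (\<lambda>(x, x'). G x x') \<in> borel_measurable (borel \<Otimes>\<^sub>M borel) \<and>
     (\<forall>u\<in>\<Theta>. \<forall>x x'. norm (ldot S g u x x' - ldot S g t x x' - lddot S g t x x' *v (u - t)) \<le> G x x' * (norm (u - t))\<^sup>2) \<and>
     (\<forall>j. (\<integral>\<^sup>+\<omega>. ennreal ((G (\<omega> j) (\<omega> (Suc j)))\<^sup>2) \<partial>P t) \<le> ennreal (max C 1))" if t: "t \<in> \<Theta>" for t
  proof -
    define r where "r u x x' = norm (ldot S g u x x' - ldot S g t x x' - lddot S g t x x' *v (u - t))" for u x x'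
    define q where "q u x x' = r u x x' / (norm (u - t))\<^sup>2" for u x x'
    define G where "G x x' = (SUP u\<in>D'. q u x x')" for x x'
    have R0: "R3 x x' \<ge> 0" for x x' using R[OF t] norm_ge_zero order_trans by blast
    have r_le: "r u x x' \<le> R3 x x' * (norm (u - t))\<^sup>2" if "u \<in> \<Theta>" for u x x'
      unfolding r_def by (rule ldot_taylor[where S = S, OF open_Theta S_C3 g_pos g_C3 convex_Theta t that R])
    have q_le: "q u x x' \<le> R3 x x'" if "u \<in> \<Theta>" for u x x'
    proof (cases "u = t")
      case False
      then show ?thesis using r_le[OF that, of x x'] by (simp add: q_def divide_le_eq)
    qed (simp add: q_def R0)
    have q0: "q u x x' \<ge> 0" for u x x' by (simp add: q_def r_def)
    have bdd: "bdd_above ((\<lambda>u. q u x x') ` D')" for x x'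
      by (rule bdd_aboveI2[of _ _ "R3 x x'"]) (auto simp: D'_def q_le)
    have G_le: "G x x' \<le> R3 x x'" for x x'
      unfolding G_def by (rule cSUP_least[OF D'ne]) (auto simp: D'_def q_le)
    have G_up: "q u x x' \<le> G x x'" if "u \<in> D'" for u x x'
      unfolding G_def by (rule cSUP_upper[OF that bdd])
    have G0: "G x x' \<ge> 0" for x x' using D'ne G_up q0 order_trans by blast
    have mq: "(\<lambda>z. q u (fst z) (snd z)) \<in> borel_measurable (borel \<Otimes>\<^sub>M borel)" for u
    proof -
      have [measurable]: "(\<lambda>z. ldot S g u (fst z) (snd z)) \<in> borel_measurable (borel \<Otimes>\<^sub>M borel)" for u
        by (rule measurable_ldot) simp_all
      have [measurable]: "(\<lambda>z. lddot S g t (fst z) (snd z)) \<in> borel_measurable (borel \<Otimes>\<^sub>M borel)"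
        by (rule measurable_lddot[OF t]) simp_all
      show ?thesis unfolding q_def r_def by measurable
    qed
    have mG: "(\<lambda>(x, x'). G x x') \<in> borel_measurable (borel \<Otimes>\<^sub>M borel)"
      unfolding case_prod_beta' G_def by (rule borel_measurable_cSUP[OF D'c mq bdd])
    have r_G: "r u x x' \<le> G x x' * (norm (u - t))\<^sup>2" if u: "u \<in> \<Theta>" for u x x'
    proof (cases "u = t")
      case True then show ?thesis by (simp add: r_def)
    next
      case False
      have "q u x x' \<le> G x x'"
      proof (rule ccontr)
        assume "\<not> q u x x' \<le> G x x'"
        then have gt: "G x x' < q u x x'" by simp
        have c1: "isCont (\<lambda>u. ldot S g u x x') u"
          using has_derivative_continuous[OF ldot_has_derivative[OF u]] .
        have "isCont (\<lambda>u. lddot S g t x x' *v (u - t)) u"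
          unfolding matrix_vector_mult_diff_distrib
          by (intro continuous_diff continuous_const linear_continuous_at)
             (simp add: linear_conv_bounded_linear[symmetric])
        then have "isCont (\<lambda>u. r u x x') u" unfolding r_def using c1 by (intro continuous_intros)
        then have "isCont (\<lambda>u. q u x x') u" unfolding q_def using False by (intro continuous_intros) auto
        then have "((\<lambda>u. q u x x') \<longlongrightarrow> q u x x') (nhds u)"
          unfolding isCont_def tendsto_at_iff_tendsto_nhds[of "\<lambda>u. q u x x'" u] .
        from order_tendstoD(1)[OF this gt]
        obtain N where N: "open N" "u \<in> N" "\<And>v. v \<in> N \<Longrightarrow> G x x' < q v x x'" by (auto simp: eventually_nhds)
        have "open (N \<inter> \<Theta>)" "N \<inter> \<Theta> \<noteq> {}" using N(1,2) open_Theta u by auto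
        from D(2)[OF this] obtain d where "d \<in> D'" "d \<in> N" by (auto simp: D'_def)
        with N(3)[of d] G_up[of d x x'] show False by simp
      qed
      then show ?thesis using False by (simp add: q_def divide_le_eq)
    qed
    have "(\<integral>\<^sup>+\<omega>. ennreal ((G (\<omega> j) (\<omega> (Suc j)))\<^sup>2) \<partial>P t) \<le> ennreal (max C 1)" for j
    proof -
      have "(\<integral>\<^sup>+\<omega>. ennreal ((G (\<omega> j) (\<omega> (Suc j)))\<^sup>2) \<partial>P t) \<le> (\<integral>\<^sup>+\<omega>. ennreal (\<bar>R3 (\<omega> (Suc j - 1)) (\<omega> (Suc j))\<bar>\<^sup>2) \<partial>P t)"
        using G0 G_le by (intro nn_integral_mono ennreal_leI power_mono) (auto intro: order_trans[OF _ abs_ge_self])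
      also have "\<dots> \<le> ennreal (max C 1)"
        using C[OF t, of "Suc j"] by (intro order_trans[OF less_imp_le ennreal_leI]) auto
      finally show ?thesis .
    qed
    then show ?thesis using G0 mG r_G unfolding r_def by blast
  qed
  then show ?thesis by (intro exI[of _ "max C 1"]) auto
qed

abbreviation "Iinv t \<equiv> matrix_inv (I t)"
abbreviation "Dl k t \<omega> \<equiv> (1 / sqrt (real k)) *\<^sub>R (\<Sum>j<k. score t (Suc j) \<omega>)"
abbreviation "Hs k t \<omega> \<equiv> (1 / sqrt (real k)) *\<^sub>R (\<Sum>j<k. hess t (Suc j) \<omega> + I t)"

lemma Delta_eq: "Delta S g k t \<omega> = Dl k t \<omega>"
  by (simp add: Delta_def sum.atLeast1_atMost_eq)

lemma fisher_symmetric: "transpose (I t) = I t"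
  by (simp add: fisher_def transpose_def vec_eq_iff mult.commute)

lemma fisher_inverse:
  obtains c where "c > 0"
    "\<And>t w. t \<in> \<Theta> \<Longrightarrow> I t *v (Iinv t *v w) = w" "\<And>t w. t \<in> \<Theta> \<Longrightarrow> Iinv t *v (I t *v w) = w"
    "\<And>t w. t \<in> \<Theta> \<Longrightarrow> norm (Iinv t *v w) \<le> norm w / c"
    "\<And>t w. t \<in> \<Theta> \<Longrightarrow> 0 \<le> w \<bullet> (Iinv t *v w)" "\<And>t w. t \<in> \<Theta> \<Longrightarrow> w \<bullet> (Iinv t *v w) \<le> 1 / c * (norm w)\<^sup>2"
proof -
  obtain c where c: "c > 0" "\<And>t v. t \<in> \<Theta> \<Longrightarrow> norm v = 1 \<Longrightarrow> c \<le> v \<bullet> (I t *v v)"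
    by (rule fisher_form_bounds) blast
  show ?thesis by (rule that[of c]) (use c coercive_matrix_inv[OF c(1)] in blast)+
qed

lemma Iinv_lipschitz:
  obtains L where "L \<ge> 0" "\<And>t u w. t \<in> \<Theta> \<Longrightarrow> u \<in> \<Theta> \<Longrightarrow> norm (Iinv u *v w - Iinv t *v w) \<le> L * norm (u - t) * norm w"
proof -
  obtain c where c: "c > 0" and inv1: "\<And>t w. t \<in> \<Theta> \<Longrightarrow> I t *v (Iinv t *v w) = w"
    and inv2: "\<And>t w. t \<in> \<Theta> \<Longrightarrow> Iinv t *v (I t *v w) = w" and inv3: "\<And>t w. t \<in> \<Theta> \<Longrightarrow> norm (Iinv t *v w) \<le> norm w / c"
    by (rule fisher_inverse) blast
  obtain L where L: "\<And>t u. t \<in> \<Theta> \<Longrightarrow> u \<in> \<Theta> \<Longrightarrow> norm (I t - I u) \<le> L * norm (t - u)"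
    using R5_Lip by blast
  have L': "norm (I t - I u) \<le> max L 0 * norm (t - u)" if "t \<in> \<Theta>" "u \<in> \<Theta>" for t u
    by (rule order_trans[OF L[OF that] mult_right_mono]) auto
  show ?thesis
  proof (rule that[of "max L 0 / c\<^sup>2"])
    fix t u w assume t: "t \<in> \<Theta>" and u: "u \<in> \<Theta>"
    have "Iinv u *v w - Iinv t *v w = Iinv u *v ((I t - I u) *v (Iinv t *v w))"
      by (rule matrix_inv_diff) (simp_all add: inv1 inv2 t u)
    then have "norm (Iinv u *v w - Iinv t *v w) = norm (Iinv u *v ((I t - I u) *v (Iinv t *v w)))" by simp
    also have "\<dots> \<le> norm ((I t - I u) *v (Iinv t *v w)) / c" by (rule inv3[OF u])
    also have "\<dots> \<le> (max L 0 * norm (t - u)) * (norm w / c) / c"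
      using c by (intro divide_right_mono order_trans[OF norm_matrix_vector_mult_le] mult_mono L' t u inv3) auto
    finally show "norm (Iinv u *v w - Iinv t *v w) \<le> max L 0 / c\<^sup>2 * norm (u - t) * norm w"
      by (simp add: norm_minus_commute power2_eq_square)
  qed simp
qed

lemma one_step_linearization:
  obtains C1 where "C1 > 0" "\<And>t u k \<omega> Gb. t \<in> \<Theta> \<Longrightarrow> u \<in> \<Theta> \<Longrightarrow> k > 0 \<Longrightarrow> Gb \<ge> 0 \<Longrightarrow>
     norm (\<Sum>j<k. score u (Suc j) \<omega> - score t (Suc j) \<omega> - hess t (Suc j) \<omega> *v (u - t)) \<le> real k * Gb * (norm (u - t))\<^sup>2 \<Longrightarrow>
     norm (sqrt (real k) *\<^sub>R (one_step P S g k u \<omega> - t) - Iinv t *v Dl k t \<omega>)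
       \<le> C1 * (norm (Dl k t \<omega>) + norm (Hs k t \<omega>) + 1 + Gb) * (norm (u - t) + sqrt (real k) * (norm (u - t))\<^sup>2)"
proof -
  obtain c where c: "c > 0" and inv1: "\<And>t w. t \<in> \<Theta> \<Longrightarrow> I t *v (Iinv t *v w) = w"
    and inv2: "\<And>t w. t \<in> \<Theta> \<Longrightarrow> Iinv t *v (I t *v w) = w" and inv3: "\<And>t w. t \<in> \<Theta> \<Longrightarrow> norm (Iinv t *v w) \<le> norm w / c"
    by (rule fisher_inverse) blast
  obtain L1 where L1: "L1 \<ge> 0" "\<And>t u w. t \<in> \<Theta> \<Longrightarrow> u \<in> \<Theta> \<Longrightarrow> norm (Iinv u *v w - Iinv t *v w) \<le> L1 * norm (u - t) * norm w"
    by (rule Iinv_lipschitz) blast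
  obtain L0 where L0: "\<And>t u. t \<in> \<Theta> \<Longrightarrow> u \<in> \<Theta> \<Longrightarrow> norm (I t - I u) \<le> L0 * norm (t - u)"
    using R5_Lip by blast
  define L where "L = max L0 0"
  have L: "L \<ge> 0" "\<And>t u. t \<in> \<Theta> \<Longrightarrow> u \<in> \<Theta> \<Longrightarrow> norm (I t - I u) \<le> L * norm (t - u)"
    unfolding L_def by (simp, rule order_trans[OF L0 mult_right_mono]) auto
  define C1 where "C1 = L1 + (L + 1) / c"
  have C1: "C1 > 0" using L1 L c by (auto simp: C1_def intro!: add_nonneg_pos)
  have Cs: "L1 \<le> C1" "L / c \<le> C1" "1 / c \<le> C1" using L1 L c by (auto simp: C1_def add_divide_distrib)
  show ?thesis
  proof (rule that[OF C1])
    fix t u k \<omega> and Gb :: real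
    assume t: "t \<in> \<Theta>" and u: "u \<in> \<Theta>" and k: "k > (0::nat)" and Gb: "Gb \<ge> 0"
      and rem: "norm (\<Sum>j<k. score u (Suc j) \<omega> - score t (Suc j) \<omega> - hess t (Suc j) \<omega> *v (u - t)) \<le> real k * Gb * (norm (u - t))\<^sup>2"
    define r where "r = sqrt (real k)"
    have r: "r > 0" "r * r = real k" using k by (auto simp: r_def)
    have rr: "real k / r = r" "r / real k = 1 / r" unfolding r(2)[symmetric] using r(1) by simp_all
    define h where "h = u - t"
    define D where "D = Dl k t \<omega>"
    define H where "H = Hs k t \<omega>"
    define \<rho> where "\<rho> = (1 / r) *\<^sub>R (\<Sum>j<k. score u (Suc j) \<omega> - score t (Suc j) \<omega> - hess t (Suc j) \<omega> *v h)"
    have lin: "(\<Sum>j<k. F j) *v v = (\<Sum>j<k. F j *v v)" for F :: "nat \<Rightarrow> real^'d^'d" and v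
      by (induction k) (simp_all add: matrix_vector_mult_add_rdistrib)
    have "r *\<^sub>R (H *v h) = (\<Sum>j<k. hess t (Suc j) \<omega> *v h) + real k *\<^sub>R (I t *v h)"
      unfolding H_def scaleR_matrix_vector_assoc[symmetric] r_def[symmetric] lin
      using r by (simp add: matrix_vector_mult_add_rdistrib sum.distrib scaleR_right_distrib sum_constant_scaleR del: sum_constant)
    then have "(\<Sum>j<k. hess t (Suc j) \<omega> *v h) = r *\<^sub>R (H *v h) - (r * r) *\<^sub>R (I t *v h)" by (simp add: r)
    then have "(1 / r) *\<^sub>R (\<Sum>j<k. hess t (Suc j) \<omega> *v h) = H *v h - r *\<^sub>R (I t *v h)"
      using r rr by (simp add: scaleR_diff_right)
    moreover have "\<rho> = Dl k u \<omega> - D - (1 / r) *\<^sub>R (\<Sum>j<k. hess t (Suc j) \<omega> *v h)"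
      unfolding \<rho>_def D_def r_def by (simp add: sum_subtractf scaleR_diff_right)
    ultimately have Du: "Dl k u \<omega> = D + H *v h - r *\<^sub>R (I t *v h) + \<rho>" by simp
    have "norm \<rho> \<le> (1 / r) * (real k * Gb * (norm h)\<^sup>2)"
      unfolding \<rho>_def using rem r by (simp add: h_def divide_right_mono)
    also have "\<dots> = r * Gb * (norm h)\<^sup>2" using r by (simp add: r(2)[symmetric])
    finally have \<rho>: "norm \<rho> \<le> r * Gb * (norm h)\<^sup>2" .
    have rh: "r *\<^sub>R h = Iinv u *v (r *\<^sub>R (I u *v h))"
      by (simp add: matrix_vector_mult_scaleR inv2[OF u])
    have "r *\<^sub>R (one_step P S g k u \<omega> - t) - Iinv t *v D = r *\<^sub>R h + Iinv u *v Dl k u \<omega> - Iinv t *v D"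
      unfolding one_step_def Delta_eq r_def[symmetric] using r rr by (simp add: h_def algebra_simps)
    also have "\<dots> = (Iinv u *v D - Iinv t *v D) + Iinv u *v (r *\<^sub>R ((I u - I t) *v h) + H *v h + \<rho>)"
      unfolding Du by (subst rh) (simp add: matrix_vector_right_distrib matrix_vector_mult_diff_distrib matrix_vector_mult_diff_rdistrib scaleR_diff_right)
    finally have eq: "r *\<^sub>R (one_step P S g k u \<omega> - t) - Iinv t *v D = \<dots>" .
    define M where "M = norm D + norm H + 1 + Gb"
    define x where "x = norm h + r * (norm h)\<^sup>2"
    have n0: "norm D \<ge> 0" "norm H \<ge> 0" "norm h \<ge> 0" "r * (norm h)\<^sup>2 \<ge> 0" using r by auto
    have "norm (r *\<^sub>R ((I u - I t) *v h) + H *v h + \<rho>) \<le> r * (L * norm h * norm h) + norm H * norm h + r * Gb * (norm h)\<^sup>2"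
    proof (intro norm_triangle_mono \<rho> norm_matrix_vector_mult_le)
      have "norm ((I u - I t) *v h) \<le> L * norm h * norm h"
        unfolding h_def by (intro order_trans[OF norm_matrix_vector_mult_le] mult_right_mono L(2) t u) simp
      then show "norm (r *\<^sub>R ((I u - I t) *v h)) \<le> r * (L * norm h * norm h)" using r by simp
    qed
    then have "norm (Iinv u *v (r *\<^sub>R ((I u - I t) *v h) + H *v h + \<rho>)) \<le> (r * (L * norm h * norm h) + norm H * norm h + r * Gb * (norm h)\<^sup>2) / c"
      using c by (intro order_trans[OF inv3[OF u]] divide_right_mono) auto
    moreover have "norm (Iinv u *v D - Iinv t *v D) \<le> L1 * norm h * norm D" unfolding h_def by (rule L1(2)[OF t u])
    ultimately have "norm (r *\<^sub>R (one_step P S g k u \<omega> - t) - Iinv t *v D)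
      \<le> L1 * norm h * norm D + (r * (L * norm h * norm h) + norm H * norm h + r * Gb * (norm h)\<^sup>2) / c"
      unfolding eq by (rule norm_triangle_mono[rotated])
    also have "\<dots> = L1 * (norm D * norm h) + L / c * (r * (norm h)\<^sup>2) + 1 / c * (norm H * norm h) + 1 / c * (Gb * (r * (norm h)\<^sup>2))"
      by (simp add: add_divide_distrib power2_eq_square mult_ac)
    also have "\<dots> \<le> C1 * (norm D * x) + C1 * (1 * x) + C1 * (norm H * x) + C1 * (Gb * x)"
    proof -
      have x: "norm h \<le> x" "r * (norm h)\<^sup>2 \<le> x" "x \<ge> 0" using n0 by (auto simp: x_def)
      have "L1 * (norm D * norm h) \<le> C1 * (norm D * x)"
        using Cs(1) C1 n0 x by (intro mult_mono mult_left_mono) auto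
      moreover have "L / c * (r * (norm h)\<^sup>2) \<le> C1 * (1 * x)"
        unfolding mult_1 by (rule mult_mono) (use Cs(2) C1 n0 x in auto)
      moreover have "1 / c * (norm H * norm h) \<le> C1 * (norm H * x)"
        using Cs(3) C1 n0 x by (intro mult_mono[of "1 / c"] mult_left_mono) auto
      moreover have "1 / c * (Gb * (r * (norm h)\<^sup>2)) \<le> C1 * (Gb * x)"
        by (rule mult_mono[OF Cs(3) mult_left_mono]) (use C1 n0 x Gb in auto)
      ultimately show ?thesis by linarith
    qed
    also have "\<dots> = C1 * M * x" by (simp add: M_def algebra_simps)
    finally show "norm (sqrt (real k) *\<^sub>R (one_step P S g k u \<omega> - t) - Iinv t *v Dl k t \<omega>)
       \<le> C1 * (norm (Dl k t \<omega>) + norm (Hs k t \<omega>) + 1 + Gb) * (norm (u - t) + sqrt (real k) * (norm (u - t))\<^sup>2)"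
      unfolding r_def D_def H_def h_def x_def M_def .
  qed
qed

lemma envelope_tail:
  assumes t: "t \<in> \<Theta>" and G0: "\<And>x x'. G x x' \<ge> (0::real)"
    and mG: "(\<lambda>(x, x'). G x x') \<in> borel_measurable (borel \<Otimes>\<^sub>M borel)"
    and C: "\<And>j. (\<integral>\<^sup>+\<omega>. ennreal ((G (\<omega> j) (\<omega> (Suc j)))\<^sup>2) \<partial>P t) \<le> ennreal C" and "C \<ge> 0" and k: "k > 0" and K: "K > 0"
  shows "measure (P t) {\<omega>. (\<Sum>j<k. G (\<omega> j) (\<omega> (Suc j))) / real k > K} \<le> (1 + C) / K"
proof -
  interpret prob_space "P t" by (rule P_prob[OF t])
  have m [measurable]: "(\<lambda>\<omega>. G (\<omega> j) (\<omega> (Suc j))) \<in> borel_measurable (P t)" for j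
    unfolding measurable_P[OF t] by (rule measurable_transition(1)[OF t mG])
  have i2: "integrable (P t) (\<lambda>\<omega>. (G (\<omega> j) (\<omega> (Suc j)))\<^sup>2)" for j
    using C[of j] by (intro integrableI_bounded) (auto simp: le_less_trans)
  have i1: "integrable (P t) (\<lambda>\<omega>. G (\<omega> j) (\<omega> (Suc j)))" for j
    by (rule integrable_of_square[OF _ m i2]) unfold_locales
  have e: "(\<integral>\<omega>. G (\<omega> j) (\<omega> (Suc j)) \<partial>P t) \<le> 1 + C" for j
  proof -
    have "ennreal (\<integral>\<omega>. (G (\<omega> j) (\<omega> (Suc j)))\<^sup>2 \<partial>P t) \<le> ennreal C"
      using C[of j] by (subst (asm) nn_integral_eq_integral[OF i2]) auto
    then have le: "(\<integral>\<omega>. (G (\<omega> j) (\<omega> (Suc j)))\<^sup>2 \<partial>P t) \<le> C" using \<open>C \<ge> 0\<close> by (simp add: ennreal_le_iff)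
    have "y \<le> 1 + y\<^sup>2" for y :: real
    proof -
      have "0 \<le> (y - 1/2)\<^sup>2" by simp
      then show ?thesis by (simp add: power2_eq_square algebra_simps)
    qed
    then have "(\<integral>\<omega>. G (\<omega> j) (\<omega> (Suc j)) \<partial>P t) \<le> (\<integral>\<omega>. 1 + (G (\<omega> j) (\<omega> (Suc j)))\<^sup>2 \<partial>P t)"
      using i1 i2 by (intro integral_mono) auto
    then show ?thesis using le i2 by (simp add: prob_space)
  qed
  let ?Y = "\<lambda>\<omega>. (\<Sum>j<k. G (\<omega> j) (\<omega> (Suc j))) / real k"
  have iY: "integrable (P t) ?Y" using i1 by simp
  have "measure (P t) {\<omega>. ?Y \<omega> > K} \<le> measure (P t) {\<omega> \<in> space (P t). ?Y \<omega> \<ge> K}"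
  proof (rule finite_measure_mono)
    show "{\<omega> \<in> space (P t). ?Y \<omega> \<ge> K} \<in> events" by measurable
  qed (auto simp: space_P[OF t])
  also have "\<dots> \<le> (\<integral>\<omega>. ?Y \<omega> \<partial>P t) / K"
    by (rule integral_Markov_inequality_measure[OF iY, of "{}"]) (use K G0 in \<open>auto intro!: divide_nonneg_nonneg sum_nonneg\<close>)
  also have "\<dots> \<le> (1 + C) / K"
  proof (intro divide_right_mono)
    have "(\<integral>\<omega>. ?Y \<omega> \<partial>P t) = (\<Sum>j<k. (\<integral>\<omega>. G (\<omega> j) (\<omega> (Suc j)) \<partial>P t)) / real k" using i1 by simp
    also have "\<dots> \<le> (\<Sum>j<k. 1 + C) / real k" by (intro divide_right_mono sum_mono e) simp
    also have "\<dots> = 1 + C" using k by simp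
    finally show "(\<integral>\<omega>. ?Y \<omega> \<partial>P t) \<le> 1 + C" .
  qed (use K in simp)
  finally show ?thesis .
qed

end

section \<open>The two-step estimator\<close>

locale ar_estimator = ar_model \<Theta> S g P
  for \<Theta> :: "(real^'d) set" and S g P +
  fixes pre :: "nat \<Rightarrow> (nat \<Rightarrow> real) \<Rightarrow> real^'d" and \<delta> :: real
  assumes pre_meas: "\<And>N. pre N \<in> borel_measurable path_space"
    and pre_in: "\<And>N \<omega>. pre N \<omega> \<in> \<Theta>"
    and pre_tight: "unif_tight \<Theta> P (\<lambda>N t \<omega>. sqrt (real N) *\<^sub>R (pre N \<omega> - t))"
    and delta: "1/4 < \<delta>"
begin

abbreviation "est s n \<equiv> theta_ss P S g pre \<delta> s n"

lemma measurable_one_step: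
  assumes [measurable]: "f \<in> borel_measurable path_space"
  shows "(\<lambda>\<omega>. one_step P S g k (f \<omega>) \<omega>) \<in> borel_measurable path_space"
proof -
  have [measurable]: "(\<lambda>\<omega>. ldot S g (f \<omega>) (\<omega> (j - 1)) (\<omega> j)) \<in> borel_measurable path_space" for j
    by (rule measurable_ldot) measurable
  have D [measurable]: "(\<lambda>\<omega>. Delta S g k (f \<omega>) \<omega>) \<in> borel_measurable path_space"
    unfolding Delta_def by measurable
  have "(\<lambda>\<omega>. I (f \<omega>)) \<in> borel_measurable path_space"
    by (rule measurable_compose[OF assms meas_fisher])
  from borel_measurable_matrix_inv[OF this D]
  have [measurable]: "(\<lambda>\<omega>. Iinv (f \<omega>) *v Delta S g k (f \<omega>) \<omega>) \<in> borel_measurable path_space" .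
  show ?thesis unfolding one_step_def by measurable
qed

lemma measurable_est [measurable]: "est s n \<in> borel_measurable path_space"
  unfolding theta_ss_def[abs_def] theta_k2_def
  by (intro measurable_one_step pre_meas)

lemma Nn_lower: "n > 0 \<Longrightarrow> real n powr \<delta> / 2 \<le> real (Nn \<delta> n)"
proof -
  assume n: "n > 0"
  have "real n powr \<delta> \<ge> 1" using n delta by (intro ge_one_powr_ge_zero) auto
  then have "\<lfloor>real n powr \<delta>\<rfloor> \<ge> 1" by linarith
  then have "real (Nn \<delta> n) = of_int \<lfloor>real n powr \<delta>\<rfloor>" by (simp add: Nn_def)
  moreover have "real n powr \<delta> < of_int \<lfloor>real n powr \<delta>\<rfloor> + 1" by linarith
  moreover have "1 \<le> real_of_int \<lfloor>real n powr \<delta>\<rfloor>" using \<open>\<lfloor>real n powr \<delta>\<rfloor> \<ge> 1\<close> by linarith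
  ultimately show ?thesis by linarith
qed

lemma Nn_at_top: "filterlim (\<lambda>n. real (Nn \<delta> n)) at_top sequentially"
proof (rule filterlim_at_top_mono)
  show "filterlim (\<lambda>n. real n powr \<delta> / 2) at_top sequentially" using delta by real_asymp
  show "\<forall>\<^sub>F n in sequentially. real n powr \<delta> / 2 \<le> real (Nn \<delta> n)"
    using eventually_gt_at_top[of 0] by eventually_elim (rule Nn_lower)
qed

lemma kk_at_top: "0 < s \<Longrightarrow> filterlim (kk s) at_top sequentially"
proof -
  assume s: "0 < s"
  have "filterlim (\<lambda>n. s * real n - 1) at_top sequentially" using s by real_asymp
  then have "filterlim (\<lambda>n. real (kk s n)) at_top sequentially"
    by (rule filterlim_at_top_mono) (auto intro!: always_eventually simp: kk_def; linarith)
  then show ?thesis by (simp add: filterlim_sequentially_iff_filterlim_real)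
qed

lemma kk_le: "0 < s \<Longrightarrow> s \<le> 1 \<Longrightarrow> kk s n \<le> n"
proof -
  assume s: "0 < s" "s \<le> 1"
  have "s * real n \<le> real n" using s mult_right_mono[of s 1 "real n"] by simp
  then have "\<lfloor>s * real n\<rfloor> \<le> int n" by linarith
  then show ?thesis by (simp add: kk_def)
qed

lemma rate_tendsto_0:
  assumes s: "0 < s" "s \<le> 1"
  shows "(\<lambda>n. sqrt (sqrt (real (kk s n))) / real (Nn \<delta> n)) \<longlonglongrightarrow> 0"
proof (rule tendsto_sandwich[OF _ _ tendsto_const])
  show "(\<lambda>n. sqrt (sqrt (real n)) / (real n powr \<delta> / 2)) \<longlonglongrightarrow> 0" using delta by real_asymp
  show "\<forall>\<^sub>F n in sequentially. sqrt (sqrt (real (kk s n))) / real (Nn \<delta> n) \<le> sqrt (sqrt (real n)) / (real n powr \<delta> / 2)"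
    using eventually_gt_at_top[of 0]
  proof eventually_elim
    case (elim n)
    then show ?case using kk_le[OF s, of n] Nn_lower[of n] by (intro frac_le) auto
  qed
qed (auto intro!: always_eventually)

text \<open>The bracketed expression bounds the error of the intermediate estimator. Multiplied by
  $k^{1/4}$ it still vanishes, because $k^{1/4} / N \to 0$; this is where $\delta > 1/4$ enters.\<close>
lemma second_stage_rate:
  assumes s: "0 < s" "s \<le> 1"
  defines "r \<equiv> \<lambda>n. sqrt (real (kk s n))"
  shows "(\<lambda>n. 1 / r n * (a + b * (c / sqrt (real (Nn \<delta> n)) + r n * (c / sqrt (real (Nn \<delta> n)))\<^sup>2))) \<longlonglongrightarrow> 0" (is "?b \<longlonglongrightarrow> 0")
    and "(\<lambda>n. (1 / r n * (a + b * (c / sqrt (real (Nn \<delta> n)) + r n * (c / sqrt (real (Nn \<delta> n)))\<^sup>2)))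
       + r n * (1 / r n * (a + b * (c / sqrt (real (Nn \<delta> n)) + r n * (c / sqrt (real (Nn \<delta> n)))\<^sup>2)))\<^sup>2) \<longlonglongrightarrow> 0"
proof -
  define R where "R n = sqrt (r n)" for n
  have rtop: "filterlim r at_top sequentially"
    unfolding r_def using kk_at_top[OF s(1)]
    by (intro filterlim_compose[OF sqrt_at_top] filterlim_compose[OF filterlim_real_sequentially])
  then have Rtop: "filterlim R at_top sequentially" unfolding R_def by (rule filterlim_compose[OF sqrt_at_top])
  have r0: "r n \<ge> 0" for n by (simp add: r_def)
  have RR: "R n * R n = r n" for n by (simp add: R_def r0)
  have iR: "(\<lambda>n. 1 / R n) \<longlonglongrightarrow> 0"
    using tendsto_inverse_0_at_top[OF Rtop] by (simp add: divide_inverse)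
  have "filterlim (\<lambda>n. sqrt (real (Nn \<delta> n))) at_top sequentially"
    by (rule filterlim_compose[OF sqrt_at_top Nn_at_top])
  from tendsto_inverse_0_at_top[OF this] have iN: "(\<lambda>n. 1 / sqrt (real (Nn \<delta> n))) \<longlonglongrightarrow> 0" by (simp add: divide_inverse)
  have rate: "(\<lambda>n. R n / real (Nn \<delta> n)) \<longlonglongrightarrow> 0" using rate_tendsto_0[OF s] by (simp add: R_def r_def)
  have "(\<lambda>n. a * (1 / R n) + b * (c * ((1 / R n) * (1 / sqrt (real (Nn \<delta> n)))) + c\<^sup>2 * (R n / real (Nn \<delta> n)))) \<longlonglongrightarrow> a * 0 + b * (c * (0 * 0) + c\<^sup>2 * 0)"
    by (intro tendsto_intros iR iN rate)
  moreover have "\<forall>\<^sub>F n in sequentially. a * (1 / R n) + b * (c * ((1 / R n) * (1 / sqrt (real (Nn \<delta> n)))) + c\<^sup>2 * (R n / real (Nn \<delta> n))) = R n * ?b n"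
    using filterlim_at_top_dense[THEN iffD1, OF Rtop, rule_format, of 0]
  proof eventually_elim
    case (elim n)
    have f: "R n * (1 / r n * (a + b * (y + r n * z))) = a * (1 / R n) + b * ((1 / R n) * y + R n * z)" for y z
      unfolding RR[symmetric] using elim by (simp add: field_simps)
    show ?case unfolding f by (simp add: power_divide)
  qed
  ultimately have Rb: "(\<lambda>n. R n * ?b n) \<longlonglongrightarrow> 0" by (simp add: tendsto_cong)
  have "(\<lambda>n. (1 / R n) * (R n * ?b n)) \<longlonglongrightarrow> 0 * 0" by (intro tendsto_mult iR Rb)
  moreover have "\<forall>\<^sub>F n in sequentially. (1 / R n) * (R n * ?b n) = ?b n"
    using filterlim_at_top_dense[THEN iffD1, OF Rtop, rule_format, of 0] by eventually_elim simp
  ultimately have "?b \<longlonglongrightarrow> 0 * 0" by (rule Lim_transform_eventually)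
  then show b: "?b \<longlonglongrightarrow> 0" by (simp only: mult_zero_left)
  have "r n * (?b n)\<^sup>2 = (R n * ?b n)\<^sup>2" for n unfolding RR[symmetric] by (simp add: power2_eq_square)
  moreover have "(\<lambda>n. ?b n + (R n * ?b n)\<^sup>2) \<longlonglongrightarrow> 0 + 0\<^sup>2" by (intro tendsto_intros b Rb)
  ultimately show "(\<lambda>n. ?b n + r n * (?b n)\<^sup>2) \<longlonglongrightarrow> 0" by simp
qed

lemma compact_margin:
  assumes "compact K" "K \<subseteq> \<Theta>"
  obtains \<epsilon> where "\<epsilon> > 0" "\<And>t u. t \<in> K \<Longrightarrow> norm (u - t) < \<epsilon> \<Longrightarrow> u \<in> \<Theta>"
proof (cases "\<Theta> = UNIV \<or> K = {}")
  case True
  then show ?thesis using that[of 1] by auto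
next
  case False
  then have "setdist K (- \<Theta>) > 0"
    using assms open_Theta setdist_gt_0_compact_closed[of K "- \<Theta>"] by auto
  moreover have "u \<in> \<Theta>" if "t \<in> K" "norm (u - t) < setdist K (- \<Theta>)" for t u
  proof (rule ccontr)
    assume "u \<notin> \<Theta>"
    then have "setdist K (- \<Theta>) \<le> dist t u" using that by (intro setdist_le_dist) auto
    then show False using that by (simp add: dist_norm norm_minus_commute)
  qed
  ultimately show ?thesis by (rule that)
qed

lemma estimator_linearization:
  assumes K: "compact K" "K \<subseteq> \<Theta>" and T: "\<And>n. T n \<in> K" and s: "0 < s" "s \<le> 1"
    and \<epsilon>: "\<epsilon> > 0" and e: "e > 0"
  shows "\<forall>\<^sub>F n in sequentially. measure (P (T n)) {\<omega>. norm (sqrt (real (kk s n)) *\<^sub>R (est s n \<omega> - T n) - Iinv (T n) *v Dl (kk s n) (T n) \<omega>) > \<epsilon>} \<le> e"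
proof -
  have TT: "T n \<in> \<Theta>" for n using T K by auto
  obtain C1 where C1: "C1 > 0" "\<And>t u k \<omega> Gb. t \<in> \<Theta> \<Longrightarrow> u \<in> \<Theta> \<Longrightarrow> k > 0 \<Longrightarrow> Gb \<ge> 0 \<Longrightarrow>
     norm (\<Sum>j<k. score u (Suc j) \<omega> - score t (Suc j) \<omega> - hess t (Suc j) \<omega> *v (u - t)) \<le> real k * Gb * (norm (u - t))\<^sup>2 \<Longrightarrow>
     norm (sqrt (real k) *\<^sub>R (one_step P S g k u \<omega> - t) - Iinv t *v Dl k t \<omega>)
       \<le> C1 * (norm (Dl k t \<omega>) + norm (Hs k t \<omega>) + 1 + Gb) * (norm (u - t) + sqrt (real k) * (norm (u - t))\<^sup>2)"
    by (rule one_step_linearization) (rule that, assumption+)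
  obtain c where c: "c > 0" and inv3: "\<And>t w. t \<in> \<Theta> \<Longrightarrow> norm (Iinv t *v w) \<le> norm w / c"
    by (rule fisher_inverse) blast
  obtain Cs where Cs: "Cs > 0" "\<And>t k K. t \<in> \<Theta> \<Longrightarrow> k > 0 \<Longrightarrow> K > 0 \<Longrightarrow> measure (P t) {\<omega>. norm (Dl k t \<omega>) > K} \<le> Cs / K\<^sup>2"
    using score_tail by blast
  obtain H where H: "H > 0" "\<And>n t. t \<in> K \<Longrightarrow> measure (P t) {\<omega>. norm (Hs n t \<omega>) > H} \<le> e / 4"
    using hess_tight[OF K, of "e / 4"] e by auto
  obtain Ce where Ce: "Ce > 0" and ex: "\<forall>t\<in>\<Theta>. \<exists>G :: real \<Rightarrow> real \<Rightarrow> real. (\<forall>x x'. G x x' \<ge> 0) \<and>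
     (\<lambda>(x, x'). G x x') \<in> borel_measurable (borel \<Otimes>\<^sub>M borel) \<and>
     (\<forall>u\<in>\<Theta>. \<forall>x x'. norm (ldot S g u x x' - ldot S g t x x' - lddot S g t x x' *v (u - t)) \<le> G x x' * (norm (u - t))\<^sup>2) \<and>
     (\<forall>j. (\<integral>\<^sup>+\<omega>. ennreal ((G (\<omega> j) (\<omega> (Suc j)))\<^sup>2) \<partial>P t) \<le> ennreal Ce)"
    using taylor_envelope by (elim exE conjE)
  from bchoice[OF ex] obtain G :: "real^'d \<Rightarrow> real \<Rightarrow> real \<Rightarrow> real" where G: "\<forall>t\<in>\<Theta>. (\<forall>x x'. G t x x' \<ge> 0) \<and>
     (\<lambda>(x, x'). G t x x') \<in> borel_measurable (borel \<Otimes>\<^sub>M borel) \<and>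
     (\<forall>u\<in>\<Theta>. \<forall>x x'. norm (ldot S g u x x' - ldot S g t x x' - lddot S g t x x' *v (u - t)) \<le> G t x x' * (norm (u - t))\<^sup>2) \<and>
     (\<forall>j. (\<integral>\<^sup>+\<omega>. ennreal ((G t (\<omega> j) (\<omega> (Suc j)))\<^sup>2) \<partial>P t) \<le> ennreal Ce)" ..
  have G0: "G t x x' \<ge> 0" and mG: "(\<lambda>(x, x'). G t x x') \<in> borel_measurable (borel \<Otimes>\<^sub>M borel)"
    and rG: "u \<in> \<Theta> \<Longrightarrow> norm (ldot S g u x x' - ldot S g t x x' - lddot S g t x x' *v (u - t)) \<le> G t x x' * (norm (u - t))\<^sup>2"
    and iG: "(\<integral>\<^sup>+\<omega>. ennreal ((G t (\<omega> j) (\<omega> (Suc j)))\<^sup>2) \<partial>P t) \<le> ennreal Ce" if t: "t \<in> \<Theta>" for t u x x' j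
    using bspec[OF G t] by blast+
  define Gb where "Gb k t \<omega> = (\<Sum>j<k. G t (\<omega> j) (\<omega> (Suc j))) / real k" for k t and \<omega> :: "nat \<Rightarrow> real"
  have Gb0: "Gb k t \<omega> \<ge> 0" if "t \<in> \<Theta>" for k t \<omega> unfolding Gb_def by (intro divide_nonneg_nonneg sum_nonneg G0 that) simp
  have rem: "norm (\<Sum>j<k. score u (Suc j) \<omega> - score t (Suc j) \<omega> - hess t (Suc j) \<omega> *v (u - t)) \<le> real k * Gb k t \<omega> * (norm (u - t))\<^sup>2"
    if "t \<in> \<Theta>" "u \<in> \<Theta>" "k > 0" for t u k \<omega>
  proof -
    have "norm (\<Sum>j<k. score u (Suc j) \<omega> - score t (Suc j) \<omega> - hess t (Suc j) \<omega> *v (u - t)) \<le> (\<Sum>j<k. G t (\<omega> j) (\<omega> (Suc j)) * (norm (u - t))\<^sup>2)"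
      using rG[OF that(1,2)] by (intro order_trans[OF norm_sum] sum_mono) simp
    also have "\<dots> = real k * Gb k t \<omega> * (norm (u - t))\<^sup>2" using that(3) by (simp add: Gb_def sum_distrib_right)
    finally show ?thesis .
  qed
  obtain c2 where c2: "c2 > 0" "\<And>N t. t \<in> K \<Longrightarrow> measure (P t) {\<omega> \<in> space (P t). norm (sqrt (real N) *\<^sub>R (pre N \<omega> - t)) > c2} \<le> e / 4"
    using pre_tight K e unfolding unif_tight_def by (meson divide_pos_pos zero_less_numeral)
  define m1 where "m1 = sqrt (4 * Cs / e)"
  have m1: "m1 > 0" "Cs / m1\<^sup>2 = e / 4" using Cs e by (auto simp: m1_def field_simps)
  define m3 where "m3 = 4 * (1 + Ce) / e"
  have m3: "m3 > 0" "(1 + Ce) / m3 = e / 4" using Ce e by (auto simp: m3_def field_simps)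
  define m0 where "m0 = m1 + H + 1 + m3"
  have m0: "m0 > 0" using m1 H m3 by (simp add: m0_def)
  obtain \<epsilon>0 where \<epsilon>0: "\<epsilon>0 > 0" "\<And>t u. t \<in> K \<Longrightarrow> norm (u - t) < \<epsilon>0 \<Longrightarrow> u \<in> \<Theta>"
    using compact_margin[OF K] by blast
  define r where "r n = sqrt (real (kk s n))" for n
  define b where "b n = c2 / sqrt (real (Nn \<delta> n))" for n
  define b2 where "b2 n = 1 / r n * (m0 / c + (C1 * m0) * (b n + r n * (b n)\<^sup>2))" for n
  have lim: "b2 \<longlonglongrightarrow> 0" "(\<lambda>n. b2 n + r n * (b2 n)\<^sup>2) \<longlonglongrightarrow> 0"
    unfolding b2_def b_def r_def by (rule second_stage_rate[OF s])+
  have "\<forall>\<^sub>F n in sequentially. b2 n < \<epsilon>0" using order_tendstoD(2)[OF lim(1) \<epsilon>0(1)] .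
  moreover have "\<forall>\<^sub>F n in sequentially. b2 n + r n * (b2 n)\<^sup>2 < \<epsilon> / (C1 * m0)"
    using order_tendstoD(2)[OF lim(2)] C1 m0 \<epsilon> by simp
  moreover have "\<forall>\<^sub>F n in sequentially. kk s n > 0"
    by (rule eventually_compose_filterlim[OF eventually_gt_at_top kk_at_top[OF s(1)]])
  moreover have "\<forall>\<^sub>F n in sequentially. real (Nn \<delta> n) > 0"
    by (rule filterlim_at_top_dense[THEN iffD1, OF Nn_at_top, rule_format])
  ultimately show ?thesis
  proof eventually_elim
    case (elim n)
    define k where "k = kk s n"
    define N where "N = Nn \<delta> n"
    define t where "t = T n"
    have t: "t \<in> \<Theta>" and tK: "t \<in> K" using TT T by (auto simp: t_def)
    have k: "k > 0" and N: "real N > 0" using elim by (auto simp: k_def N_def)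
    have rk: "r n = sqrt (real k)" "r n > 0" using k by (auto simp: r_def k_def)
    interpret prob_space "P t" by (rule P_prob[OF t])
    have [measurable]: "score t (Suc j) \<in> borel_measurable (P t)" "hess t (Suc j) \<in> borel_measurable (P t)" for j
      using measurable_score[OF t, of "Suc j"] measurable_hess[OF t, of "Suc j"] by (simp_all add: measurable_P[OF t])
    have [measurable]: "(\<lambda>\<omega>. G t (\<omega> j) (\<omega> (Suc j))) \<in> borel_measurable (P t)" for j
      unfolding measurable_P[OF t] by (rule measurable_transition(1)[OF t mG[OF t]])
    have [measurable]: "pre N \<in> borel_measurable (P t)" using pre_meas by (simp add: measurable_P[OF t])
    define B1 where "B1 = {\<omega> \<in> space (P t). norm (Dl k t \<omega>) > m1}"
    define B2 where "B2 = {\<omega> \<in> space (P t). norm (Hs k t \<omega>) > H}"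
    define B3 where "B3 = {\<omega> \<in> space (P t). Gb k t \<omega> > m3}"
    define B4 where "B4 = {\<omega> \<in> space (P t). norm (sqrt (real N) *\<^sub>R (pre N \<omega> - t)) > c2}"
    have ev: "B1 \<in> events" "B2 \<in> events" "B3 \<in> events" "B4 \<in> events"
      unfolding B1_def B2_def B3_def B4_def Gb_def by measurable
    have p1: "prob B1 \<le> e / 4" using Cs(2)[OF t k m1(1)] m1(2) by (simp add: B1_def space_P[OF t])
    have p2: "prob B2 \<le> e / 4" using H(2)[OF tK, of k] by (simp add: B2_def space_P[OF t])
    have p3: "prob B3 \<le> e / 4"
      using envelope_tail[OF t G0[OF t] mG[OF t] iG[OF t] less_imp_le[OF Ce] k m3(1)] m3(2)
      by (simp add: B3_def Gb_def space_P[OF t])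
    have p4: "prob B4 \<le> e / 4" using c2(2)[OF tK, of N] by (simp add: B4_def)
    have "measure (P t) {\<omega>. norm (sqrt (real k) *\<^sub>R (est s n \<omega> - t) - Iinv t *v Dl k t \<omega>) > \<epsilon>} \<le> prob (B1 \<union> B2 \<union> (B3 \<union> B4))"
    proof (rule finite_measure_mono)
      show "{\<omega>. norm (sqrt (real k) *\<^sub>R (est s n \<omega> - t) - Iinv t *v Dl k t \<omega>) > \<epsilon>} \<subseteq> B1 \<union> B2 \<union> (B3 \<union> B4)"
      proof (rule subsetI, rule ccontr)
        fix \<omega> assume big: "\<omega> \<in> {\<omega>. norm (sqrt (real k) *\<^sub>R (est s n \<omega> - t) - Iinv t *v Dl k t \<omega>) > \<epsilon>}"
          and "\<omega> \<notin> B1 \<union> B2 \<union> (B3 \<union> B4)"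
        then have good: "norm (Dl k t \<omega>) \<le> m1" "norm (Hs k t \<omega>) \<le> H" "Gb k t \<omega> \<le> m3" "norm (sqrt (real N) *\<^sub>R (pre N \<omega> - t)) \<le> c2"
          unfolding B1_def B2_def B3_def B4_def space_P[OF t] Un_iff mem_Collect_eq by (simp_all only: not_less de_Morgan_disj UNIV_I simp_thms)
        define M where "M = norm (Dl k t \<omega>) + norm (Hs k t \<omega>) + 1 + Gb k t \<omega>"
        have M: "0 \<le> M" "M \<le> m0" using good Gb0[OF t] by (auto simp: M_def m0_def intro!: add_nonneg_nonneg)
        define u where "u = pre N \<omega>"
        have u: "u \<in> \<Theta>" by (simp add: u_def pre_in)
        have ub: "norm (u - t) \<le> b n"
        proof -
          have "sqrt (real N) * norm (u - t) \<le> c2" using good(4) unfolding norm_scaleR u_def by simp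
          then show ?thesis using N by (simp add: b_def N_def[symmetric] field_simps)
        qed
        define v where "v = one_step P S g k u \<omega>"
        have E1: "norm (r n *\<^sub>R (v - t) - Iinv t *v Dl k t \<omega>) \<le> C1 * M * (norm (u - t) + r n * (norm (u - t))\<^sup>2)"
          unfolding v_def rk(1) M_def by (rule C1(2)[OF t u k Gb0[OF t] rem[OF t u k]])
        also have "\<dots> \<le> (C1 * m0) * (b n + r n * (b n)\<^sup>2)"
          using M C1 ub rk m0 by (intro mult_mono add_mono mult_left_mono power_mono) (auto intro!: add_nonneg_nonneg mult_nonneg_nonneg)
        finally have E1': "norm (r n *\<^sub>R (v - t) - Iinv t *v Dl k t \<omega>) \<le> (C1 * m0) * (b n + r n * (b n)\<^sup>2)" .
        have "norm (Iinv t *v Dl k t \<omega>) \<le> m0 / c"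
        proof (rule order_trans[OF inv3[OF t]])
          show "norm (Dl k t \<omega>) / c \<le> m0 / c" using good(1) H m3 c by (intro divide_right_mono) (auto simp: m0_def)
        qed
        then have "norm (r n *\<^sub>R (v - t)) \<le> m0 / c + (C1 * m0) * (b n + r n * (b n)\<^sup>2)"
          using E1' norm_triangle_sub[of "r n *\<^sub>R (v - t)" "Iinv t *v Dl k t \<omega>"] by linarith
        then have "r n * norm (v - t) \<le> m0 / c + (C1 * m0) * (b n + r n * (b n)\<^sup>2)"
          unfolding norm_scaleR using rk(2) by simp
        then have vb: "norm (v - t) \<le> b2 n" using rk(2) by (simp add: b2_def pos_le_divide_eq mult.commute)
        then have v: "v \<in> \<Theta>" using \<epsilon>0(2)[OF tK, of v] elim(1) by simp
        have "norm (r n *\<^sub>R (one_step P S g k v \<omega> - t) - Iinv t *v Dl k t \<omega>) \<le> C1 * M * (norm (v - t) + r n * (norm (v - t))\<^sup>2)"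
          unfolding rk(1) M_def by (rule C1(2)[OF t v k Gb0[OF t] rem[OF t v k]])
        also have "\<dots> \<le> (C1 * m0) * (b2 n + r n * (b2 n)\<^sup>2)"
          using M C1 vb rk m0 by (intro mult_mono add_mono mult_left_mono power_mono) (auto intro!: add_nonneg_nonneg mult_nonneg_nonneg)
        also have "\<dots> \<le> \<epsilon>" using elim(2) C1 m0 by (simp add: field_simps)
        finally have "norm (sqrt (real k) *\<^sub>R (one_step P S g k v \<omega> - t) - Iinv t *v Dl k t \<omega>) \<le> \<epsilon>" by (simp only: rk(1))
        moreover have "one_step P S g k v \<omega> = est s n \<omega>"
          by (simp add: theta_ss_def theta_k2_def v_def u_def k_def N_def)
        ultimately show False using big by simp
      qed
    qed (use ev in simp)
    also have "\<dots> \<le> (prob B1 + prob B2) + (prob B3 + prob B4)"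
      using ev by (intro order_trans[OF measure_Un_le] add_mono measure_Un_le) auto
    also have "\<dots> \<le> e" using p1 p2 p3 p4 by simp
    finally show ?case by (simp add: k_def t_def)
  qed
qed


lemma fisher_Iinv: "t \<in> \<Theta> \<Longrightarrow> I t *v (Iinv t *v w) = w"
  by (rule fisher_inverse) simp

lemma Iinv_psd: "t \<in> \<Theta> \<Longrightarrow> 0 \<le> w \<bullet> (Iinv t *v w)"
  by (rule fisher_inverse) simp

lemma Iinv_symmetric: "t \<in> \<Theta> \<Longrightarrow> transpose (Iinv t) = Iinv t"
  by (rule transpose_matrix_inv_symmetric[OF fisher_symmetric fisher_Iinv])

lemma char_limit_law:
  assumes "t \<in> \<Theta>"
  shows "(CLINT x|normal_vec (Iinv t). iexp (l \<bullet> x)) = of_real (exp (- (l \<bullet> (Iinv t *v l)) / 2))"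
  by (rule char_normal_vec[OF Iinv_symmetric[OF assms] Iinv_psd[OF assms]])

lemma limit_law_tight:
  assumes "e > 0"
  shows "\<exists>R. \<forall>t\<in>\<Theta>. measure (normal_vec (Iinv t)) {x. norm x > R} \<le> e"
proof -
  obtain c where c: "c > 0" and p: "\<And>t w. t \<in> \<Theta> \<Longrightarrow> 0 \<le> w \<bullet> (Iinv t *v w)"
    and b: "\<And>t w. t \<in> \<Theta> \<Longrightarrow> w \<bullet> (Iinv t *v w) \<le> 1 / c * (norm w)\<^sup>2"
    by (rule fisher_inverse) (rule that, assumption+)
  obtain R where R: "\<And>\<Sigma>::real^'d^'d. transpose \<Sigma> = \<Sigma> \<Longrightarrow> (\<And>v. 0 \<le> v \<bullet> (\<Sigma> *v v)) \<Longrightarrow>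
     (\<And>v. v \<bullet> (\<Sigma> *v v) \<le> 1 / c * (norm v)\<^sup>2) \<Longrightarrow> measure (normal_vec \<Sigma>) {x. norm x > R} \<le> e"
    using normal_vec_tight[OF assms, of "1 / c"] by blast
  show ?thesis by (intro exI[of _ R] ballI R Iinv_symmetric p b)
qed

lemma estimator_limit:
  fixes f :: "real^'d \<Rightarrow> real"
  assumes K: "compact K" "K \<subseteq> \<Theta>" and T: "\<And>n. T n \<in> K" and s: "0 < s" "s \<le> 1"
    and f: "continuous_on UNIV f" "bounded (range f)"
  shows "(\<lambda>n. (\<integral>\<omega>. f (sqrt (real (kk s n)) *\<^sub>R (est s n \<omega> - T n)) \<partial>P (T n)) - (\<integral>x. f x \<partial>normal_vec (Iinv (T n)))) \<longlonglongrightarrow> 0"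
proof -
  have TT: "T n \<in> \<Theta>" for n using T K by auto
  obtain c where c: "c > 0" and inv1: "\<And>t w. t \<in> \<Theta> \<Longrightarrow> I t *v (Iinv t *v w) = w"
    and inv3: "\<And>t w. t \<in> \<Theta> \<Longrightarrow> norm (Iinv t *v w) \<le> norm w / c"
    by (rule fisher_inverse) (rule that, assumption+)
  define Y where "Y n \<omega> = sqrt (real (kk s n)) *\<^sub>R (est s n \<omega> - T n)" for n \<omega>
  define Z where "Z n \<omega> = Iinv (T n) *v Dl (kk s n) (T n) \<omega>" for n \<omega>
  have mY [measurable]: "Y n \<in> borel_measurable (P (T n))" for n
    unfolding Y_def measurable_P[OF TT] by measurable
  have mS [measurable]: "score (T n) (Suc j) \<in> borel_measurable (P (T n))" for n j
    using measurable_score[OF TT[of n], of "Suc j"] by (simp add: measurable_P[OF TT])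
  have mZ [measurable]: "Z n \<in> borel_measurable (P (T n))" for n
    unfolding Z_def by (intro borel_measurable_matrix_vector_mult borel_measurable_const) measurable
  have YZ: "\<forall>\<^sub>F n in sequentially. measure (P (T n)) {\<omega>. norm (Y n \<omega> - Z n \<omega>) > \<epsilon>} \<le> e" if "\<epsilon> > 0" "e > 0" for \<epsilon> e
    unfolding Y_def Z_def by (rule estimator_linearization[OF K T s that])
  have evs: "{\<omega>. norm (Y n \<omega> - Z n \<omega>) > \<epsilon>} \<in> sets (P (T n))" "{\<omega>. norm (Z n \<omega>) > \<epsilon>} \<in> sets (P (T n))" for n \<epsilon>
  proof -
    have "{\<omega> \<in> space (P (T n)). norm (Y n \<omega> - Z n \<omega>) > \<epsilon>} \<in> sets (P (T n))"
      "{\<omega> \<in> space (P (T n)). norm (Z n \<omega>) > \<epsilon>} \<in> sets (P (T n))" by measurable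
    then show "{\<omega>. norm (Y n \<omega> - Z n \<omega>) > \<epsilon>} \<in> sets (P (T n))" "{\<omega>. norm (Z n \<omega>) > \<epsilon>} \<in> sets (P (T n))"
      by (simp_all add: space_P[OF TT])
  qed
  define \<mu> where "\<mu> n = distr (P (T n)) borel (Y n)" for n
  have "(\<lambda>n. (\<integral>x. f x \<partial>\<mu> n) - (\<integral>x. f x \<partial>normal_vec (Iinv (T n)))) \<longlonglongrightarrow> 0"
  proof (rule levy_difference[OF _ _ normal_vec_prob sets_normal_vec _ _ _ f])
    show "prob_space (\<mu> n)" for n unfolding \<mu>_def by (rule prob_space.prob_space_distr[OF P_prob[OF TT] mY])
    show "sets (\<mu> n) = sets borel" for n by (simp add: \<mu>_def)
    show "\<exists>R. \<forall>\<^sub>F n in sequentially. measure (normal_vec (Iinv (T n))) {x. norm x > R} \<le> e" if "e > 0" for e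
      using limit_law_tight[OF that] TT by (auto intro!: always_eventually)
    show "\<exists>R. \<forall>\<^sub>F n in sequentially. measure (\<mu> n) {x. norm x > R} \<le> e" if e: "e > 0" for e
    proof -
      obtain Cs where Cs: "Cs > 0" "\<And>t k K. t \<in> \<Theta> \<Longrightarrow> k > 0 \<Longrightarrow> K > 0 \<Longrightarrow> measure (P t) {\<omega>. norm (Dl k t \<omega>) > K} \<le> Cs / K\<^sup>2"
        using score_tail by blast
      define K1 where "K1 = sqrt (2 * Cs / e)"
      have K1: "K1 > 0" "Cs / K1\<^sup>2 = e / 2" using Cs e by (auto simp: K1_def field_simps)
      have "\<forall>\<^sub>F n in sequentially. kk s n > 0"
        by (rule eventually_compose_filterlim[OF eventually_gt_at_top kk_at_top[OF s(1)]])
      moreover have "\<forall>\<^sub>F n in sequentially. measure (P (T n)) {\<omega>. norm (Y n \<omega> - Z n \<omega>) > 1} \<le> e / 2"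
        by (rule YZ) (use e in simp_all)
      ultimately have "\<forall>\<^sub>F n in sequentially. measure (\<mu> n) {x. norm x > K1 / c + 1} \<le> e"
      proof eventually_elim
        case (elim n)
        interpret prob_space "P (T n)" by (rule P_prob[OF TT])
        have mD: "{\<omega>. norm (Dl (kk s n) (T n) \<omega>) > K1} \<in> events"
        proof -
          have "{\<omega> \<in> space (P (T n)). norm (Dl (kk s n) (T n) \<omega>) > K1} \<in> events" by measurable
          then show ?thesis by (simp add: space_P[OF TT])
        qed
        have "measure (\<mu> n) {x. norm x > K1 / c + 1} = prob {\<omega>. norm (Y n \<omega>) > K1 / c + 1}"
          unfolding \<mu>_def by (subst measure_distr[OF mY]) (auto simp: vimage_def space_P[OF TT])
        also have "\<dots> \<le> prob ({\<omega>. norm (Dl (kk s n) (T n) \<omega>) > K1} \<union> {\<omega>. norm (Y n \<omega> - Z n \<omega>) > 1})"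
        proof (rule finite_measure_mono)
          show "{\<omega>. norm (Y n \<omega>) > K1 / c + 1} \<subseteq> {\<omega>. norm (Dl (kk s n) (T n) \<omega>) > K1} \<union> {\<omega>. norm (Y n \<omega> - Z n \<omega>) > 1}"
          proof (rule subsetI, rule ccontr)
            fix \<omega> assume big: "\<omega> \<in> {\<omega>. norm (Y n \<omega>) > K1 / c + 1}"
              and "\<omega> \<notin> {\<omega>. norm (Dl (kk s n) (T n) \<omega>) > K1} \<union> {\<omega>. norm (Y n \<omega> - Z n \<omega>) > 1}"
            then have D: "norm (Dl (kk s n) (T n) \<omega>) \<le> K1" and d: "norm (Y n \<omega> - Z n \<omega>) \<le> 1" by (simp_all add: not_less)
            have "norm (Z n \<omega>) \<le> K1 / c"
              unfolding Z_def using c D by (intro order_trans[OF inv3[OF TT]] divide_right_mono) auto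
            then have "norm (Y n \<omega>) \<le> K1 / c + 1" using d norm_triangle_sub[of "Y n \<omega>" "Z n \<omega>"] by linarith
            then show False using big by simp
          qed
        qed (use mD evs in auto)
        also have "\<dots> \<le> prob {\<omega>. norm (Dl (kk s n) (T n) \<omega>) > K1} + prob {\<omega>. norm (Y n \<omega> - Z n \<omega>) > 1}"
          by (rule measure_Un_le[OF mD evs(1)])
        also have "\<dots> \<le> e / 2 + e / 2"
          using Cs(2)[OF TT elim(1) K1(1), of n] K1(2) elim(2) by (intro add_mono) auto
        finally show ?case by simp
      qed
      then show ?thesis by blast
    qed
    show "(\<lambda>n. (CLINT x|\<mu> n. iexp (l \<bullet> x)) - (CLINT x|normal_vec (Iinv (T n)). iexp (l \<bullet> x))) \<longlonglongrightarrow> 0" for l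
    proof -
      define w where "w n = Iinv (T n) *v l" for n
      have lZ: "l \<bullet> Z n \<omega> = w n \<bullet> Dl (kk s n) (T n) \<omega>" for n \<omega>
        unfolding Z_def w_def by (rule symmetric_matrix_inner[OF Iinv_symmetric[OF TT], symmetric])
      have ww: "w n \<bullet> (I (T n) *v w n) = l \<bullet> (Iinv (T n) *v l)" for n
        unfolding w_def by (simp add: inv1[OF TT] inner_commute)
      have "(\<lambda>n. (CLINT \<omega>|P (T n). iexp (w n \<bullet> Dl (kk s n) (T n) \<omega>)) - of_real (exp (- (w n \<bullet> (I (T n) *v w n)) / 2))) \<longlonglongrightarrow> 0"
        by (rule score_cf_limit[OF K T kk_at_top[OF s(1)], of w "norm l / c"]) (simp add: w_def inv3[OF TT])
      then have 2: "(\<lambda>n. (CLINT \<omega>|P (T n). iexp (l \<bullet> Z n \<omega>)) - (CLINT x|normal_vec (Iinv (T n)). iexp (l \<bullet> x))) \<longlonglongrightarrow> 0"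
        unfolding lZ[symmetric] ww char_limit_law[OF TT] .
      have 1: "(\<lambda>n. (CLINT \<omega>|P (T n). iexp (l \<bullet> Y n \<omega>)) - (CLINT \<omega>|P (T n). iexp (l \<bullet> Z n \<omega>))) \<longlonglongrightarrow> 0"
      proof (rule LIMSEQ_I)
        fix r :: real assume r: "r > 0"
        define \<epsilon> where "\<epsilon> = r / (4 * (norm l + 1))"
        have l1: "norm l + 1 > 0" by (simp add: add_nonneg_pos)
        have \<epsilon>: "\<epsilon> > 0" unfolding \<epsilon>_def using r l1 by simp
        have l\<epsilon>: "norm l * \<epsilon> \<le> r / 4"
        proof -
          have "norm l * \<epsilon> \<le> (norm l + 1) * \<epsilon>" using \<epsilon> by (intro mult_right_mono) auto
          also have "\<dots> = r / 4" unfolding \<epsilon>_def using l1 by (simp add: field_simps)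
          finally show ?thesis .
        qed
        have "\<forall>\<^sub>F n in sequentially. measure (P (T n)) {\<omega>. norm (Y n \<omega> - Z n \<omega>) > \<epsilon>} \<le> r / 8"
          using YZ[OF \<epsilon>, of "r / 8"] r by simp
        then have "\<forall>\<^sub>F n in sequentially. norm ((CLINT \<omega>|P (T n). iexp (l \<bullet> Y n \<omega>)) - (CLINT \<omega>|P (T n). iexp (l \<bullet> Z n \<omega>)) - 0) < r"
        proof eventually_elim
          case (elim n)
          interpret prob_space "P (T n)" by (rule P_prob[OF TT])
          let ?B = "{\<omega>. norm (Y n \<omega> - Z n \<omega>) > \<epsilon>}"
          have iY: "integrable (P (T n)) (\<lambda>\<omega>. iexp (l \<bullet> Y n \<omega>))"
            by (rule integrable_const_bound[of _ 1]) auto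
          have iZ: "integrable (P (T n)) (\<lambda>\<omega>. iexp (l \<bullet> Z n \<omega>))"
            by (rule integrable_const_bound[of _ 1]) auto
          have iB: "integrable (P (T n)) (indicat_real ?B)"
            using evs by (intro integrable_real_indicator) (auto simp: less_top[symmetric])
          have "cmod ((CLINT \<omega>|P (T n). iexp (l \<bullet> Y n \<omega>)) - (CLINT \<omega>|P (T n). iexp (l \<bullet> Z n \<omega>)))
             \<le> (\<integral>\<omega>. cmod (iexp (l \<bullet> Y n \<omega>) - iexp (l \<bullet> Z n \<omega>)) \<partial>P (T n))"
            unfolding Bochner_Integration.integral_diff[OF iY iZ, symmetric] by (rule integral_norm_bound)
          also have "\<dots> \<le> (\<integral>\<omega>. r / 4 + 2 * indicator ?B \<omega> \<partial>P (T n))"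
          proof (rule integral_mono)
            fix \<omega>
            show "cmod (iexp (l \<bullet> Y n \<omega>) - iexp (l \<bullet> Z n \<omega>)) \<le> r / 4 + 2 * indicator ?B \<omega>"
            proof (cases "\<omega> \<in> ?B")
              case True
              have "cmod (iexp (l \<bullet> Y n \<omega>) - iexp (l \<bullet> Z n \<omega>)) \<le> 2"
                using norm_triangle_ineq4[of "iexp (l \<bullet> Y n \<omega>)" "iexp (l \<bullet> Z n \<omega>)"] by simp
              then show ?thesis using True r by simp
            next
              case False
              have "cmod (iexp (l \<bullet> Y n \<omega>) - iexp (l \<bullet> Z n \<omega>)) \<le> \<bar>l \<bullet> (Y n \<omega> - Z n \<omega>)\<bar>"
                unfolding inner_diff_right by (rule cmod_iexp_diff)
              also have "\<dots> \<le> norm l * norm (Y n \<omega> - Z n \<omega>)" by (rule Cauchy_Schwarz_ineq2)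
              also have "\<dots> \<le> norm l * \<epsilon>" using False by (intro mult_left_mono) auto
              finally show ?thesis using False l\<epsilon> by simp
            qed
          qed (use iY iZ iB in auto)
          also have "\<dots> = r / 4 + 2 * prob ?B" using iB evs by (simp add: prob_space)
          finally show ?case using elim r by simp
        qed
        then show "\<exists>no. \<forall>n\<ge>no. norm ((CLINT \<omega>|P (T n). iexp (l \<bullet> Y n \<omega>)) - (CLINT \<omega>|P (T n). iexp (l \<bullet> Z n \<omega>)) - 0) < r"
          by (simp add: eventually_sequentially)
      qed
      have "(CLINT x|\<mu> n. iexp (l \<bullet> x)) = (CLINT \<omega>|P (T n). iexp (l \<bullet> Y n \<omega>))" for n
        unfolding \<mu>_def by (rule integral_distr[OF mY]) simp
      then show ?thesis using tendsto_add[OF 1 2] by simp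
    qed
  qed
  moreover have "(\<integral>x. f x \<partial>\<mu> n) = (\<integral>\<omega>. f (Y n \<omega>) \<partial>P (T n))" for n
    unfolding \<mu>_def by (rule integral_distr[OF mY]) (rule borel_measurable_continuous_onI[OF f(1)])
  ultimately show ?thesis unfolding Y_def by simp
qed

lemma limit_law_continuous:
  fixes f :: "real^'d \<Rightarrow> real"
  assumes f: "continuous_on UNIV f" "bounded (range f)" and t: "t \<in> \<Theta>"
  shows "((\<lambda>u. \<integral>x. f x \<partial>normal_vec (Iinv u)) \<longlongrightarrow> (\<integral>x. f x \<partial>normal_vec (Iinv t))) (at t)"
proof -
  obtain L where L: "L \<ge> 0" "\<And>t u w. t \<in> \<Theta> \<Longrightarrow> u \<in> \<Theta> \<Longrightarrow> norm (Iinv u *v w - Iinv t *v w) \<le> L * norm (u - t) * norm w"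
    by (rule Iinv_lipschitz) (rule that, assumption+)
  have "((\<lambda>u. \<integral>x. f x \<partial>normal_vec (Iinv u)) \<longlongrightarrow> (\<integral>x. f x \<partial>normal_vec (Iinv t))) (at t within \<Theta>)"
    unfolding tendsto_at_iff_sequentially
  proof (intro allI impI)
    fix X assume X: "\<forall>i. X i \<in> \<Theta> - {t}" "X \<longlonglongrightarrow> t"
    have XT: "X i \<in> \<Theta>" for i using X by auto
    have "(\<lambda>n. (\<integral>x. f x \<partial>normal_vec (Iinv (X n))) - (\<integral>x. f x \<partial>normal_vec (Iinv t))) \<longlonglongrightarrow> 0"
    proof (rule levy_difference[OF normal_vec_prob sets_normal_vec normal_vec_prob sets_normal_vec _ _ _ f])
      show "\<exists>R. \<forall>\<^sub>F n in sequentially. measure (normal_vec (Iinv (X n))) {x. norm x > R} \<le> e" if "e > 0" for e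
        using limit_law_tight[OF that] XT by (auto intro!: always_eventually)
      show "\<exists>R. \<forall>\<^sub>F n in sequentially. measure (normal_vec (Iinv t)) {x. norm x > R} \<le> e" if "e > 0" for e
        using limit_law_tight[OF that] t by (auto intro!: always_eventually)
      fix l :: "real^'d"
      have "(\<lambda>n. l \<bullet> (Iinv (X n) *v l)) \<longlonglongrightarrow> l \<bullet> (Iinv t *v l)"
      proof (rule LIM_zero_cancel, rule Lim_null_comparison)
        show "\<forall>\<^sub>F n in sequentially. norm (l \<bullet> (Iinv (X n) *v l) - l \<bullet> (Iinv t *v l)) \<le> norm l * (L * norm (X n - t) * norm l)"
        proof (intro always_eventually allI)
          fix n
          have "\<bar>l \<bullet> (Iinv (X n) *v l) - l \<bullet> (Iinv t *v l)\<bar> \<le> norm l * norm (Iinv (X n) *v l - Iinv t *v l)"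
            unfolding inner_diff_right[symmetric] by (rule Cauchy_Schwarz_ineq2)
          also have "\<dots> \<le> norm l * (L * norm (X n - t) * norm l)" by (intro mult_left_mono L(2) t XT) simp
          finally show "norm (l \<bullet> (Iinv (X n) *v l) - l \<bullet> (Iinv t *v l)) \<le> norm l * (L * norm (X n - t) * norm l)" by simp
        qed
        have "(\<lambda>n. norm (X n - t)) \<longlonglongrightarrow> 0" using X(2) by (simp add: tendsto_norm_zero LIM_zero)
        then have "(\<lambda>n. norm l * (L * norm (X n - t) * norm l)) \<longlonglongrightarrow> norm l * (L * 0 * norm l)" by (intro tendsto_intros)
        then show "(\<lambda>n. norm l * (L * norm (X n - t) * norm l)) \<longlonglongrightarrow> 0" by simp
      qed
      from isCont_tendsto_compose[OF _ this, of "\<lambda>y. complex_of_real (exp (- y / 2)) - of_real (exp (- (l \<bullet> (Iinv t *v l)) / 2))"]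
      have "(\<lambda>n. complex_of_real (exp (- (l \<bullet> (Iinv (X n) *v l)) / 2)) - of_real (exp (- (l \<bullet> (Iinv t *v l)) / 2))) \<longlonglongrightarrow>
          of_real (exp (- (l \<bullet> (Iinv t *v l)) / 2)) - of_real (exp (- (l \<bullet> (Iinv t *v l)) / 2))"
        by simp
      then show "(\<lambda>n. (CLINT x|normal_vec (Iinv (X n)). iexp (l \<bullet> x)) - (CLINT x|normal_vec (Iinv t). iexp (l \<bullet> x))) \<longlonglongrightarrow> 0"
        unfolding char_limit_law[OF XT] char_limit_law[OF t] by simp
    qed
    then show "((\<lambda>u. \<integral>x. f x \<partial>normal_vec (Iinv u)) \<circ> X) \<longlonglongrightarrow> (\<integral>x. f x \<partial>normal_vec (Iinv t))"
      unfolding o_def by (rule LIM_zero_cancel)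
  qed
  then show ?thesis using at_within_open[OF t open_Theta] by simp
qed

lemma estimator_limit_uniform:
  fixes f :: "real^'d \<Rightarrow> real"
  assumes K: "compact K" "K \<subseteq> \<Theta>" and s: "0 < s" "s \<le> 1"
    and f: "continuous_on UNIV f" "bounded (range f)" and e: "e > 0"
  shows "\<forall>\<^sub>F n in sequentially. \<forall>t\<in>K. \<bar>(\<integral>\<omega>. f (sqrt (real (kk s n)) *\<^sub>R (est s n \<omega> - t)) \<partial>P t) - (\<integral>x. f x \<partial>normal_vec (Iinv t))\<bar> \<le> e"
proof (cases "K = {}")
  case False
  define D where "D n t = \<bar>(\<integral>\<omega>. f (sqrt (real (kk s n)) *\<^sub>R (est s n \<omega> - t)) \<partial>P t) - (\<integral>x. f x \<partial>normal_vec (Iinv t))\<bar>" for n t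
  obtain t0 where t0: "t0 \<in> K" using False by auto
  define T where "T n = (if \<exists>t\<in>K. D n t > e then SOME t. t \<in> K \<and> D n t > e else t0)" for n
  have T: "T n \<in> K \<and> ((\<exists>t\<in>K. D n t > e) \<longrightarrow> D n (T n) > e)" for n
  proof (cases "\<exists>t\<in>K. D n t > e")
    case True
    then have "\<exists>t. t \<in> K \<and> D n t > e" by blast
    from someI_ex[OF this] True show ?thesis by (simp add: T_def)
  qed (simp add: T_def t0)
  have "(\<lambda>n. D n (T n)) \<longlonglongrightarrow> 0"
    unfolding D_def by (rule tendsto_rabs_zero, rule estimator_limit[OF K _ s f]) (use T in blast)
  then have "\<forall>\<^sub>F n in sequentially. D n (T n) < e" using e by (rule order_tendstoD(2))
  then show ?thesis unfolding D_def[symmetric]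
  proof eventually_elim
    case (elim n)
    then show ?case using T[of n] by (meson not_less less_imp_le order.asym)
  qed
qed simp

end

section \<open>Asymptotic normality and efficiency\<close>

theorem theorem2:
  fixes \<Theta> :: "(real^'d) set"
    and S :: "real^'d \<Rightarrow> real \<Rightarrow> real"
    and g :: "real \<Rightarrow> real"
    and P :: "real^'d \<Rightarrow> (nat \<Rightarrow> real) measure"
    and \<pi> :: "real^'d \<Rightarrow> real \<Rightarrow> real"
    and pre :: "nat \<Rightarrow> (nat \<Rightarrow> real) \<Rightarrow> real^'d"
    and \<delta> :: real
  assumes Theta: "open \<Theta>" "convex \<Theta>" "bounded \<Theta>"
    \<comment> \<open>the model X_j = S(t, X_{j-1}) + eps_j, eps_j i.i.d. with density g, independent of X_0\<close>
    and model_prob: "\<And>t. t \<in> \<Theta> \<Longrightarrow> prob_space (P t) \<and> sets (P t) = sets path_space"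
    and model_indep: "\<And>t. t \<in> \<Theta> \<Longrightarrow> prob_space.indep_vars (P t) (\<lambda>_. borel)
              (\<lambda>j \<omega>. if j = 0 then \<omega> 0 else \<omega> j - S t (\<omega> (j - 1))) UNIV"
    and model_noise: "\<And>t j. t \<in> \<Theta> \<Longrightarrow> 1 \<le> j \<Longrightarrow>
              distributed (P t) lborel (\<lambda>\<omega>. \<omega> j - S t (\<omega> (j - 1))) (\<lambda>x. ennreal (g x))"
    \<comment> \<open>R(1): strict stationarity and unique invariant distribution with density pi\<close>
    and R1_stat: "\<And>t m. t \<in> \<Theta> \<Longrightarrow> distr (P t) path_space (\<lambda>\<omega> j. \<omega> (j + m)) = P t"
    and R1_inv: "\<And>t \<mu>. t \<in> \<Theta> \<Longrightarrow>
              invariant_distribution S g t \<mu> \<longleftrightarrow> \<mu> = density lborel (\<lambda>x. ennreal (\<pi> t x))"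
    \<comment> \<open>R(2): the preliminary estimator\<close>
    and pre_meas: "\<And>N. pre N \<in> borel_measurable path_space"
    and pre_in: "\<And>N \<omega>. pre N \<omega> \<in> \<Theta>"
    and pre_adapted: "\<And>N \<omega> \<omega>'. (\<forall>j\<le>N. \<omega> j = \<omega>' j) \<Longrightarrow> pre N \<omega> = pre N \<omega>'"
    and pre_tight: "unif_tight \<Theta> P (\<lambda>N t \<omega>. sqrt (real N) *\<^sub>R (pre N \<omega> - t))"
    \<comment> \<open>R(3): smoothness and moment bounds\<close>
    and R3_S: "\<And>x. C3_on \<Theta> (\<lambda>t. S t x)"
    and R3_g: "\<And>x. 0 < g x" "C3_real g"
    and R3_bounds: "\<exists>R1 R2 R3 C.
              (\<forall>t\<in>\<Theta>. \<forall>x x'. norm (ldot S g t x x') \<le> R1 x x'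
                          \<and> norm (lddot S g t x x') \<le> R2 x x'
                          \<and> norm (l3dot S g t x x') \<le> R3 x x') \<and>
              (\<forall>t\<in>\<Theta>. \<forall>j\<ge>1.
                  (\<integral>\<^sup>+\<omega>. ennreal (\<bar>R1 (\<omega> (j - 1)) (\<omega> j)\<bar>\<^sup>2) \<partial>P t) < ennreal C
                \<and> (\<integral>\<^sup>+\<omega>. ennreal (\<bar>R2 (\<omega> (j - 1)) (\<omega> j)\<bar>\<^sup>2) \<partial>P t) < ennreal C
                \<and> (\<integral>\<^sup>+\<omega>. ennreal (\<bar>R3 (\<omega> (j - 1)) (\<omega> j)\<bar>\<^sup>2) \<partial>P t) < ennreal C)"
    \<comment> \<open>R(4): LLN, CLT and uniform tightness\<close>
    and R4_LLN: "\<And>t. t \<in> \<Theta> \<Longrightarrow> conv_prob (P t)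
              (\<lambda>n \<omega>. (1 / real n) *\<^sub>R (\<Sum>j=1..n. (\<chi> a b. ldot S g t (\<omega> (j - 1)) (\<omega> j) $ a
                                                   * ldot S g t (\<omega> (j - 1)) (\<omega> j) $ b)))
              (fisher P S g t)"
    and R4_CLT: "\<And>t. t \<in> \<Theta> \<Longrightarrow> conv_distr (P t)
              (\<lambda>n \<omega>. (1 / sqrt (real n)) *\<^sub>R (\<Sum>j=1..n. ldot S g t (\<omega> (j - 1)) (\<omega> j)))
              (normal_vec (fisher P S g t))"
    and R4_tight: "unif_tight \<Theta> P
              (\<lambda>n t \<omega>. (1 / sqrt (real n)) *\<^sub>R (\<Sum>j=1..n. lddot S g t (\<omega> (j - 1)) (\<omega> j) + fisher P S g t))"
    \<comment> \<open>R(5): Lipschitz, uniformly non-degenerate and bounded Fisher information\<close>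
    and R5_Lip: "\<exists>L. \<forall>t1\<in>\<Theta>. \<forall>t2\<in>\<Theta>. norm (fisher P S g t1 - fisher P S g t2) \<le> L * norm (t1 - t2)"
    and R5_nondeg: "\<exists>c>0. \<forall>t\<in>\<Theta>. \<forall>v::real^'d. norm v = 1 \<longrightarrow> c \<le> v \<bullet> (fisher P S g t *v v)"
    and R5_bdd: "\<exists>C. \<forall>t\<in>\<Theta>. \<forall>v::real^'d. norm v = 1 \<longrightarrow> v \<bullet> (fisher P S g t *v v) \<le> C"
    \<comment> \<open>technical measurability (implicit in the paper, see NOTES.md)\<close>
    and meas_ldot: "(\<lambda>(t, x, x'). ldot S g t x x') \<in> borel_measurable borel"
    and meas_fisher: "fisher P S g \<in> borel_measurable borel"
    \<comment> \<open>the tuning parameter\<close>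
    and delta: "1/4 < \<delta>" "\<delta> \<le> 1/2"
  shows "\<forall>s. 0 < s \<and> s \<le> 1 \<longrightarrow>
           (\<forall>t\<in>\<Theta>. conv_distr (P t)
               (\<lambda>n \<omega>. sqrt (real (kk s n)) *\<^sub>R (theta_ss P S g pre \<delta> s n \<omega> - t))
               (normal_vec (matrix_inv (fisher P S g t))))
         \<and> (\<forall>t0\<in>\<Theta>. \<forall>W. loss_function W \<and> bounded (range W) \<longrightarrow>
               (\<exists>L. (\<forall>\<^sub>F \<rho> in at_right 0.
                        (\<lambda>n. SUP t\<in>ball t0 \<rho>. \<integral>\<omega>. W (sqrt (real (kk s n)) *\<^sub>R (theta_ss P S g pre \<delta> s n \<omega> - t)) \<partial>P t)
                          \<longlonglongrightarrow> L \<rho>)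
                  \<and> (L \<longlongrightarrow> (\<integral>\<zeta>. W (\<zeta> v* psd_sqrt (matrix_inv (fisher P S g t0))) \<partial>std_normal_vec)) (at_right 0)))"
proof -
  interpret ar_estimator \<Theta> S g P pre \<delta>
  proof (rule ar_estimator.intro)
    have "\<Theta> \<noteq> {}" using pre_in by blast
    then show "ar_model \<Theta> S g P"
      by (rule ar_model.intro[rotated -1]) (fact Theta model_prob model_indep model_noise R3_S R3_g R3_bounds
            R4_tight R5_Lip R5_nondeg R5_bdd meas_ldot meas_fisher)+
    show "ar_estimator_axioms \<Theta> P pre \<delta>"
      by (rule ar_estimator_axioms.intro) (fact pre_meas pre_in pre_tight delta)+
  qed
  show ?thesis
  proof (intro allI impI)
    fix s :: real assume s: "0 < s \<and> s \<le> 1"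
    show "(\<forall>t\<in>\<Theta>. conv_distr (P t) (\<lambda>n \<omega>. sqrt (real (kk s n)) *\<^sub>R (est s n \<omega> - t)) (normal_vec (Iinv t)))
         \<and> (\<forall>t0\<in>\<Theta>. \<forall>W. loss_function W \<and> bounded (range W) \<longrightarrow>
               (\<exists>L. (\<forall>\<^sub>F \<rho> in at_right 0.
                        (\<lambda>n. SUP t\<in>ball t0 \<rho>. \<integral>\<omega>. W (sqrt (real (kk s n)) *\<^sub>R (est s n \<omega> - t)) \<partial>P t) \<longlonglongrightarrow> L \<rho>)
                  \<and> (L \<longlongrightarrow> (\<integral>\<zeta>. W (\<zeta> v* psd_sqrt (Iinv t0)) \<partial>std_normal_vec)) (at_right 0)))"
    proof (intro conjI ballI allI impI)
      fix t assume t: "t \<in> \<Theta>"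
      show "conv_distr (P t) (\<lambda>n \<omega>. sqrt (real (kk s n)) *\<^sub>R (est s n \<omega> - t)) (normal_vec (Iinv t))"
        unfolding conv_distr_def
      proof (intro allI impI)
        fix f :: "real^'d \<Rightarrow> real" assume f: "continuous_on UNIV f \<and> bounded (range f)"
        show "(\<lambda>n. \<integral>\<omega>. f (sqrt (real (kk s n)) *\<^sub>R (est s n \<omega> - t)) \<partial>P t) \<longlonglongrightarrow> (\<integral>x. f x \<partial>normal_vec (Iinv t))"
          by (rule LIM_zero_cancel, rule estimator_limit[of "{t}"]) (use t s f in auto)
      qed
    next
      fix t0 and W :: "real^'d \<Rightarrow> real" assume t0: "t0 \<in> \<Theta>" and W: "loss_function W \<and> bounded (range W)"
      have f: "continuous_on UNIV W" "bounded (range W)" using W by (auto simp: loss_function_def)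
      obtain B where B: "\<And>x. \<bar>W x\<bar> \<le> B" using f(2) by (auto simp: bounded_iff)
      define r where "r n t = (\<integral>\<omega>. W (sqrt (real (kk s n)) *\<^sub>R (est s n \<omega> - t)) \<partial>P t)" for n t
      define w where "w t = (\<integral>x. W x \<partial>normal_vec (Iinv t))" for t
      have Bint: "\<bar>\<integral>x. W (h x) \<partial>M\<bar> \<le> B" if M: "prob_space M" for M :: "'z measure" and h
      proof (cases "integrable M (\<lambda>x. W (h x))")
        case True
        interpret prob_space M by fact
        have "\<bar>\<integral>x. W (h x) \<partial>M\<bar> \<le> (\<integral>x. \<bar>W (h x)\<bar> \<partial>M)" by simp
        also have "\<dots> \<le> (\<integral>x. B \<partial>M)" using True B by (intro integral_mono) auto
        finally show ?thesis by (simp add: prob_space)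
      next
        case False
        then show ?thesis using B[of undefined] by (simp add: not_integrable_integral_eq)
      qed
      have rB: "\<bar>r n t\<bar> \<le> B" if "t \<in> \<Theta>" for n t unfolding r_def by (rule Bint[OF P_prob[OF that]])
      have wB: "\<bar>w t\<bar> \<le> B" for t unfolding w_def by (rule Bint[OF normal_vec_prob])
      obtain \<rho>0 where \<rho>0: "\<rho>0 > 0" "cball t0 \<rho>0 \<subseteq> \<Theta>"
        using open_Theta t0 open_contains_cball by blast
      define L where "L \<rho> = (SUP t\<in>ball t0 \<rho>. w t)" for \<rho>
      have bw: "bdd_above (w ` ball t0 \<rho>)" for \<rho>
        by (rule bdd_aboveI2[of _ _ B]) (use wB in \<open>simp add: abs_le_iff\<close>)
      have lim: "(\<lambda>n. SUP t\<in>ball t0 \<rho>. r n t) \<longlonglongrightarrow> L \<rho>" if \<rho>: "0 < \<rho>" "\<rho> < \<rho>0" for \<rho>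
      proof (rule LIMSEQ_I)
        fix e :: real assume e: "e > 0"
        have K: "compact (cball t0 \<rho>)" "cball t0 \<rho> \<subseteq> \<Theta>" using \<rho> \<rho>0 by auto
        have br: "bdd_above (r n ` ball t0 \<rho>)" for n
          by (rule bdd_aboveI2[of _ _ B]) (use rB K in \<open>force simp: abs_le_iff\<close>)
        have "\<forall>\<^sub>F n in sequentially. \<forall>t\<in>cball t0 \<rho>. \<bar>r n t - w t\<bar> \<le> e / 2"
          unfolding r_def w_def by (rule estimator_limit_uniform[OF K _ _ f]) (use s e in auto)
        then have "\<forall>\<^sub>F n in sequentially. norm ((SUP t\<in>ball t0 \<rho>. r n t) - L \<rho>) < e"
        proof eventually_elim
          case (elim n)
          have "\<bar>(SUP t\<in>ball t0 \<rho>. r n t) - L \<rho>\<bar> \<le> e / 2"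
            unfolding L_def by (rule abs_SUP_diff_le[OF _ br bw]) (use elim \<rho> in auto)
          then show ?case using e by simp
        qed
        then show "\<exists>no. \<forall>n\<ge>no. norm ((SUP t\<in>ball t0 \<rho>. r n t) - L \<rho>) < e"
          by (simp add: eventually_sequentially)
      qed
      have Llim: "(L \<longlongrightarrow> w t0) (at_right 0)"
      proof (rule tendstoI)
        fix e :: real assume e: "e > 0"
        have "(w \<longlongrightarrow> w t0) (at t0)" unfolding w_def by (rule limit_law_continuous[OF f t0])
        then have "\<forall>\<^sub>F t in at t0. dist (w t) (w t0) < e / 2" using e by (intro tendstoD) auto
        then obtain d where d: "d > 0" "\<And>t. t \<noteq> t0 \<Longrightarrow> dist t t0 < d \<Longrightarrow> dist (w t) (w t0) < e / 2"
          by (auto simp: eventually_at)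
        have "dist (L \<rho>) (w t0) < e" if \<rho>: "0 < \<rho>" "\<rho> < d" for \<rho>
        proof -
          have "\<bar>L \<rho> - (SUP t\<in>ball t0 \<rho>. w t0)\<bar> \<le> e / 2"
            unfolding L_def
          proof (rule abs_SUP_diff_le[OF _ bw])
            fix t assume "t \<in> ball t0 \<rho>"
            then have "dist t t0 < d" using \<rho> by (simp add: dist_commute)
            then show "\<bar>w t - w t0\<bar> \<le> e / 2"
              using d(2)[of t] e by (cases "t = t0") (auto simp: dist_real_def)
          qed (use \<rho> in auto)
          moreover have "(SUP t\<in>ball t0 \<rho>. w t0) = w t0" using \<rho> by (intro cSUP_const) auto
          ultimately show ?thesis using e by (simp add: dist_real_def)
        qed
        then show "\<forall>\<^sub>F \<rho> in at_right 0. dist (L \<rho>) (w t0) < e"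
          unfolding eventually_at_right_field using d(1) by blast
      qed
      have weq: "w t0 = (\<integral>\<zeta>. W (\<zeta> v* psd_sqrt (Iinv t0)) \<partial>std_normal_vec)"
      proof -
        have "psd_root (Iinv t0) (psd_sqrt (Iinv t0))"
          by (rule psd_sqrt_root[OF Iinv_symmetric[OF t0] Iinv_psd[OF t0]])
        then have sym: "transpose (psd_sqrt (Iinv t0)) = psd_sqrt (Iinv t0)" by (simp add: psd_root_def)
        have v: "\<zeta> v* psd_sqrt (Iinv t0) = psd_sqrt (Iinv t0) *v \<zeta>" for \<zeta>
          using transpose_matrix_vector[of "psd_sqrt (Iinv t0)" \<zeta>] unfolding sym by simp
        have mW: "W \<in> borel_measurable borel" by (rule borel_measurable_continuous_onI[OF f(1)])
        have mA: "(\<lambda>z. psd_sqrt (Iinv t0) *v z) \<in> measurable std_normal_vec borel" by simp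
        show ?thesis unfolding w_def normal_vec_def v by (rule integral_distr[OF mA mW])
      qed
      show "\<exists>L. (\<forall>\<^sub>F \<rho> in at_right 0. (\<lambda>n. SUP t\<in>ball t0 \<rho>. \<integral>\<omega>. W (sqrt (real (kk s n)) *\<^sub>R (est s n \<omega> - t)) \<partial>P t) \<longlonglongrightarrow> L \<rho>)
                  \<and> (L \<longlongrightarrow> (\<integral>\<zeta>. W (\<zeta> v* psd_sqrt (Iinv t0)) \<partial>std_normal_vec)) (at_right 0)"
      proof (intro exI[of _ L] conjI)
        show "\<forall>\<^sub>F \<rho> in at_right 0. (\<lambda>n. SUP t\<in>ball t0 \<rho>. \<integral>\<omega>. W (sqrt (real (kk s n)) *\<^sub>R (est s n \<omega> - t)) \<partial>P t) \<longlonglongrightarrow> L \<rho>"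
          unfolding r_def[symmetric] eventually_at_right_field using lim \<rho>0(1) by blast
        show "(L \<longlongrightarrow> (\<integral>\<zeta>. W (\<zeta> v* psd_sqrt (Iinv t0)) \<partial>std_normal_vec)) (at_right 0)"
          using Llim unfolding weq .
      qed
    qed
  qed
qed

end
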